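(* Let $\mathcal{T}$ be a lattice triangulation of a $d$-dimensional lattice polytope $P\subset\mathbb{R}^d$ such that every face of $\mathcal{T}$ has volume at most $V$, where $V$ is a prime number. Then for every $c\in d!\,\mathbb{N}$ (positive multiple of $d!$), the dilation $c\mathcal{T}$ has a regular refinement in which every full-dimensional cell has volume less than $V$.
   Context: The volume of a simplex $F$ of $\mathcal{T}$ is its normalized volume with respect to the lattice $\mathbb{Z}^d\cap\operatorname{aff}(F)$, equivalently the index of the lattice affinely generated by the vertices of $F$ in $\mathbb{Z}^d\cap\operatorname{aff}(F)$ (unimodular simplices have volume $1$). $c\mathcal{T}=\{c\Delta:\Delta\in\mathcal{T}\}$. A refinement $\mathcal{T}'$ of $c\mathcal{T}$ (a lattice triangulation of $cP$ each of whose cells lies in a cell of $c\mathcal{T}$) is a regular refinement if there is a weight vector $\omega$ on the lattice points of $cP$ such that for every cell $C$ of $c\mathcal{T}$, the restriction of $\mathcal{T}'$ to $C$ is the regular subdivision of $C$ induced by $\omega$ restricted to the lattice points of $C$. (A regular refinement of a regular triangulation is regular.) *)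

theory Defs
  imports "HOL-Analysis.Analysis" "HOL-Computational_Algebra.Primes"
begin

definition int_lattice :: "(real ^ 'n) set" where
  "int_lattice = {x. \<forall>i. x $ i \<in> \<int>}"

definition lattice_polytope :: "(real ^ 'n) set \<Rightarrow> bool" where
  "lattice_polytope P \<longleftrightarrow> (\<exists>S. finite S \<and> S \<subseteq> int_lattice \<and> P = convex hull S)"

definition vertices :: "(real ^ 'n) set \<Rightarrow> (real ^ 'n) set" where
  "vertices F = {v. v extreme_point_of F}"

text \<open>A triangulation contains all faces of its simplices, the empty face included
  (\<open>simplicial_complex\<close> is closed under \<open>face_of\<close>).\<close>

definition lattice_triangulation :: "(real ^ 'n) set set \<Rightarrow> (real ^ 'n) set \<Rightarrow> bool" where
  "lattice_triangulation \<T> P \<longleftrightarrow>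
     simplicial_complex \<T> \<and> \<Union>\<T> = P \<and> (\<forall>F\<in>\<T>. vertices F \<subseteq> int_lattice)"

text \<open>The translation lattice of the affine lattice generated by a finite set \<open>W\<close>: the
  differences of two integer affine combinations of \<open>W\<close> are exactly the integer combinations
  with coefficient sum 0.\<close>

definition aff_lattice_dir :: "(real ^ 'n) set \<Rightarrow> (real ^ 'n) set" where
  "aff_lattice_dir W = {(\<Sum>v\<in>W. of_int (a v) *\<^sub>R v) | a :: real ^ 'n \<Rightarrow> int. (\<Sum>v\<in>W. a v) = 0}"

text \<open>The volume of a lattice simplex \<open>F\<close> is the index of the affine lattice generated by its
  vertices in \<open>\<int>\<^sup>d \<inter> aff F\<close>. For a nonempty lattice simplex both lattices have rank \<open>dim F\<close>, so
  the quotient is finite and the cardinality is the genuine index; it is at least 1, and the empty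
  face gets the harmless value 0.\<close>

definition simplex_volume :: "(real ^ 'n) set \<Rightarrow> nat" where
  "simplex_volume F =
     card ((int_lattice \<inter> affine hull F) // {(x, y). x - y \<in> aff_lattice_dir (vertices F)})"

definition dilate :: "nat \<Rightarrow> (real ^ 'n) set \<Rightarrow> (real ^ 'n) set" where
  "dilate c X = (\<lambda>x. real c *\<^sub>R x) ` X"

definition lifted_polytope ::
    "(real ^ 'n \<Rightarrow> real) \<Rightarrow> (real ^ 'n) set \<Rightarrow> ((real ^ 'n) \<times> real) set" where
  "lifted_polytope \<omega> A = convex hull ((\<lambda>a. (a, \<omega> a)) ` A)"

text \<open>Faces that minimise a linear functional with positive last
  coordinate (normalised to 1); these are the nonempty lower faces.\<close>

definition lower_face :: "((real ^ 'n) \<times> real) set \<Rightarrow> ((real ^ 'n) \<times> real) set \<Rightarrow> bool" where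
  "lower_face G Q \<longleftrightarrow>
     (\<exists>u. G = {z \<in> Q. \<forall>z'\<in>Q. (u, 1) \<bullet> z \<le> (u, 1) \<bullet> z'})"

text \<open>The empty cell is inserted to match the convention for triangulations above.\<close>

definition regular_subdivision ::
    "(real ^ 'n \<Rightarrow> real) \<Rightarrow> (real ^ 'n) set \<Rightarrow> (real ^ 'n) set set" where
  "regular_subdivision \<omega> A = insert {} {fst ` G | G. lower_face G (lifted_polytope \<omega> A)}"

definition refines :: "(real ^ 'n) set set \<Rightarrow> (real ^ 'n) set set \<Rightarrow> bool" where
  "refines \<T>' \<S> \<longleftrightarrow> (\<forall>F\<in>\<T>'. \<exists>C\<in>\<S>. F \<subseteq> C)"

text \<open>\<open>\<S>\<close> is a lattice triangulation of a polytope, or a dilate of one, with support \<open>Q\<close>.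
  Only the values of \<open>\<omega>\<close> on the lattice points of \<open>Q\<close> matter.\<close>

definition regular_refinement ::
    "(real ^ 'n) set set \<Rightarrow> (real ^ 'n) set set \<Rightarrow> (real ^ 'n) set \<Rightarrow> bool" where
  "regular_refinement \<T>' \<S> Q \<longleftrightarrow>
     lattice_triangulation \<T>' Q \<and> refines \<T>' \<S> \<and>
     (\<exists>\<omega> :: real ^ 'n \<Rightarrow> real. \<forall>C\<in>\<S>.
        {F \<in> \<T>'. F \<subseteq> C} = regular_subdivision \<omega> (C \<inter> int_lattice))"

end

theory Submission
  imports Defs
begin

text \<open>
  Let \<open>S\<close> be a simplex of volume \<open>V\<close> with vertices \<open>v\<^sub>j\<close>. As \<open>V\<close> is prime, the lattice points of
  \<open>aff S\<close> modulo the lattice of \<open>S\<close> form a cyclic group of order \<open>V\<close>, so all nonzero classes have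
  fractional barycentric coordinates with the same support, spanning a face \<open>D\<close> of \<open>S\<close>. Choose for
  every such face \<open>D\<close> a lattice point \<open>m = (1/V) \<Sum> a\<^sub>j v\<^sub>j\<close> with \<open>0 < a\<^sub>j < V\<close> on \<open>D\<close>. It lies in \<open>h D\<close> for
  an integer \<open>h \<le> d\<close>, whence \<open>h\<close> divides \<open>c\<close>. Starring \<open>c S\<close> at \<open>(c/h) m\<close> gives the cones over the facets
  opposite to the vertices \<open>v\<^sub>i\<close> of \<open>D\<close>, and the lattice generated by \<open>m\<close> and the remaining \<open>v\<^sub>j\<close> has
  index \<open>a\<^sub>i < V\<close>. It remains to triangulate the cones unimodularly for these lattices, and the
  simplices of volume \<open>\<noteq> V\<close> unimodularly for the lattice of their vertices.

  The points of such a lattice in a cone are the natural solutions \<open>z\<close> of \<open>h z\<^sub>0 + z\<^sub>1 + \<dots> + z\<^sub>N = c\<close>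
  with prescribed zeros. They are weighted by a quadratic form that is lexicographic in \<open>z\<close>. If
  \<open>x + y = x' + y'\<close> and \<open>x, y\<close> lie in one cell, then the weights of \<open>x, y\<close> sum to at most those of
  \<open>x', y'\<close>. Exchanging coordinates this way shows that, coordinate by coordinate, the projection of a
  cell to the first \<open>j + 1\<close> coordinates splits at most one fibre over the projection to the first \<open>j\<close>,
  and that one into two consecutive values; hence cells are unimodular simplices. All data depend
  only on global barycentric coordinates, so the weight is globally defined.
\<close>

section \<open>Sets of integer vectors closed under exchange\<close>

text \<open>Unimodularity is not read off from a determinant. Real coefficients on the points of a
  cell whose total and coordinate moments are integers are shown to be integers themselves: at each
  level one fibre at most splits, into values n and n + 1, so the moment isolates the coefficient
  sum of its upper half. The same fact gives affine independence, as a nontrivial relation can be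
  scaled to have a coefficient 1/2 while its total and moments stay 0. The box point is put at
  coordinate 0, the first one, because it alone has weight h in the equation for the total; all
  later coordinates have weight 1, so a remainder can be redistributed among them freely. Squares
  alone would confine a fibre to two consecutive values but not prevent several fibres from
  splitting; the mixed terms \<open>pre c j z * z j\<close> give each prefix its own increments. The
  obstacle is that an exchange of coordinates must not leave the domain where the weight is given by
  the cost. A steep concave term therefore confines each cell to one cone, and every natural
  solution supported there is an admissible representation again.\<close>

lemma sum_bounded_split:
  fixes w :: "'a \<Rightarrow> nat"
  assumes "finite L" "k \<le> sum w L"
  shows "\<exists>w1. (\<forall>l. w1 l \<le> w l) \<and> sum w1 L = k"
  using assms
proof (induction L arbitrary: k rule: finite_induct)
  case empty
  then show ?case by (intro exI[of _ "\<lambda>_. 0"]) auto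
next
  case (insert x F)
  have "k - min k (w x) \<le> sum w F" using insert by auto
  from insert.IH[OF this] obtain w1 where w1: "\<forall>l. w1 l \<le> w l" "sum w1 F = k - min k (w x)" by blast
  have "sum (w1(x := min k (w x))) F = sum w1 F"
    using insert by (intro sum.cong) auto
  then show ?case using w1 insert
    by (intro exI[of _ "w1(x := min k (w x))"]) auto
qed

lemma geometric_tail:
  fixes q :: nat
  assumes "j \<le> N"
  shows "(\<Sum>i\<in>{j<..N}. (q + 1) ^ (N - i) * q) + 1 = (q + 1) ^ (N - j)"
  using assms
proof (induction "N - j" arbitrary: j)
  case 0
  then show ?case by simp
next
  case (Suc n)
  have e: "{j<..N} = insert (Suc j) {Suc j<..N}" using Suc by auto
  have "(\<Sum>i\<in>{Suc j<..N}. (q + 1) ^ (N - i) * q) + 1 = (q + 1) ^ (N - Suc j)"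
    using Suc by (intro Suc.hyps) auto
  moreover have "N - j = Suc (N - Suc j)" using Suc by auto
  ultimately show ?case unfolding e by (simp add: algebra_simps)
qed

text \<open>The weight of level \<open>j\<close> is one more than all later levels together can
  reach with entries at most \<open>q\<close>, so an excess at \<open>j\<close> cannot be
  compensated later.\<close>

lemma lexicographic_le:
  fixes \<alpha> \<beta> :: "nat \<Rightarrow> nat"
  assumes le: "(\<Sum>i\<le>N. (q + 1) ^ (N - i) * \<alpha> i) \<le> (\<Sum>i\<le>N. (q + 1) ^ (N - i) * \<beta> i)"
    and eq: "\<And>i. i < j \<Longrightarrow> \<alpha> i = \<beta> i"
    and bd: "\<And>i. i \<le> N \<Longrightarrow> \<beta> i \<le> q"
    and j: "j \<le> N"
  shows "\<alpha> j \<le> \<beta> j"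
proof (rule ccontr)
  assume "\<not> ?thesis"
  then have a: "\<alpha> j \<ge> \<beta> j + 1" by simp
  have split: "(\<Sum>i\<le>N. F i) = (\<Sum>i<j. F i) + F j + (\<Sum>i\<in>{j<..N}. F i)" for F :: "nat \<Rightarrow> nat"
  proof -
    have "{..N} = insert j ({..<j} \<union> {j<..N})" using j by auto
    moreover have "sum F (insert j ({..<j} \<union> {j<..N})) = F j + sum F ({..<j} \<union> {j<..N})"
      by (intro sum.insert) auto
    moreover have "sum F ({..<j} \<union> {j<..N}) = sum F {..<j} + sum F {j<..N}"
      by (intro sum.union_disjoint) auto
    ultimately show ?thesis by simp
  qed
  have 1: "(\<Sum>i<j. (q + 1) ^ (N - i) * \<alpha> i) = (\<Sum>i<j. (q + 1) ^ (N - i) * \<beta> i)"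
    using eq by (intro sum.cong) auto
  have 2: "(\<Sum>i\<in>{j<..N}. (q + 1) ^ (N - i) * \<beta> i) \<le> (\<Sum>i\<in>{j<..N}. (q + 1) ^ (N - i) * q)"
    using bd by (intro sum_mono) auto
  have 3: "(q + 1) ^ (N - j) * (\<beta> j + 1) \<le> (q + 1) ^ (N - j) * \<alpha> j"
    using a by (intro mult_left_mono) auto
  show False
    using le 1 2 3 geometric_tail[OF j, of q] unfolding split by simp
qed

lemma base_expansion_less:
  fixes b :: nat
  assumes "\<And>i. i < j \<Longrightarrow> x i < b"
  shows "(\<Sum>i<j. b ^ i * x i) < b ^ j"
  using assms
proof (induction j)
  case (Suc j)
  have "b ^ j * (x j + 1) \<le> b ^ j * b"
    using Suc.prems[of j] by (intro mult_left_mono) auto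
  moreover have "(\<Sum>i<j. b ^ i * x i) < b ^ j" using Suc by auto
  ultimately show ?case by (simp add: algebra_simps)
qed simp

lemma base_expansion_unique:
  fixes b :: nat
  assumes "\<And>i. i < j \<Longrightarrow> x i < b" "\<And>i. i < j \<Longrightarrow> y i < b"
    and "(\<Sum>i<j. b ^ i * x i) = (\<Sum>i<j. b ^ i * y i)"
  shows "\<forall>i<j. x i = y i"
  using assms
proof (induction j)
  case (Suc j)
  let ?s = "\<lambda>x. \<Sum>i<j. b ^ i * x i"
  have lt: "?s x < b ^ j" "?s y < b ^ j"
    using Suc.prems by (auto intro!: base_expansion_less)
  have e: "?s x + b ^ j * x j = ?s y + b ^ j * y j" using Suc.prems(3) by simp
  have "b ^ j \<noteq> 0" using lt by linarith
  then have "(?s x + b ^ j * x j) div b ^ j = x j" "(?s y + b ^ j * y j) div b ^ j = y j"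
    using lt div_mult_self2[of "b ^ j"] by simp_all
  then have xy: "x j = y j" using e by metis
  then have "?s x = ?s y" using e by simp
  then have "\<forall>i<j. x i = y i" by (intro Suc.IH Suc.prems) auto
  then show ?case using xy by (auto simp: less_Suc_eq)
qed simp

text \<open>Induction on the prefix length. Classes that are constant in coordinate \<open>j\<close>
  contribute integers to the moment. The one class that may split, with values \<open>n\<close> and
  \<open>n + 1\<close>, contributes \<open>n\<close> times its total plus the total of its upper
  half, so both halves have integer totals.\<close>

lemma prefix_sums_Ints:
  fixes f :: "'a \<Rightarrow> nat \<Rightarrow> nat" and r :: "'a \<Rightarrow> real"
  assumes fin: "finite X"
    and step: "\<And>j x y. \<lbrakk>j \<le> N; x \<in> X; y \<in> X; \<forall>i<j. f x i = f y i\<rbrakk> \<Longrightarrow> f x j \<le> f y j + 1"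
    and unique: "\<And>j x x' y y'. \<lbrakk>j \<le> N; x \<in> X; x' \<in> X; y \<in> X; y' \<in> X;
        \<forall>i<j. f x i = f x' i; f x j < f x' j; \<forall>i<j. f y i = f y' i; f y j < f y' j\<rbrakk>
        \<Longrightarrow> \<forall>i<j. f x i = f y i"
    and sum_r: "sum r X \<in> \<int>"
    and sum_rf: "\<And>j. j \<le> N \<Longrightarrow> (\<Sum>x\<in>X. r x * f x j) \<in> \<int>"
  shows "\<lbrakk>j \<le> Suc N; p \<in> X\<rbrakk> \<Longrightarrow> sum r {x \<in> X. \<forall>i<j. f x i = f p i} \<in> \<int>"
proof (induction j arbitrary: p)
  case 0
  then show ?case using sum_r by simp
next
  case (Suc j)
  define P where "P = {x \<in> X. \<forall>i<j. f x i = f p i}"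
  have IH: "q \<in> X \<Longrightarrow> sum r {x \<in> X. \<forall>i<j. f x i = f q i} \<in> \<int>" for q
    using Suc by auto
  have cls: "{x \<in> X. \<forall>i<Suc j. f x i = f p i} = {x \<in> P. f x j = f p j}"
    unfolding P_def by (auto simp: less_Suc_eq)
  have finP: "finite P" and PX: "P \<subseteq> X" unfolding P_def using fin by auto
  have P_Int: "sum r P \<in> \<int>" using IH[OF Suc.prems(2)] P_def by simp
  show ?case
  proof (cases "\<forall>x\<in>P. f x j = f p j")
    case True
    then have "{x \<in> P. f x j = f p j} = P" by auto
    then show ?thesis using cls P_Int by simp
  next
    case False
    then obtain x0 where x0: "x0 \<in> P" "f x0 j \<noteq> f p j" by auto
    have pP: "p \<in> P" using Suc.prems by (simp add: P_def)
    have same: "\<forall>i<j. f x i = f y i" if "x \<in> P" "y \<in> P" for x y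
      using that by (auto simp: P_def)
    \<comment> \<open>\<open>P\<close> splits at coordinate \<open>j\<close>, so by
      \<open>unique\<close> a second class that splits would have the prefix of
      \<open>P\<close>.\<close>
    have const: "f x j = f y j" if "x \<in> X - P" "y \<in> X" "\<forall>i<j. f x i = f y i" for x y
    proof (rule ccontr)
      assume ne: "f x j \<noteq> f y j"
      have yP: "y \<notin> P" using that by (auto simp: P_def)
      obtain a b where ab: "a \<in> X - P" "b \<in> X - P" "\<forall>i<j. f a i = f b i" "f a j < f b j"
      proof (cases "f x j < f y j")
        case True
        then show ?thesis using that yP \<open>x \<in> X - P\<close> \<open>y \<in> X\<close> \<open>\<forall>i<j. f x i = f y i\<close> by blast
      next
        case False
        then have "f y j < f x j" using ne by simp
        then show ?thesis using that yP \<open>x \<in> X - P\<close> \<open>y \<in> X\<close> \<open>\<forall>i<j. f x i = f y i\<close>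
          by (metis DiffI)
      qed
      obtain a' b' where ab': "a' \<in> P" "b' \<in> P" "f a' j < f b' j"
      proof (cases "f x0 j < f p j")
        case True then show ?thesis using that[of x0 p] x0 pP by auto
      next
        case False then show ?thesis using that[of p x0] x0 pP by auto
      qed
      have "\<forall>i<j. f a' i = f a i"
        using unique[of j a' b' a b] ab ab' same[of a' b'] PX Suc.prems by auto
      then have "a \<in> P" using ab(1) ab'(1) by (auto simp: P_def)
      then show False using ab by auto
    qed
    have rest: "(\<Sum>x\<in>X - P. r x * f x j) \<in> \<int>"
    proof -
      let ?pr = "\<lambda>x. map (f x) [0..<j]"
      have pr: "?pr x = ?pr y \<longleftrightarrow> (\<forall>i<j. f x i = f y i)" for x y
        by (auto simp: list_eq_iff_nth_eq)
      have "(\<Sum>x\<in>X - P. r x * f x j) =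
          (\<Sum>q\<in>?pr ` (X - P). \<Sum>x\<in>{x \<in> X - P. ?pr x = q}. r x * f x j)"
        using fin by (intro sum.image_gen) auto
      also have "\<dots> \<in> \<int>"
      proof (rule Ints_sum)
        fix q assume "q \<in> ?pr ` (X - P)"
        then obtain y where y: "y \<in> X - P" "q = ?pr y" by auto
        have "{x \<in> X - P. ?pr x = q} = {x \<in> X. \<forall>i<j. f x i = f y i}"
          unfolding y pr using y by (auto simp: P_def)
        moreover have "(\<Sum>x\<in>{x \<in> X. \<forall>i<j. f x i = f y i}. r x * f x j) =
            (\<Sum>x\<in>{x \<in> X. \<forall>i<j. f x i = f y i}. r x * f y j)"
          using const[OF y(1)] by (intro sum.cong refl) (metis (mono_tags, lifting) mem_Collect_eq)
        moreover have "(\<Sum>x\<in>{x \<in> X. \<forall>i<j. f x i = f y i}. r x * f y j) =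
            sum r {x \<in> X. \<forall>i<j. f x i = f y i} * f y j"
          by (simp add: sum_distrib_right)
        moreover have "\<dots> \<in> \<int>"
          using IH[of y] y by (intro Ints_mult) auto
        ultimately show "(\<Sum>x\<in>{x \<in> X - P. ?pr x = q}. r x * f x j) \<in> \<int>" by simp
      qed
      finally show ?thesis .
    qed
    have "(\<Sum>x\<in>X. r x * f x j) = (\<Sum>x\<in>X - P. r x * f x j) + (\<Sum>x\<in>P. r x * f x j)"
      using PX fin by (intro sum.subset_diff) auto
    then have Pf: "(\<Sum>x\<in>P. r x * f x j) \<in> \<int>"
      using rest sum_rf[of j] Suc.prems by (metis Ints_diff Suc_le_mono add_diff_cancel_left')
    \<comment> \<open>\<open>x0\<close> and \<open>p\<close> differ at coordinate \<open>j\<close>;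
      by \<open>step\<close> their values are consecutive and no third value fits.\<close>
    define n where "n = min (f x0 j) (f p j)"
    have vals: "f x j = n \<or> f x j = n + 1" if "x \<in> P" for x
    proof -
      have st: "f a j \<le> f b j + 1" if "a \<in> P" "b \<in> P" for a b
        using step[OF _ _ _ same[OF that]] that PX Suc.prems(1) by auto
      show ?thesis
        using st[OF that x0(1)] st[OF x0(1) that] st[OF that pP] st[OF pP that] st[OF x0(1) pP] st[OF pP x0(1)] x0(2)
        unfolding n_def by linarith
    qed
    have "(\<Sum>x\<in>P. r x * f x j) = (\<Sum>x\<in>P. n * r x + (if f x j = n + 1 then r x else 0))"
      using vals by (intro sum.cong) (auto simp: algebra_simps)
    also have "\<dots> = n * sum r P + sum r {x \<in> P. f x j = n + 1}"
      using finP by (simp add: sum.distrib sum_distrib_left sum.inter_filter)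
    finally have up: "sum r {x \<in> P. f x j = n + 1} \<in> \<int>"
      using Pf P_Int by (metis Ints_diff Ints_mult Ints_of_nat add_diff_cancel_left')
    have "sum r P = sum r {x \<in> P. f x j = n + 1} + sum r {x \<in> P. f x j = n}"
    proof -
      have "P = {x \<in> P. f x j = n + 1} \<union> {x \<in> P. f x j = n}" using vals by auto
      then have "sum r P = sum r ({x \<in> P. f x j = n + 1} \<union> {x \<in> P. f x j = n})" by simp
      also have "\<dots> = sum r {x \<in> P. f x j = n + 1} + sum r {x \<in> P. f x j = n}"
        using finP by (intro sum.union_disjoint) auto
      finally show ?thesis .
    qed
    then have "sum r {x \<in> P. f x j = n} = sum r P - sum r {x \<in> P. f x j = n + 1}" by linarith
    then have lo: "sum r {x \<in> P. f x j = n} \<in> \<int>"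
      using Ints_diff[OF P_Int up] by simp
    show ?thesis using vals[OF pP]
    proof
      assume "f p j = n" then show ?thesis unfolding cls using lo by simp
    next
      assume "f p j = n + 1" then show ?thesis unfolding cls using up by simp
    qed
  qed
qed

section \<open>A lexicographic quadratic cost on integer vectors\<close>

definition pre :: "nat \<Rightarrow> nat \<Rightarrow> (nat \<Rightarrow> nat) \<Rightarrow> nat" where
  "pre c j z = (\<Sum>i<j. (c + 1) ^ i * z i)"

text \<open>
  For fixed coordinates before \<open>j\<close> the increments of the cost of level \<open>j\<close> in \<open>z j\<close> are
  \<open>(c + 1) ^ (N + 1) * (2 * z j + 1) + pre c j z\<close>; by uniqueness of the expansion in base \<open>c + 1\<close> they
  are different for different prefixes.
\<close>

definition level_cost :: "nat \<Rightarrow> nat \<Rightarrow> nat \<Rightarrow> (nat \<Rightarrow> nat) \<Rightarrow> nat" where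
  "level_cost N c j z = (c + 1) ^ (N + 1) * (z j)\<^sup>2 + pre c j z * z j"

definition level_bound :: "nat \<Rightarrow> nat \<Rightarrow> nat" where
  "level_bound N c = (c + 1) ^ (N + 1) * c\<^sup>2 + (c + 1) ^ (N + 1) * c"

text \<open>The base contains twice the level bound because costs are compared for sums of two
  vectors.\<close>

definition cost :: "nat \<Rightarrow> nat \<Rightarrow> (nat \<Rightarrow> nat) \<Rightarrow> nat" where
  "cost N c z = (\<Sum>j\<le>N. (2 * level_bound N c + 1) ^ (N - j) * level_cost N c j z)"

definition cost_bound :: "nat \<Rightarrow> nat \<Rightarrow> nat" where
  "cost_bound N c = (\<Sum>j\<le>N. (2 * level_bound N c + 1) ^ (N - j) * level_bound N c)"

lemma pre_less:
  assumes "\<And>i. i \<le> N \<Longrightarrow> z i \<le> c" "j \<le> Suc N"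
  shows "pre c j z < (c + 1) ^ (N + 1)"
proof -
  have "pre c j z < (c + 1) ^ j" unfolding pre_def
    using assms by (intro base_expansion_less) (auto simp: less_Suc_eq_le)
  also have "\<dots> \<le> (c + 1) ^ (N + 1)" using assms by (intro power_increasing) auto
  finally show ?thesis .
qed

lemma level_cost_le:
  assumes "\<And>i. i \<le> N \<Longrightarrow> z i \<le> c" "j \<le> N"
  shows "level_cost N c j z \<le> level_bound N c"
  unfolding level_cost_def level_bound_def
  using assms pre_less[of N z c j] by (intro add_mono mult_mono power_mono) auto

lemma cost_le:
  assumes "\<And>i. i \<le> N \<Longrightarrow> z i \<le> c"
  shows "cost N c z \<le> cost_bound N c"
  unfolding cost_def cost_bound_def
  using assms level_cost_le by (intro sum_mono mult_left_mono) auto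

text \<open>Coordinate \<open>0\<close> belongs to a box point of height \<open>h\<close>, coordinate \<open>j \<ge> 1\<close> to the vertex \<open>v j\<close>.\<close>

definition reps :: "nat \<Rightarrow> nat \<Rightarrow> nat set \<Rightarrow> nat \<Rightarrow> (nat \<Rightarrow> nat) set" where
  "reps N c J h = {z. (\<forall>j. j \<notin> J \<longrightarrow> z j = 0) \<and> h * z 0 + (\<Sum>j=1..N. z j) = c}"

lemma reps_le:
  assumes "z \<in> reps N c J h" "h > 0" "i \<le> N"
  shows "z i \<le> c"
proof (cases "i = 0")
  case True
  have "z 0 \<le> h * z 0" using assms by simp
  also have "\<dots> \<le> c" using assms by (simp add: reps_def)
  finally show ?thesis using True by simp
next
  case False
  then have "z i \<le> (\<Sum>j=1..N. z j)" using assms by (intro member_le_sum) auto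
  then show ?thesis using assms by (simp add: reps_def)
qed

text \<open>\<open>exchange\<close> is all that is kept of minimality in a cell: a linear tilt is
  additive, so it drops out when two pairs of points have the same sum.\<close>

context
  fixes N c :: nat and J :: "nat set" and h :: nat and X :: "'a set" and f :: "'a \<Rightarrow> nat \<Rightarrow> nat"
  assumes h: "h > 0" and JN: "J \<subseteq> {..N}"
    and X: "\<And>x. x \<in> X \<Longrightarrow> f x \<in> reps N c J h"
    and exchange: "\<And>x y z z'. \<lbrakk>x \<in> X; y \<in> X; z \<in> reps N c J h; z' \<in> reps N c J h;
        \<And>j. f x j + f y j = z j + z' j\<rbrakk> \<Longrightarrow> cost N c (f x) + cost N c (f y) \<le> cost N c z + cost N c z'"
begin

lemma X_le: "x \<in> X \<Longrightarrow> i \<le> N \<Longrightarrow> f x i \<le> c"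
  using reps_le[OF X h] by blast

definition hw :: "nat \<Rightarrow> nat" where "hw j = (if j = 0 then h else 1)"

lemma reps_iff: "z \<in> reps N c J h \<longleftrightarrow> (\<forall>j. j \<notin> J \<longrightarrow> z j = 0) \<and> (\<Sum>j\<le>N. hw j * z j) = c"
proof -
  have "{..N} = insert 0 {1..N}" by auto
  then have "(\<Sum>j\<le>N. hw j * z j) = h * z 0 + (\<Sum>j=1..N. hw j * z j)"
    by (simp add: hw_def)
  also have "(\<Sum>j=1..N. hw j * z j) = (\<Sum>j=1..N. z j)"
    by (intro sum.cong) (auto simp: hw_def)
  finally show ?thesis by (simp add: reps_def)
qed

lemma hw_split:
  assumes "j \<le> N"
  shows "(\<Sum>i\<le>N. hw i * z i) = (\<Sum>i<j. hw i * z i) + hw j * z j + (\<Sum>i\<in>{j<..N}. z i)"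
proof -
  have "{..N} = insert j ({..<j} \<union> {j<..N})" using assms by auto
  moreover have "sum F (insert j ({..<j} \<union> {j<..N})) = F j + sum F ({..<j} \<union> {j<..N})" for F :: "nat \<Rightarrow> nat"
    by (intro sum.insert) auto
  moreover have "sum F ({..<j} \<union> {j<..N}) = sum F {..<j} + sum F {j<..N}" for F :: "nat \<Rightarrow> nat"
    by (intro sum.union_disjoint) auto
  moreover have "(\<Sum>i\<in>{j<..N}. hw i * z i) = (\<Sum>i\<in>{j<..N}. z i)"
    by (intro sum.cong) (auto simp: hw_def)
  ultimately show ?thesis by simp
qed

text \<open>The pair is replaced by one with the same prefixes, with \<open>n\<close> and
  \<open>m\<close> at coordinate \<open>j\<close>, and with the later coordinates of
  \<open>x\<close> and \<open>y\<close> pooled and redistributed. \<open>x'\<close> and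
  \<open>y'\<close> witness that the prefixes continued by \<open>n\<close> and \<open>m\<close> do
  not exceed the total \<open>c\<close>. Levels before \<open>j\<close> keep their cost and later
  ones are dominated, so minimality is felt at level \<open>j\<close>.\<close>

lemma level_exchange:
  assumes j: "j \<le> N" and x: "x \<in> X" and y: "y \<in> X"
    and n: "n + m = f x j + f y j" "n \<le> f x' j" "m \<le> f y' j"
    and x': "x' \<in> X" "\<forall>i<j. f x' i = f x i"
    and y': "y' \<in> X" "\<forall>i<j. f y' i = f y i"
  shows "level_cost N c j (f x) + level_cost N c j (f y) \<le>
    (c + 1) ^ (N + 1) * n\<^sup>2 + pre c j (f x) * n + (c + 1) ^ (N + 1) * m\<^sup>2 + pre c j (f y) * m"
proof -
  note iff = reps_iff[THEN iffD1, OF X] 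
  define w where "w l = f x l + f y l" for l
  have tot: "(\<Sum>i<j. hw i * f u i) + hw j * f u j + (\<Sum>i\<in>{j<..N}. f u i) = c" if "u \<in> X" for u
    using iff[OF that] hw_split[OF j, of "f u"] by simp
  have px: "(\<Sum>i<j. hw i * f x' i) = (\<Sum>i<j. hw i * f x i)"
    "(\<Sum>i<j. hw i * f y' i) = (\<Sum>i<j. hw i * f y i)"
    using x' y' by (auto intro: sum.cong)
  \<comment> \<open>What the first new vector still lacks to the total \<open>c\<close>. Coordinates
    after \<open>j\<close> have weight 1, so any part of the pool with this sum will do.\<close>
  define k where "k = c - ((\<Sum>i<j. hw i * f x i) + hw j * n)"
  have mn: "hw j * n \<le> hw j * f x' j" "hw j * m \<le> hw j * f y' j"
    using n by (auto intro: mult_left_mono)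
  have hn: "hw j * n + hw j * m = hw j * f x j + hw j * f y j"
    using n(1) by (metis distrib_left)
  have k1: "(\<Sum>i<j. hw i * f x i) + hw j * n + k = c"
    using tot[OF x'(1)] px mn unfolding k_def by linarith
  have k2: "k \<le> (\<Sum>i\<in>{j<..N}. w i)"
    using k1 tot[OF y'(1)] px mn tot[OF x] tot[OF y] hn unfolding w_def sum.distrib by linarith
  obtain w1 where w1: "\<forall>l. w1 l \<le> w l" "sum w1 {j<..N} = k"
    using sum_bounded_split[OF _ k2] by auto
  define zx where "zx l = (if l < j then f x l else if l = j then n else w1 l)" for l
  define zy where "zy l = (if l < j then f y l else if l = j then m else w l - w1 l)" for l
  have out: "f x l = 0 \<and> f y l = 0 \<and> f x' l = 0 \<and> f y' l = 0" if "l \<notin> J" for l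
    using iff x y x' y' that by blast
  have add: "f x l + f y l = zx l + zy l" for l
    using n(1) w1(1) by (auto simp: zx_def zy_def w_def)
  have s: "(\<Sum>i<j. hw i * zx i) = (\<Sum>i<j. hw i * f x i)" "(\<Sum>i<j. hw i * zy i) = (\<Sum>i<j. hw i * f y i)"
    by (auto intro: sum.cong simp: zx_def zy_def)
  have s2: "(\<Sum>i\<in>{j<..N}. zx i) = k"
    unfolding w1(2)[symmetric] by (auto intro: sum.cong simp: zx_def)
  have sx: "(\<Sum>i\<le>N. hw i * zx i) = c"
    unfolding hw_split[OF j] s s2 using k1 by (simp add: zx_def)
  have "(\<Sum>i\<le>N. hw i * zx i) + (\<Sum>i\<le>N. hw i * zy i) = (\<Sum>i\<le>N. hw i * f x i) + (\<Sum>i\<le>N. hw i * f y i)"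
    unfolding sum.distrib[symmetric] distrib_left[symmetric] add ..
  then have sy: "(\<Sum>i\<le>N. hw i * zy i) = c"
    using sx iff[OF x] iff[OF y] by simp
  have o: "zx l = 0 \<and> zy l = 0" if "l \<notin> J" for l
  proof -
    have "w l = 0" using out[OF that] by (simp add: w_def)
    then have "w1 l = 0" using w1(1) by (metis le_zero_eq)
    moreover have "n = 0 \<and> m = 0" if "l = j" using n out[OF \<open>l \<notin> J\<close>] that by auto
    ultimately show ?thesis using out[OF that] by (auto simp: zx_def zy_def w_def)
  qed
  have R: "zx \<in> reps N c J h" "zy \<in> reps N c J h"
    unfolding reps_iff using sx sy o by auto
  have ex: "cost N c (f x) + cost N c (f y) \<le> cost N c zx + cost N c zy"
    using exchange[OF x y R add] .
  let ?q = "2 * level_bound N c"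
  have pre_eq: "pre c i zx = pre c i (f x)" "pre c i zy = pre c i (f y)" if "i \<le> j" for i
    using that unfolding pre_def by (auto intro!: sum.cong simp: zx_def zy_def)
  have "level_cost N c j (f x) + level_cost N c j (f y) \<le> level_cost N c j zx + level_cost N c j zy"
  proof (rule lexicographic_le[where q = ?q and N = N and j = j
        and \<alpha> = "\<lambda>i. level_cost N c i (f x) + level_cost N c i (f y)"
        and \<beta> = "\<lambda>i. level_cost N c i zx + level_cost N c i zy"])
    show "(\<Sum>i\<le>N. (?q + 1) ^ (N - i) * (level_cost N c i (f x) + level_cost N c i (f y)))
      \<le> (\<Sum>i\<le>N. (?q + 1) ^ (N - i) * (level_cost N c i zx + level_cost N c i zy))"
      using ex unfolding cost_def distrib_left sum.distrib .
    show "level_cost N c i (f x) + level_cost N c i (f y) = level_cost N c i zx + level_cost N c i zy"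
      if "i < j" for i
      using that pre_eq[of i] by (simp add: level_cost_def zx_def zy_def)
    show "level_cost N c i zx + level_cost N c i zy \<le> ?q" if "i \<le> N" for i
      using level_cost_le[of N zx c i] level_cost_le[of N zy c i] reps_le[OF R(1) h] reps_le[OF R(2) h] that
      by fastforce
  qed (rule j)
  then show ?thesis
    using pre_eq[of j] by (simp add: level_cost_def zx_def zy_def)
qed

text \<open>Values at distance 2 or more could both move inward by 1. The common prefix makes the
  linear terms agree, and the sum of the squares would strictly drop.\<close>

lemma fibre_step:
  assumes j: "j \<le> N" and x: "x \<in> X" and y: "y \<in> X" and eq: "\<forall>i<j. f x i = f y i"
  shows "f x j \<le> f y j + 1"
proof (rule ccontr)
  assume "\<not> ?thesis"
  then have "f x j = f y j + 2 + (f x j - f y j - 2)" by linarith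
  then obtain d where d: "f x j = f y j + 2 + d" by blast
  have pe: "pre c j (f y) = pre c j (f x)"
    unfolding pre_def using eq by (intro sum.cong) auto
  \<comment> \<open>Both new values are at most \<open>f x j\<close>, so \<open>x\<close> itself
    serves as either witness.\<close>
  have "level_cost N c j (f x) + level_cost N c j (f y) \<le>
    (c + 1) ^ (N + 1) * (f y j + 1 + d)\<^sup>2 + pre c j (f x) * (f y j + 1 + d) + (c + 1) ^ (N + 1) * (f y j + 1)\<^sup>2 + pre c j (f y) * (f y j + 1)"
    using d eq by (intro level_exchange[OF j x y, where x' = x and y' = x]) (auto simp: x)
  then have "(c + 1) ^ (N + 1) * ((f x j)\<^sup>2 + (f y j)\<^sup>2) \<le> (c + 1) ^ (N + 1) * ((f y j + 1 + d)\<^sup>2 + (f y j + 1)\<^sup>2)"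
    unfolding level_cost_def pe unfolding d by (simp add: algebra_simps)
  then have "(f x j)\<^sup>2 + (f y j)\<^sup>2 \<le> (f y j + 1 + d)\<^sup>2 + (f y j + 1)\<^sup>2"
    by simp
  then show False unfolding d by (simp add: power2_eq_square algebra_simps)
qed

text \<open>A unit at coordinate \<open>j\<close> can be passed between the two split fibres in
  either direction, so both have the same increment of cost. Modulo \<open>(c + 1) ^ (N + 1)\<close>
  this increment is the encoded prefix.\<close>

lemma fibre_unique:
  assumes j: "j \<le> N" and X4: "x \<in> X" "x' \<in> X" "y \<in> X" "y' \<in> X"
    and x: "\<forall>i<j. f x i = f x' i" "f x j < f x' j"
    and y: "\<forall>i<j. f y i = f y' i" "f y j < f y' j"
  shows "\<forall>i<j. f x i = f y i"
proof -
  have sym: "\<forall>i<j. f x' i = f x i" "\<forall>i<j. f y' i = f y i" using x(1) y(1) by auto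
  have s: "f x' j = f x j + 1" "f y' j = f y j + 1"
    using fibre_step[OF j X4(2,1) sym(1)] fibre_step[OF j X4(4,3) sym(2)] x(2) y(2) by auto
  let ?M = "(c + 1) ^ (N + 1)"
  have pe: "pre c j (f x') = pre c j (f x)" "pre c j (f y') = pre c j (f y)"
    unfolding pre_def using x y by (auto intro: sum.cong)
  have "level_cost N c j (f x') + level_cost N c j (f y) \<le>
    ?M * (f x j)\<^sup>2 + pre c j (f x') * f x j + ?M * (f y j + 1)\<^sup>2 + pre c j (f y) * (f y j + 1)"
    by (rule level_exchange[OF j X4(2,3) _ _ _ X4(1) x(1) X4(4) sym(2)]) (use s in simp_all)
  then have 1: "?M * (2 * f x j + 1) + pre c j (f x) \<le> ?M * (2 * f y j + 1) + pre c j (f y)"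
    unfolding level_cost_def pe s by (simp add: algebra_simps power2_eq_square)
  have "level_cost N c j (f x) + level_cost N c j (f y') \<le>
    ?M * (f x j + 1)\<^sup>2 + pre c j (f x) * (f x j + 1) + ?M * (f y j)\<^sup>2 + pre c j (f y') * f y j"
    by (rule level_exchange[OF j X4(1,4) _ _ _ X4(2) sym(1) X4(3) y(1)]) (use s in simp_all)
  then have 2: "?M * (2 * f y j + 1) + pre c j (f y) \<le> ?M * (2 * f x j + 1) + pre c j (f x)"
    unfolding level_cost_def pe s by (simp add: algebra_simps power2_eq_square)
  have lt: "pre c j (f x) < ?M" "pre c j (f y) < ?M"
    using X4 X_le j by (intro pre_less; simp)+
  have "(pre c j (f x) + ?M * (2 * f x j + 1)) mod ?M = (pre c j (f y) + ?M * (2 * f y j + 1)) mod ?M"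
    using 1 2 by (metis add.commute le_antisym)
  then have "pre c j (f x) = pre c j (f y)" using lt by (metis mod_less mod_mult_self2)
  then show ?thesis unfolding pre_def
    using X4 X_le j by (intro base_expansion_unique[where b = "c + 1"]) (auto simp: less_Suc_eq_le)
qed

text \<open>Coordinates beyond \<open>N\<close> vanish and \<open>f\<close> is injective, so classes
  of prefixes of length \<open>N + 1\<close> are single points.\<close>

lemma exchange_Ints:
  fixes r :: "'a \<Rightarrow> real"
  assumes fin: "finite X" and inj: "inj_on f X"
    and sum_r: "sum r X \<in> \<int>"
    and sum_rf: "\<And>j. j \<le> N \<Longrightarrow> (\<Sum>x\<in>X. r x * f x j) \<in> \<int>"
    and p: "p \<in> X"
  shows "r p \<in> \<int>"
proof -
  have "sum r {x \<in> X. \<forall>i<Suc N. f x i = f p i} \<in> \<int>"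
  proof (rule prefix_sums_Ints[where N = N])
    show "f x j \<le> f y j + 1" if "j \<le> N" "x \<in> X" "y \<in> X" "\<forall>i<j. f x i = f y i" for j x y
      using that by (rule fibre_step)
    show "\<forall>i<j. f x i = f y i" if "j \<le> N" "x \<in> X" "x' \<in> X" "y \<in> X" "y' \<in> X"
      "\<forall>i<j. f x i = f x' i" "f x j < f x' j" "\<forall>i<j. f y i = f y' i" "f y j < f y' j" for j x x' y y'
      using that by (rule fibre_unique)
  qed (use fin sum_r sum_rf p in auto)
  moreover have "{x \<in> X. \<forall>i<Suc N. f x i = f p i} = {p}"
  proof -
    have "f x = f p" if "x \<in> X" "\<forall>i<Suc N. f x i = f p i" for x
    proof
      fix i show "f x i = f p i"
      proof (cases "i < Suc N")
        case False
        then have "i \<notin> J" using JN by auto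
        then show ?thesis using X[OF that(1)] X[OF p] by (simp add: reps_def)
      qed (use that in auto)
    qed
    then show ?thesis using inj p by (auto simp: inj_on_def)
  qed
  ultimately show ?thesis by simp
qed

end

section \<open>Regular subdivisions\<close>

lemma finite_bounded_int_lattice:
  fixes S :: "(real ^ 'n) set"
  assumes "bounded S"
  shows "finite (S \<inter> int_lattice)"
proof -
  obtain B where B: "\<And>x. x \<in> S \<Longrightarrow> norm x \<le> B" using assms by (auto simp: bounded_iff)
  let ?F = "PiE UNIV (\<lambda>_::'n. {- \<lceil>B\<rceil>..\<lceil>B\<rceil>})"
  have "S \<inter> int_lattice \<subseteq> (\<lambda>f. \<chi> i. of_int (f i)) ` ?F"
  proof
    fix x assume x: "x \<in> S \<inter> int_lattice"
    have "x = (\<chi> i. of_int \<lfloor>x $ i\<rfloor>)"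
      using x by (simp add: vec_eq_iff int_lattice_def)
    moreover have "(\<lambda>i. \<lfloor>x $ i\<rfloor>) \<in> ?F"
    proof -
      have "\<lfloor>x $ i\<rfloor> \<in> {- \<lceil>B\<rceil>..\<lceil>B\<rceil>}" for i
      proof -
        have "\<bar>x $ i\<bar> \<le> B" using B[of x] x component_le_norm_cart[of x i] by auto
        then show ?thesis by (simp add: abs_le_iff le_floor_iff floor_le_iff ceiling_def) linarith
      qed
      then show ?thesis by auto
    qed
    ultimately show "x \<in> (\<lambda>f. \<chi> i. of_int (f i)) ` ?F" by (rule image_eqI)
  qed
  moreover have "finite ?F" by (intro finite_PiE) auto
  ultimately show ?thesis by (meson finite_imageI finite_subset)
qed

section \<open>Minimisers of tilted weights as cells\<close>

definition min_set :: "('a \<Rightarrow> real) \<Rightarrow> 'a set \<Rightarrow> 'a set" where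
  "min_set f A = {a \<in> A. \<forall>b\<in>A. f a \<le> f b}"

lemma min_set_subset: "min_set f A \<subseteq> A"
  by (auto simp: min_set_def)

lemma min_set_nonempty: "finite A \<Longrightarrow> A \<noteq> {} \<Longrightarrow> min_set f A \<noteq> {}"
  using ex_min_if_finite[of "f ` A"] unfolding min_set_def
  by (smt (verit) arg_min_if_finite(1) arg_min_least empty_Collect_eq)

lemma min_set_less: "a \<in> min_set f A \<Longrightarrow> b \<in> A \<Longrightarrow> b \<notin> min_set f A \<Longrightarrow> f a < f b"
  unfolding min_set_def by (smt (verit) mem_Collect_eq)

lemma min_set_eq: "a \<in> min_set f A \<Longrightarrow> b \<in> min_set f A \<Longrightarrow> f a = f b"
  unfolding min_set_def by (smt (verit) mem_Collect_eq)

lemma min_set_between: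
  assumes "finite A" "min_set f A \<subseteq> B" "B \<subseteq> A"
  shows "min_set f B = min_set f A"
proof (cases "A = {}")
  case True
  then show ?thesis using assms by auto
next
  case False
  then obtain a where "a \<in> min_set f A" using assms min_set_nonempty by blast
  then show ?thesis using assms unfolding min_set_def by (blast intro: order_trans)
qed

text \<open>For small \<epsilon> the strict gaps of \<open>f\<close> between minimisers and other
  points survive, and \<open>g\<close> decides among the minimisers. Faces of cells, and cells lying
  over a face of a simplex, are both produced this way.\<close>

lemma min_set_perturb:
  assumes A: "finite A"
  shows "\<exists>\<epsilon>>0. min_set (\<lambda>a. f a + \<epsilon> * g a) A = min_set g (min_set f A)"
proof -
  let ?M = "min_set f A"
  have ev: "\<forall>\<^sub>F \<epsilon> in at_right 0. f b + \<epsilon> * g b < f a + \<epsilon> * g a" if "b \<in> ?M" "a \<in> A - ?M" for a b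
  proof -
    have l: "((\<lambda>\<epsilon>. (f a + \<epsilon> * g a) - (f b + \<epsilon> * g b)) \<longlongrightarrow> (f a + 0 * g a) - (f b + 0 * g b)) (at_right 0)"
      by (intro tendsto_intros)
    have "f a - f b > 0" using min_set_less[of b f A a] that by auto
    then have "\<forall>\<^sub>F \<epsilon> in at_right 0. (f a + \<epsilon> * g a) - (f b + \<epsilon> * g b) > 0"
      using order_tendstoD(1)[OF l, of 0] by simp
    then show ?thesis by eventually_elim simp
  qed
  have fin: "finite ?M" "finite (A - ?M)" using A min_set_subset[of f A] by (auto intro: finite_subset)
  have "\<forall>\<^sub>F \<epsilon> in at_right 0. \<forall>b\<in>?M. \<forall>a\<in>A - ?M. f b + \<epsilon> * g b < f a + \<epsilon> * g a"
    using ev fin by (intro eventually_ball_finite ballI) auto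
  moreover have "\<forall>\<^sub>F \<epsilon> in at_right (0::real). \<epsilon> > 0"
    by (simp add: eventually_at_right_less)
  ultimately have "\<forall>\<^sub>F \<epsilon> in at_right 0. \<epsilon> > 0 \<and> (\<forall>b\<in>?M. \<forall>a\<in>A - ?M. f b + \<epsilon> * g b < f a + \<epsilon> * g a)"
    by eventually_elim simp
  then have "\<exists>\<epsilon>>0. \<forall>b\<in>?M. \<forall>a\<in>A - ?M. f b + \<epsilon> * g b < f a + \<epsilon> * g a"
    by (rule eventually_happens'[rotated]) simp
  then obtain \<epsilon> where e: "\<epsilon> > 0" "\<And>a b. b \<in> ?M \<Longrightarrow> a \<in> A - ?M \<Longrightarrow> f b + \<epsilon> * g b < f a + \<epsilon> * g a"
    by blast
  have "min_set (\<lambda>a. f a + \<epsilon> * g a) A = min_set g ?M"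
  proof (cases "A = {}")
    case True then show ?thesis by (auto simp: min_set_def)
  next
    case False
    then obtain m where m: "m \<in> ?M" using A min_set_nonempty by blast
    have iff: "f a + \<epsilon> * g a \<le> f b + \<epsilon> * g b \<longleftrightarrow> g a \<le> g b" if "a \<in> ?M" "b \<in> ?M" for a b
      using min_set_eq[OF that] e(1) by simp
    have sub: "?M \<subseteq> A" by (rule min_set_subset)
    show ?thesis
    proof (intro equalityI subsetI)
      fix a assume a: "a \<in> min_set (\<lambda>a. f a + \<epsilon> * g a) A"
      then have "a \<in> A" "f a + \<epsilon> * g a \<le> f m + \<epsilon> * g m" using m sub by (auto simp: min_set_def)
      then have aM: "a \<in> ?M" using e(2)[OF m, of a] by force
      have "g a \<le> g b" if "b \<in> ?M" for b
        using a that sub iff[OF aM that] by (auto simp: min_set_def)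
      then show "a \<in> min_set g ?M" unfolding min_set_def[of g ?M] using aM by simp
    next
      fix a assume "a \<in> min_set g ?M"
      then have aM: "a \<in> ?M" and g: "\<And>b. b \<in> ?M \<Longrightarrow> g a \<le> g b" unfolding min_set_def[of g ?M] by simp_all
      have "f a + \<epsilon> * g a \<le> f b + \<epsilon> * g b" if b: "b \<in> A" for b
      proof (cases "b \<in> ?M")
        case True then show ?thesis using iff[OF aM True] g by simp
      next
        case False then show ?thesis using e(2)[OF aM, of b] b by simp
      qed
      then show "a \<in> min_set (\<lambda>a. f a + \<epsilon> * g a) A"
        unfolding min_set_def[of "\<lambda>a. f a + \<epsilon> * g a"] using aM sub by auto
    qed
  qed
  then show ?thesis using e(1) by blast
qed

text \<open>The value of the functional \<open>(u, 1)\<close> at the lifted point over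
  \<open>a\<close>.\<close>

definition tilt :: "(real ^ 'n \<Rightarrow> real) \<Rightarrow> real ^ 'n \<Rightarrow> real ^ 'n \<Rightarrow> real" where
  "tilt \<omega> u a = \<omega> a + u \<bullet> a"

lemma sum_tilt:
  "(\<Sum>i\<in>I. \<beta> i * tilt \<omega> u (p i)) = (\<Sum>i\<in>I. \<beta> i * \<omega> (p i)) + u \<bullet> (\<Sum>i\<in>I. \<beta> i *\<^sub>R p i)"
  by (simp add: tilt_def distrib_left sum.distrib inner_sum_right)

text \<open>The tilt is constant on its minimisers and nowhere smaller on \<open>A\<close>, and its
  linear part agrees on two representations of one point. In the case of equality no positive
  coefficient can sit on a point that is not a minimiser.\<close>

lemma min_set_tilt_exchange:
  assumes I: "finite I" "\<forall>i\<in>I. p i \<in> min_set (tilt \<omega> u) A" "sum \<beta> I = 1"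
    and K: "finite K" "\<forall>k\<in>K. q k \<in> A" "\<forall>k\<in>K. \<gamma> k \<ge> 0" "sum \<gamma> K = 1"
    and eq: "(\<Sum>i\<in>I. \<beta> i *\<^sub>R p i) = (\<Sum>k\<in>K. \<gamma> k *\<^sub>R q k)"
  shows "(\<Sum>i\<in>I. \<beta> i * \<omega> (p i)) \<le> (\<Sum>k\<in>K. \<gamma> k * \<omega> (q k))"
    and "\<lbrakk>(\<Sum>k\<in>K. \<gamma> k * \<omega> (q k)) \<le> (\<Sum>i\<in>I. \<beta> i * \<omega> (p i)); k \<in> K; \<gamma> k > 0\<rbrakk>
      \<Longrightarrow> q k \<in> min_set (tilt \<omega> u) A"
proof -
  have "I \<noteq> {}" using I(3) by auto
  then obtain m where m: "m \<in> I" by blast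
  let ?L = "tilt \<omega> u"
  have mA: "p m \<in> min_set ?L A" using m I by auto
  have Lm: "?L (p i) = ?L (p m)" if "i \<in> I" for i using min_set_eq[OF _ mA] I(2) that by blast
  have "(\<Sum>i\<in>I. \<beta> i * ?L (p i)) = (\<Sum>i\<in>I. \<beta> i * ?L (p m))"
    using Lm by (intro sum.cong) simp_all
  then have 1: "(\<Sum>i\<in>I. \<beta> i * ?L (p i)) = ?L (p m)"
    using I(3) by (simp add: sum_distrib_right[symmetric])
  have le: "?L (p m) \<le> ?L (q k)" if "k \<in> K" for k
    using mA that K(2) by (auto simp: min_set_def)
  have 2: "(\<Sum>k\<in>K. \<gamma> k * (?L (q k) - ?L (p m))) = (\<Sum>k\<in>K. \<gamma> k * ?L (q k)) - ?L (p m)"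
    using K(4) by (simp add: right_diff_distrib sum_subtractf sum_distrib_right[symmetric])
  have nonneg: "\<And>k. k \<in> K \<Longrightarrow> 0 \<le> \<gamma> k * (?L (q k) - ?L (p m))" using le K(3) by simp
  then have 3: "0 \<le> (\<Sum>k\<in>K. \<gamma> k * (?L (q k) - ?L (p m)))" by (rule sum_nonneg)
  note t = sum_tilt[of \<beta> \<omega> u p I] sum_tilt[of \<gamma> \<omega> u q K]
  show "(\<Sum>i\<in>I. \<beta> i * \<omega> (p i)) \<le> (\<Sum>k\<in>K. \<gamma> k * \<omega> (q k))"
    using 1 2 3 t eq by simp
  assume ge: "(\<Sum>k\<in>K. \<gamma> k * \<omega> (q k)) \<le> (\<Sum>i\<in>I. \<beta> i * \<omega> (p i))" and k: "k \<in> K" "\<gamma> k > 0"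
  have zero: "(\<Sum>k\<in>K. \<gamma> k * (?L (q k) - ?L (p m))) = 0" using ge 1 2 3 t eq by simp
  have "\<gamma> k * (?L (q k) - ?L (p m)) = 0" by (rule sum_nonneg_0[OF K(1) nonneg zero k(1)])
  then have "?L (q k) = ?L (p m)" using k by simp
  then show "q k \<in> min_set (tilt \<omega> u) A"
    using mA k K(2) by (auto simp: min_set_def)
qed

lemma lifted_polytope_iff:
  assumes "finite A"
  shows "z \<in> lifted_polytope \<omega> A \<longleftrightarrow>
    (\<exists>\<beta>. (\<forall>a\<in>A. 0 \<le> \<beta> a) \<and> sum \<beta> A = 1 \<and> z = (\<Sum>a\<in>A. \<beta> a *\<^sub>R a, \<Sum>a\<in>A. \<beta> a * \<omega> a))"
proof -
  let ?g = "\<lambda>a. (a, \<omega> a)"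
  have inj: "inj_on ?g A" by (auto simp: inj_on_def)
  have pair: "(\<Sum>a\<in>A. \<beta> a *\<^sub>R ?g a) = (\<Sum>a\<in>A. \<beta> a *\<^sub>R a, \<Sum>a\<in>A. \<beta> a * \<omega> a)" for \<beta>
    by (auto simp: sum_prod[symmetric] scaleR_prod_def prod_eq_iff fst_sum snd_sum)
  show ?thesis
  proof
    assume "z \<in> lifted_polytope \<omega> A"
    then obtain v where v: "\<forall>x\<in>?g ` A. 0 \<le> v x" "sum v (?g ` A) = 1" "(\<Sum>x\<in>?g ` A. v x *\<^sub>R x) = z"
      unfolding lifted_polytope_def using convex_hull_finite[of "?g ` A"] assms by auto
    show "\<exists>\<beta>. (\<forall>a\<in>A. 0 \<le> \<beta> a) \<and> sum \<beta> A = 1 \<and> z = (\<Sum>a\<in>A. \<beta> a *\<^sub>R a, \<Sum>a\<in>A. \<beta> a * \<omega> a)"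
      using v unfolding sum.reindex[OF inj] pair[symmetric]
      by (intro exI[of _ "v \<circ> ?g"]) auto
  next
    assume "\<exists>\<beta>. (\<forall>a\<in>A. 0 \<le> \<beta> a) \<and> sum \<beta> A = 1 \<and> z = (\<Sum>a\<in>A. \<beta> a *\<^sub>R a, \<Sum>a\<in>A. \<beta> a * \<omega> a)"
    then obtain \<beta> where b: "\<forall>a\<in>A. 0 \<le> \<beta> a" "sum \<beta> A = 1" "z = (\<Sum>a\<in>A. \<beta> a *\<^sub>R ?g a)"
      unfolding pair by blast
    show "z \<in> lifted_polytope \<omega> A"
      unfolding lifted_polytope_def b(3)
      using b assms by (intro convex_sum) (auto intro: hull_inc)
  qed
qed

text \<open>On a convex combination of lifted points the functional is the average of the tilts, so
  it is minimal exactly when all coefficients off the minimisers vanish.\<close>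

lemma lower_face_fst_image:
  assumes "finite A"
  shows "fst ` {z \<in> lifted_polytope \<omega> A. \<forall>z'\<in>lifted_polytope \<omega> A. (u, 1) \<bullet> z \<le> (u, 1) \<bullet> z'}
    = convex hull (min_set (tilt \<omega> u) A)" (is "fst ` ?G = _")
proof -
  let ?L = "tilt \<omega> u" and ?Q = "lifted_polytope \<omega> A"
  let ?M = "min_set ?L A"
  have MA: "?M \<subseteq> A" by (rule min_set_subset)
  have finM: "finite ?M" using MA assms finite_subset by blast
  have val: "(u, 1) \<bullet> (\<Sum>a\<in>A. \<beta> a *\<^sub>R a, \<Sum>a\<in>A. \<beta> a * \<omega> a) = (\<Sum>a\<in>A. \<beta> a * ?L a)" for \<beta>
    using sum_tilt[of \<beta> \<omega> u "\<lambda>a. a" A] by (simp add: inner_prod_def)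
  have pt: "(a, \<omega> a) \<in> ?Q" "(u, 1) \<bullet> (a, \<omega> a) = ?L a" if "a \<in> A" for a
    using that unfolding lifted_polytope_def by (auto intro: hull_inc simp: inner_prod_def tilt_def)
  show ?thesis
  proof (cases "A = {}")
    case True
    then show ?thesis by (auto simp: lifted_polytope_def min_set_def)
  next
    case False
    then obtain m where m: "m \<in> ?M" using assms min_set_nonempty by blast
    have low: "?L m \<le> ?L a" if "a \<in> A" for a using m that by (auto simp: min_set_def)
    have bound: "?L m \<le> (\<Sum>a\<in>A. \<beta> a * ?L a)" if "\<forall>a\<in>A. 0 \<le> \<beta> a" "sum \<beta> A = 1" for \<beta>
    proof -
      have "(\<Sum>a\<in>A. \<beta> a * ?L m) \<le> (\<Sum>a\<in>A. \<beta> a * ?L a)"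
        using that low by (intro sum_mono mult_left_mono) auto
      then show ?thesis using that by (simp add: sum_distrib_right[symmetric])
    qed
    show ?thesis
    proof (intro equalityI subsetI)
      fix x assume "x \<in> fst ` ?G"
      then obtain z where z: "z \<in> ?G" "x = fst z" by auto
      then obtain \<beta> where b: "\<forall>a\<in>A. 0 \<le> \<beta> a" "sum \<beta> A = 1"
        "z = (\<Sum>a\<in>A. \<beta> a *\<^sub>R a, \<Sum>a\<in>A. \<beta> a * \<omega> a)"
        using lifted_polytope_iff[OF assms] by auto
      have "(\<Sum>a\<in>A. \<beta> a * ?L a) \<le> ?L m"
      proof -
        have "m \<in> A" using m MA by blast
        then have "(u, 1) \<bullet> z \<le> (u, 1) \<bullet> (m, \<omega> m)" using z(1) pt(1) by blast
        then show ?thesis using pt(2)[OF \<open>m \<in> A\<close>] unfolding b(3) val by simp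
      qed
      then have "(\<Sum>a\<in>A. \<beta> a * (?L a - ?L m)) \<le> 0"
        using b(2) by (simp add: right_diff_distrib sum_subtractf sum_distrib_right[symmetric])
      moreover have nn: "\<And>a. a \<in> A \<Longrightarrow> 0 \<le> \<beta> a * (?L a - ?L m)" using b low by simp
      ultimately have sum0: "(\<Sum>a\<in>A. \<beta> a * (?L a - ?L m)) = 0"
        by (meson antisym sum_nonneg)
      have "\<forall>a\<in>A. \<beta> a * (?L a - ?L m) = 0"
        using sum_nonneg_0[OF assms nn sum0] by blast
      then have zero: "\<beta> a = 0" if "a \<in> A - ?M" for a
        using that min_set_less[OF m, of a] by force
      have "x = (\<Sum>a\<in>?M. \<beta> a *\<^sub>R a)"
        unfolding z(2) b(3) using zero MA assms by (auto intro: sum.mono_neutral_right)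
      moreover have "sum \<beta> ?M = 1"
        using b(2) zero MA assms sum.mono_neutral_right[of A ?M \<beta>] by simp
      ultimately show "x \<in> convex hull ?M"
        unfolding convex_hull_finite[OF finM] using b(1) MA by (intro CollectI exI[of _ \<beta>]) auto
    next
      fix x assume "x \<in> convex hull ?M"
      then obtain \<gamma> where g: "\<forall>a\<in>?M. 0 \<le> \<gamma> a" "sum \<gamma> ?M = 1" "(\<Sum>a\<in>?M. \<gamma> a *\<^sub>R a) = x"
        using convex_hull_finite[OF finM] by auto
      define \<beta> where "\<beta> a = (if a \<in> ?M then \<gamma> a else 0)" for a
      have s: "(\<Sum>a\<in>A. \<beta> a *\<^sub>R F a) = (\<Sum>a\<in>?M. \<gamma> a *\<^sub>R F a)" for F :: "real^'a \<Rightarrow> 'c::real_vector"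
        using MA assms by (intro sum.mono_neutral_cong_right) (auto simp: \<beta>_def)
      have sb: "sum \<beta> A = 1" using s[of "\<lambda>_. 1::real"] g by simp
      have b0: "\<forall>a\<in>A. 0 \<le> \<beta> a" using g by (auto simp: \<beta>_def)
      let ?z = "(\<Sum>a\<in>A. \<beta> a *\<^sub>R a, \<Sum>a\<in>A. \<beta> a * \<omega> a)"
      have "(\<Sum>a\<in>A. \<beta> a * ?L a) = (\<Sum>a\<in>?M. \<gamma> a * ?L a)" using s[of ?L] by simp
      also have "\<dots> = (\<Sum>a\<in>?M. \<gamma> a * ?L m)"
        by (intro sum.cong refl arg_cong2[of _ _ _ _ "(*)"] min_set_eq[OF _ m])
      also have "\<dots> = ?L m" using g by (simp add: sum_distrib_right[symmetric])
      finally have "(u, 1) \<bullet> ?z = ?L m" using val by simp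
      moreover have "?L m \<le> (u, 1) \<bullet> z'" if "z' \<in> ?Q" for z'
        using that lifted_polytope_iff[OF assms] bound val by fastforce
      moreover have "?z \<in> ?Q" using lifted_polytope_iff[OF assms] b0 sb by blast
      ultimately have zG: "?z \<in> ?G" by auto
      have zx: "fst ?z = x" using s[of "\<lambda>a. a"] g by simp
      show "x \<in> fst ` ?G" by (rule image_eqI[where f = fst, OF zx[symmetric] zG])
    qed
  qed
qed

lemma regular_subdivision_eq:
  assumes "finite A"
  shows "regular_subdivision \<omega> A = insert {} (range (\<lambda>u. convex hull (min_set (tilt \<omega> u) A)))"
  unfolding regular_subdivision_def lower_face_def
  using lower_face_fst_image[OF assms, of \<omega>] by (auto simp: image_iff) blast+

lemma convex_combination_in_face:
  fixes S :: "'a::real_vector set"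
  assumes E: "E face_of S" and S: "convex S" and I: "finite I" "\<And>i. i \<in> I \<Longrightarrow> p i \<in> S"
    and \<beta>: "\<And>i. i \<in> I \<Longrightarrow> 0 \<le> \<beta> i" "sum \<beta> I = 1" "(\<Sum>i\<in>I. \<beta> i *\<^sub>R p i) \<in> E"
    and k: "k \<in> I" "\<beta> k > 0"
  shows "p k \<in> E"
proof -
  let ?x = "\<Sum>i\<in>I. \<beta> i *\<^sub>R p i"
  have s: "sum \<beta> I = \<beta> k + sum \<beta> (I - {k})" "?x = \<beta> k *\<^sub>R p k + (\<Sum>i\<in>I - {k}. \<beta> i *\<^sub>R p i)"
    using k I by (auto intro: sum.remove)
  have le: "\<beta> k \<le> 1" using s(1) \<beta> sum_nonneg[of "I - {k}" \<beta>] by auto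
  show ?thesis
  proof (cases "\<beta> k = 1")
    case True
    then have "sum \<beta> (I - {k}) = 0" using s \<beta> by simp
    then have "\<forall>i\<in>I - {k}. \<beta> i = 0" using sum_nonneg_eq_0_iff[of "I - {k}" \<beta>] I \<beta> by auto
    then have "?x = p k" using s(2) True by simp
    then show ?thesis using \<beta> by simp
  next
    case False
    define t where "t = 1 - \<beta> k"
    have t: "0 < t" "t < 1" using False le k by (auto simp: t_def)
    define b where "b = (\<Sum>i\<in>I - {k}. (\<beta> i / t) *\<^sub>R p i)"
    have "sum (\<lambda>i. \<beta> i / t) (I - {k}) = 1"
      using s(1) \<beta>(2) t by (simp add: sum_divide_distrib[symmetric] t_def)
    then have bS: "b \<in> S" unfolding b_def using I \<beta> t S by (intro convex_sum) auto
    have "t *\<^sub>R b = (\<Sum>i\<in>I - {k}. \<beta> i *\<^sub>R p i)"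
      unfolding b_def using t by (simp add: scaleR_sum_right)
    then have x: "?x = (1 - t) *\<^sub>R p k + t *\<^sub>R b" using s(2) by (simp add: t_def)
    show ?thesis
    proof (cases "p k = b")
      case True
      then have "?x = p k" using x by (simp add: algebra_simps)
      then show ?thesis using \<beta> by simp
    next
      case False
      then have "?x \<in> open_segment (p k) b" using x t by (auto simp: in_segment)
      then show ?thesis using E \<beta>(3) bS I(2)[OF k(1)] unfolding face_of_def by blast
    qed
  qed
qed

lemma lattice_simplex_hull:
  assumes "n simplex C" "vertices C \<subseteq> int_lattice"
  shows "convex hull (C \<inter> int_lattice) = C"
proof -
  obtain V where V: "\<not> affine_dependent V" "C = convex hull V" using assms by (auto simp: simplex_def)
  have "V \<subseteq> vertices C"
    unfolding vertices_def V(2) using extreme_point_of_convex_hull_affine_independent[OF V(1)] by auto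
  then have "V \<subseteq> C \<inter> int_lattice" using assms V(2) hull_subset by fastforce
  then have "C \<subseteq> convex hull (C \<inter> int_lattice)" using V(2) hull_mono by blast
  moreover have "convex hull (C \<inter> int_lattice) \<subseteq> C"
    using convex_simplex[OF assms(1)] by (simp add: subset_hull)
  ultimately show ?thesis by auto
qed

text \<open>\<open>independent\<close> concerns all minimising lattice points, so that they are
  exactly the vertices of their hull. It is all that is required of the weight for the subdivisions
  of the single simplices to glue to a triangulation.\<close>

locale lifted_complex =
  fixes \<C> :: "(real ^ 'n) set set" and \<omega> :: "real ^ 'n \<Rightarrow> real"
  assumes complex: "simplicial_complex \<C>" and nonempty: "\<C> \<noteq> {}"
    and lattice: "\<And>C. C \<in> \<C> \<Longrightarrow> vertices C \<subseteq> int_lattice"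
    and independent: "\<And>C u. C \<in> \<C> \<Longrightarrow> \<not> affine_dependent (min_set (tilt \<omega> u) (C \<inter> int_lattice))"
begin

definition cell :: "(real ^ 'n) set \<Rightarrow> real ^ 'n \<Rightarrow> (real ^ 'n) set" where
  "cell C u = min_set (tilt \<omega> u) (C \<inter> int_lattice)"

definition subdivision :: "(real ^ 'n) set set" where
  "subdivision = (\<Union>C\<in>\<C>. regular_subdivision \<omega> (C \<inter> int_lattice))"

lemma simplex_cell: "C \<in> \<C> \<Longrightarrow> \<exists>n. n simplex C"
  using complex by (simp add: simplicial_complex_def)

lemma convex_cell: "C \<in> \<C> \<Longrightarrow> convex C"
  using simplex_cell convex_simplex by blast

lemma finite_lattice_points: "C \<in> \<C> \<Longrightarrow> finite (C \<inter> int_lattice)"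
  using simplex_cell compact_simplex compact_imp_bounded finite_bounded_int_lattice by blast

lemma cell_subset: "cell C u \<subseteq> C" "cell C u \<subseteq> int_lattice"
  using min_set_subset[of "tilt \<omega> u" "C \<inter> int_lattice"] unfolding cell_def by blast+

lemma finite_cell: "C \<in> \<C> \<Longrightarrow> finite (cell C u)"
  unfolding cell_def by (rule finite_subset[OF min_set_subset finite_lattice_points])

lemma independent_cell: "C \<in> \<C> \<Longrightarrow> \<not> affine_dependent (cell C u)"
  using independent unfolding cell_def .

lemma regular_subdivision_cells:
  "C \<in> \<C> \<Longrightarrow> regular_subdivision \<omega> (C \<inter> int_lattice) = insert {} (range (\<lambda>u. convex hull (cell C u)))"
  using regular_subdivision_eq[OF finite_lattice_points] by (simp add: cell_def)

lemma subdivision_iff: "F \<in> subdivision \<longleftrightarrow> F = {} \<or> (\<exists>C\<in>\<C>. \<exists>u. F = convex hull (cell C u))"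
proof -
  have "subdivision = (\<Union>C\<in>\<C>. insert {} (range (\<lambda>u. convex hull (cell C u))))"
    unfolding subdivision_def by (rule SUP_cong[OF refl regular_subdivision_cells])
  then show ?thesis using nonempty by blast
qed

lemma hull_cell_subset: "C \<in> \<C> \<Longrightarrow> convex hull (cell C u) \<subseteq> C"
  using cell_subset convex_cell by (simp add: subset_hull)

lemma face_Int: "C \<in> \<C> \<Longrightarrow> D \<in> \<C> \<Longrightarrow> C \<inter> D face_of C"
  using complex unfolding simplicial_complex_def by blast

text \<open>A common point has a support \<open>X\<close> in the first and \<open>Y\<close> in the
  second cell. As \<open>C \<inter> D\<close> is a face of both simplices, it contains both
  supports. By minimality in \<open>C\<close> the set \<open>X\<close> is no heavier than
  \<open>Y\<close>; the equality case of the exchange in \<open>D\<close> then puts \<open>X\<close>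
  into the second cell.\<close>

lemma hull_cells_Int:
  assumes C: "C \<in> \<C>" and D: "D \<in> \<C>"
  shows "convex hull (cell C u) \<inter> convex hull (cell D w) = convex hull (cell C u \<inter> cell D w)"
proof (intro equalityI subsetI)
  fix x assume x: "x \<in> convex hull (cell C u) \<inter> convex hull (cell D w)"
  have "\<exists>\<beta>. (\<forall>a\<in>cell C u. 0 \<le> \<beta> a) \<and> sum \<beta> (cell C u) = 1 \<and> (\<Sum>a\<in>cell C u. \<beta> a *\<^sub>R a) = x"
    using x convex_hull_finite[OF finite_cell[OF C]] by auto
  then obtain \<beta> where b: "\<And>a. a \<in> cell C u \<Longrightarrow> 0 \<le> \<beta> a" "sum \<beta> (cell C u) = 1"
    "(\<Sum>a\<in>cell C u. \<beta> a *\<^sub>R a) = x" by blast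
  have "\<exists>\<gamma>. (\<forall>a\<in>cell D w. 0 \<le> \<gamma> a) \<and> sum \<gamma> (cell D w) = 1 \<and> (\<Sum>a\<in>cell D w. \<gamma> a *\<^sub>R a) = x"
    using x convex_hull_finite[OF finite_cell[OF D]] by auto
  then obtain \<gamma> where g: "\<And>a. a \<in> cell D w \<Longrightarrow> 0 \<le> \<gamma> a" "sum \<gamma> (cell D w) = 1"
    "(\<Sum>a\<in>cell D w. \<gamma> a *\<^sub>R a) = x" by blast
  define X where "X = {a \<in> cell C u. \<beta> a > 0}"
  define Y where "Y = {a \<in> cell D w. \<gamma> a > 0}"
  have restX: "(\<Sum>a\<in>X. \<beta> a *\<^sub>R f a) = (\<Sum>a\<in>cell C u. \<beta> a *\<^sub>R f a)" for f :: "real^'n \<Rightarrow> 'c::real_vector"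
    unfolding X_def using b(1) finite_cell[OF C] by (intro sum.mono_neutral_left) (auto simp: less_le)
  have restY: "(\<Sum>a\<in>Y. \<gamma> a *\<^sub>R f a) = (\<Sum>a\<in>cell D w. \<gamma> a *\<^sub>R f a)" for f :: "real^'n \<Rightarrow> 'c::real_vector"
    unfolding Y_def using g(1) finite_cell[OF D] by (intro sum.mono_neutral_left) (auto simp: less_le)
  have X: "finite X" "X \<subseteq> cell C u" "sum \<beta> X = 1" "(\<Sum>a\<in>X. \<beta> a *\<^sub>R a) = x" "\<forall>a\<in>X. 0 \<le> \<beta> a"
    using finite_cell[OF C] restX[of "\<lambda>_. 1::real"] restX[of "\<lambda>a. a"] b by (auto simp: X_def)
  have Y: "finite Y" "Y \<subseteq> cell D w" "sum \<gamma> Y = 1" "(\<Sum>a\<in>Y. \<gamma> a *\<^sub>R a) = x" "\<forall>a\<in>Y. 0 \<le> \<gamma> a"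
    using finite_cell[OF D] restY[of "\<lambda>_. 1::real"] restY[of "\<lambda>a. a"] g by (auto simp: Y_def)
  have xC: "x \<in> C" "x \<in> D" using x hull_cell_subset[OF C] hull_cell_subset[OF D] by auto
  have "X \<subseteq> D"
  proof
    fix a assume a: "a \<in> X"
    have "a \<in> C \<inter> D"
    proof (rule convex_combination_in_face[OF face_Int[OF C D] convex_cell[OF C] X(1), where \<beta> = \<beta> and p = "\<lambda>a. a"])
      show "i \<in> C" if "i \<in> X" for i using that X(2) cell_subset by blast
    qed (use X a xC in \<open>auto simp: X_def\<close>)
    then show "a \<in> D" by simp
  qed
  then have XD: "X \<subseteq> D \<inter> int_lattice" using X(2) cell_subset by blast
  have "Y \<subseteq> C"
  proof
    fix a assume a: "a \<in> Y"
    have "a \<in> D \<inter> C"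
    proof (rule convex_combination_in_face[OF face_Int[OF D C] convex_cell[OF D] Y(1), where \<beta> = \<gamma> and p = "\<lambda>a. a"])
      show "i \<in> D" if "i \<in> Y" for i using that Y(2) cell_subset by blast
    qed (use Y a xC in \<open>auto simp: Y_def\<close>)
    then show "a \<in> C" by simp
  qed
  then have YC: "Y \<subseteq> C \<inter> int_lattice" using Y(2) cell_subset by blast
  have eq: "(\<Sum>a\<in>X. \<beta> a *\<^sub>R a) = (\<Sum>a\<in>Y. \<gamma> a *\<^sub>R a)" using X Y by simp
  have XM: "\<forall>a\<in>X. a \<in> min_set (tilt \<omega> u) (C \<inter> int_lattice)" "\<forall>a\<in>X. a \<in> D \<inter> int_lattice"
    and YM: "\<forall>a\<in>Y. a \<in> min_set (tilt \<omega> w) (D \<inter> int_lattice)" "\<forall>a\<in>Y. a \<in> C \<inter> int_lattice"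
    using X(2) Y(2) XD YC unfolding cell_def by blast+
  note XY = min_set_tilt_exchange[where p = "\<lambda>a. a" and q = "\<lambda>a. a", OF X(1) XM(1) X(3) Y(1) YM(2) Y(5) Y(3) eq]
  note YX = min_set_tilt_exchange[where p = "\<lambda>a. a" and q = "\<lambda>a. a", OF Y(1) YM(1) Y(3) X(1) XM(2) X(5) X(3) eq[symmetric]]
  have "a \<in> cell D w" if "a \<in> X" for a
    unfolding cell_def using YX(2)[OF XY(1) that] that by (auto simp: X_def)
  then have "X \<subseteq> cell C u \<inter> cell D w" using X(2) by blast
  moreover have "x \<in> convex hull X"
    unfolding convex_hull_finite[OF X(1)] using X by (intro CollectI exI[of _ \<beta>]) simp
  ultimately show "x \<in> convex hull (cell C u \<inter> cell D w)" using hull_mono by blast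
next
  fix x assume "x \<in> convex hull (cell C u \<inter> cell D w)"
  then show "x \<in> convex hull (cell C u) \<inter> convex hull (cell D w)"
    by (meson IntI Int_lower1 Int_lower2 hull_mono subsetD)
qed

text \<open>A cell spans a simplex, so \<open>B\<close> spans a face of it, which is exposed.
  Subtracting a small multiple of the exposing functional from \<open>u\<close> keeps just the
  minimisers on that face.\<close>

lemma subset_cell_is_cell:
  assumes C: "C \<in> \<C>" and B: "B \<subseteq> cell C u" "B \<noteq> {}"
  shows "\<exists>w. cell C w = B"
proof -
  let ?M = "cell C u"
  have ind: "\<not> affine_dependent ?M" by (rule independent_cell[OF C])
  have face: "convex hull B face_of convex hull ?M"
    using face_of_convex_hull_affine_independent[OF ind] B by blast
  have "convex hull B exposed_face_of convex hull ?M"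
    using exposed_face_of_polyhedron[OF polyhedron_convex_hull[OF finite_cell[OF C]]] face by blast
  then consider "convex hull B = {}" | "convex hull B = convex hull ?M"
    | a b where "convex hull ?M \<subseteq> {x. a \<bullet> x \<le> b}" "convex hull B = convex hull ?M \<inter> {x. a \<bullet> x = b}"
    unfolding exposed_face_of by blast
  moreover have mem: "x \<in> convex hull B \<longleftrightarrow> x \<in> B" if "x \<in> ?M" for x
  proof
    assume x: "x \<in> convex hull B"
    show "x \<in> B"
    proof (rule ccontr)
      assume "x \<notin> B"
      then have "B \<subseteq> ?M - {x}" using B by auto
      then have "x \<in> convex hull (?M - {x})" using x hull_mono by blast
      then have "x \<in> affine hull (?M - {x})" using convex_hull_subset_affine_hull by blast
      then show False using ind that unfolding affine_dependent_def by blast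
    qed
  qed (rule hull_inc)
  ultimately show ?thesis
  proof cases
    case 1
    then show ?thesis using B by simp
  next
    case 2
    have "x \<in> B" if "x \<in> ?M" for x
      using mem[OF that] 2 hull_inc[OF that, of convex] by simp
    then have "?M \<subseteq> B" by blast
    then show ?thesis using B by blast
  next
    case (3 a b)
    have le: "a \<bullet> x \<le> b" and eq: "a \<bullet> x = b \<longleftrightarrow> x \<in> B" if "x \<in> ?M" for x
      using 3 mem[OF that] hull_inc[OF that, of convex] by blast+
    obtain \<epsilon> where e: "\<epsilon> > 0" "min_set (\<lambda>x. tilt \<omega> u x + \<epsilon> * - (a \<bullet> x)) (C \<inter> int_lattice)
        = min_set (\<lambda>x. - (a \<bullet> x)) ?M"
      unfolding cell_def using min_set_perturb[OF finite_lattice_points[OF C]] by blast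
    have "(\<lambda>x. tilt \<omega> u x + \<epsilon> * - (a \<bullet> x)) = tilt \<omega> (u - \<epsilon> *\<^sub>R a)"
      by (auto simp: tilt_def inner_diff_left)
    moreover obtain b0 where "b0 \<in> B" using B by blast
    then have "min_set (\<lambda>x. - (a \<bullet> x)) ?M = B"
      unfolding min_set_def using le eq B(1) by (smt (verit, best) Collect_cong Collect_mem_eq subsetD)
    ultimately show ?thesis using e unfolding cell_def by auto
  qed
qed

text \<open>\<open>C \<inter> D\<close> is an exposed face of \<open>C\<close>. A large multiple of
  its exposing functional dominates the weight, so that the minimisers over \<open>C\<close> are
  those over \<open>C \<inter> D\<close>.\<close>

lemma cell_of_superset:
  assumes C: "C \<in> \<C>" and D: "D \<in> \<C>" and F: "cell D u \<noteq> {}" "cell D u \<subseteq> C"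
  shows "\<exists>w. cell C w = cell D u"
proof -
  let ?E = "C \<inter> D"
  have sub: "cell D u \<subseteq> ?E \<inter> int_lattice" using F cell_subset by blast
  have E: "min_set (tilt \<omega> u) (?E \<inter> int_lattice) = cell D u"
    unfolding cell_def using sub[unfolded cell_def] by (intro min_set_between[OF finite_lattice_points[OF D]]) auto
  have "?E exposed_face_of C"
    using exposed_face_of_polyhedron face_Int[OF C D] simplex_imp_polyhedron simplex_cell[OF C] by blast
  then consider "?E = {}" | "?E = C"
    | a b where "C \<subseteq> {x. a \<bullet> x \<le> b}" "?E = C \<inter> {x. a \<bullet> x = b}"
    unfolding exposed_face_of by blast
  then show ?thesis
  proof cases
    case 1
    then show ?thesis using sub F by auto
  next
    case 2
    then show ?thesis using E unfolding cell_def by metis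
  next
    case (3 a b)
    obtain e0 where e0: "e0 \<in> ?E \<inter> int_lattice" using sub F by blast
    have "min_set (\<lambda>x. - (a \<bullet> x)) (C \<inter> int_lattice) = ?E \<inter> int_lattice"
      unfolding min_set_def using 3 e0 by (auto intro: antisym)
    then obtain \<epsilon> where e: "\<epsilon> > 0" "min_set (\<lambda>x. - (a \<bullet> x) + \<epsilon> * tilt \<omega> u x) (C \<inter> int_lattice) = cell D u"
      using min_set_perturb[OF finite_lattice_points[OF C], of "\<lambda>x. - (a \<bullet> x)" "tilt \<omega> u"] E by auto
    have "- (a \<bullet> x) + \<epsilon> * tilt \<omega> u x = \<epsilon> * tilt \<omega> (u - (1 / \<epsilon>) *\<^sub>R a) x" for x
      using e(1) by (simp add: tilt_def inner_diff_left field_simps)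
    then have "min_set (\<lambda>x. - (a \<bullet> x) + \<epsilon> * tilt \<omega> u x) (C \<inter> int_lattice) = cell C (u - (1 / \<epsilon>) *\<^sub>R a)"
      using e(1) by (simp add: cell_def min_set_def)
    then show ?thesis using e(2) by metis
  qed
qed

lemma simplicial_complex_subdivision: "simplicial_complex subdivision"
  unfolding simplicial_complex_def
proof (intro conjI ballI allI impI)
  have "finite (insert {} (range (\<lambda>u. convex hull (cell C u))))" if C: "C \<in> \<C>" for C
  proof -
    have "range (\<lambda>u. convex hull (cell C u)) \<subseteq> (\<lambda>B. convex hull B) ` Pow (C \<inter> int_lattice)"
      using cell_subset by blast
    then show ?thesis using finite_lattice_points[OF C] by (meson finite_Pow_iff finite_imageI finite_insert finite_subset)
  qed
  moreover have "finite \<C>" using complex by (simp add: simplicial_complex_def)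
  ultimately show "finite subdivision"
    unfolding subdivision_def using regular_subdivision_cells by auto
next
  fix F assume "F \<in> subdivision"
  then consider "F = {}" | C u where "C \<in> \<C>" "F = convex hull (cell C u)" using subdivision_iff by blast
  then show "\<exists>n. n simplex F"
  proof cases
    case 1
    then show ?thesis by auto
  next
    case (2 C u)
    have "(int (card (cell C u)) - 1) simplex F"
      unfolding 2(2) by (intro simplex_convex_hull conjI independent_cell[OF 2(1)]) simp
    then show ?thesis by blast
  qed
next
  fix G F assume *: "F \<in> subdivision \<and> G face_of F"
  show "G \<in> subdivision"
  proof (cases "G = {}")
    case False
    then have "F \<noteq> {}" using * by auto
    then obtain C u where C: "C \<in> \<C>" "F = convex hull (cell C u)" using * subdivision_iff by blast
    then obtain B where B: "B \<subseteq> cell C u" "G = convex hull B"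
      using face_of_convex_hull_affine_independent[OF independent_cell[OF C(1)]] * by blast
    then have "B \<noteq> {}" using False by auto
    then show ?thesis using subset_cell_is_cell[OF C(1) B(1)] B(2) C(1) subdivision_iff by metis
  qed (simp add: subdivision_iff)
next
  fix F G assume FG: "F \<in> subdivision \<and> G \<in> subdivision"
  show "F \<inter> G face_of F"
  proof (cases "F = {} \<or> G = {}")
    case True
    then show ?thesis by auto
  next
    case False
    obtain C u where C: "C \<in> \<C>" "F = convex hull (cell C u)"
      using FG False subdivision_iff[of F] by blast
    obtain D w where D: "D \<in> \<C>" "G = convex hull (cell D w)"
      using FG False subdivision_iff[of G] by blast
    have "F \<inter> G = convex hull (cell C u \<inter> cell D w)"
      unfolding C(2) D(2) by (rule hull_cells_Int[OF C(1) D(1)])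
    moreover have "cell C u \<inter> cell D w \<subseteq> cell C u" by blast
    ultimately show ?thesis
      unfolding face_of_convex_hull_affine_independent[OF independent_cell[OF C(1)], of _ u, folded C(2)] by blast
  qed
qed

text \<open>The set above the lifted polytope is supported at the lowest point over
  \<open>x\<close>. The hyperplane is not vertical because \<open>x\<close> is relatively interior,
  so its normal can be scaled to the form \<open>(u, 1)\<close>.\<close>

lemma rel_interior_covered:
  assumes D: "D \<in> \<C>" and x: "x \<in> rel_interior D"
  shows "\<exists>u. x \<in> convex hull (cell D u)"
proof -
  let ?A = "D \<inter> int_lattice"
  let ?Q = "lifted_polytope \<omega> ?A"
  have fin: "finite ?A" by (rule finite_lattice_points[OF D])
  have hull: "convex hull ?A = D" using simplex_cell[OF D] lattice_simplex_hull lattice[OF D] by blast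
  have Q: "convex ?Q" "compact ?Q"
    unfolding lifted_polytope_def using fin by (auto intro: finite_imp_compact_convex_hull)
  have fst_Q: "fst ` ?Q = D"
  proof -
    have "fst ` ?Q = convex hull (fst ` (\<lambda>a. (a, \<omega> a)) ` ?A)"
      unfolding lifted_polytope_def by (rule convex_hull_linear_image[OF linear_fst])
    then show ?thesis using hull by (simp add: image_image)
  qed
  define K where "K = ?Q \<inter> {z. fst z = x}"
  have "closed {z :: (real^'n) \<times> real. fst z = x}"
    by (intro closed_Collect_eq continuous_intros)
  then have K: "compact K" unfolding K_def using Q by (intro compact_Int_closed)
  have "x \<in> fst ` ?Q" using fst_Q x rel_interior_subset by blast
  then have K0: "K \<noteq> {}" unfolding K_def by auto
  have "continuous_on K snd" by (intro continuous_intros)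
  then obtain z where z: "z \<in> K" "\<And>z'. z' \<in> K \<Longrightarrow> snd z \<le> snd z'"
    using continuous_attains_inf[OF K K0] by blast
  obtain y where zy: "z = (x, y)" using z(1) by (cases z) (auto simp: K_def)
  have yQ: "(x, y) \<in> ?Q" and ymin: "\<And>y'. (x, y') \<in> ?Q \<Longrightarrow> y \<le> y'"
    using z unfolding zy K_def by auto
  \<comment> \<open>Closing the polytope upwards forces the last coordinate of the normal to be
    nonnegative.\<close>
  define E where "E = {(p, t) | p t. \<exists>s\<le>t. (p, s) \<in> ?Q}"
  have Eiff: "(p, t) \<in> E \<longleftrightarrow> (\<exists>s\<le>t. (p, s) \<in> ?Q)" for p t unfolding E_def by auto
  have convE: "convex E"
  proof (rule convexI)
    fix a b :: "(real^'n) \<times> real" and v w :: real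
    assume ab: "a \<in> E" "b \<in> E" and vw: "0 \<le> v" "0 \<le> w" "v + w = 1"
    obtain p t p' t' where pt: "a = (p, t)" "b = (p', t')" by (metis surj_pair)
    obtain s s' where s: "s \<le> t" "(p, s) \<in> ?Q" "s' \<le> t'" "(p', s') \<in> ?Q" using ab pt Eiff by auto
    have "v *\<^sub>R (p, s) + w *\<^sub>R (p', s') \<in> ?Q" using Q(1) s vw by (intro convexD) auto
    moreover have "v * s + w * s' \<le> v * t + w * t'" using s vw by (intro add_mono mult_left_mono) auto
    ultimately show "v *\<^sub>R a + w *\<^sub>R b \<in> E" unfolding pt by (auto simp: Eiff)
  qed
  have xyE: "(x, y) \<in> E" and up: "(x, y + 1) \<in> E" using yQ by (auto simp: Eiff intro: exI[of _ y])
  have "(x, y) \<notin> rel_interior E"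
  proof
    assume "(x, y) \<in> rel_interior E"
    then obtain e where e: "e > 1" "(1 - e) *\<^sub>R (x, y + 1) + e *\<^sub>R (x, y) \<in> E"
      using convex_rel_interior_iff[OF convE] xyE up by blast
    have "(1 - e) *\<^sub>R (x, y + 1) + e *\<^sub>R (x, y) = (x, y + 1 - e)"
      by (simp add: algebra_simps)
    then obtain s where "s \<le> y + 1 - e" "(x, s) \<in> ?Q" using e Eiff by auto
    then show False using ymin[of s] e by simp
  qed
  then obtain n where n: "\<And>z. z \<in> E \<Longrightarrow> n \<bullet> (x, y) \<le> n \<bullet> z" "\<And>z. z \<in> rel_interior E \<Longrightarrow> n \<bullet> (x, y) < n \<bullet> z"
    using supporting_hyperplane_rel_boundary[OF convE xyE] by metis
  obtain a b where ab: "n = (a, b)" by (cases n)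
  have b0: "b \<ge> 0" using n(1)[OF up] by (simp add: ab inner_prod_def algebra_simps)
  \<comment> \<open>For \<open>b = 0\<close> the functional is strictly larger at some
    \<open>p\<close> in \<open>D\<close> than at \<open>x\<close>; prolonging the segment from
    \<open>p\<close> beyond \<open>x\<close> inside \<open>D\<close> would go below its
    minimum.\<close>
  have "b \<noteq> 0"
  proof
    assume b: "b = 0"
    have "rel_interior E \<noteq> {}" using convE xyE rel_interior_eq_empty by blast
    then obtain p t where pt: "(p, t) \<in> rel_interior E" by (metis ex_in_conv surj_pair)
    then have "a \<bullet> x < a \<bullet> p" using n(2)[OF pt] by (simp add: ab b inner_prod_def)
    moreover have "(p, t) \<in> E" using pt rel_interior_subset by blast
    then obtain s where "(p, s) \<in> ?Q" using Eiff by blast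
    then have "p \<in> D" using fst_Q by force
    then obtain e where e: "e > 1" "(1 - e) *\<^sub>R p + e *\<^sub>R x \<in> D"
      using convex_rel_interior_iff[OF convex_cell[OF D]] x by blast
    then obtain s where "((1 - e) *\<^sub>R p + e *\<^sub>R x, s) \<in> ?Q" using fst_Q by force
    then have "((1 - e) *\<^sub>R p + e *\<^sub>R x, s) \<in> E" using Eiff by auto
    then have "a \<bullet> x \<le> (1 - e) * (a \<bullet> p) + e * (a \<bullet> x)"
      using n(1) by (fastforce simp: ab b inner_prod_def inner_add_right)
    then have "0 \<le> (e - 1) * (a \<bullet> x - a \<bullet> p)" by (simp add: algebra_simps)
    ultimately show False using e(1) by (simp add: zero_le_mult_iff)
  qed
  then have bpos: "b > 0" using b0 by simp
  let ?u = "(1 / b) *\<^sub>R a"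
  have scale: "(?u, 1) \<bullet> z = (1 / b) * (n \<bullet> z)" for z :: "(real^'n) \<times> real"
    using bpos by (cases z) (simp add: ab inner_prod_def field_simps)
  have "(?u, 1) \<bullet> (x, y) \<le> (?u, 1) \<bullet> z'" if "z' \<in> ?Q" for z'
  proof -
    have "z' \<in> E" using that Eiff by (cases z') auto
    then have "n \<bullet> (x, y) \<le> n \<bullet> z'" by (rule n(1))
    then show ?thesis unfolding scale using bpos by (intro mult_left_mono) auto
  qed
  then have "x \<in> fst ` {z \<in> ?Q. \<forall>z'\<in>?Q. (?u, 1) \<bullet> z \<le> (?u, 1) \<bullet> z'}"
    using yQ by (intro image_eqI[of _ _ "(x, y)"]) auto
  then show ?thesis unfolding lower_face_fst_image[OF fin] cell_def by blast
qed

text \<open>A point of \<open>C\<close> is relatively interior to the face spanned by its support,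
  and this face belongs to the complex, so \<open>rel_interior_covered\<close> can be applied
  there.\<close>

lemma Union_subdivision: "\<Union>subdivision = \<Union>\<C>"
proof (intro equalityI subsetI)
  fix x assume "x \<in> \<Union>subdivision"
  then show "x \<in> \<Union>\<C>" using subdivision_iff hull_cell_subset by blast
next
  fix x assume "x \<in> \<Union>\<C>"
  then obtain C where C: "C \<in> \<C>" "x \<in> C" by blast
  then obtain V where V: "\<not> affine_dependent V" "C = convex hull V" using simplex_cell by (auto simp: simplex_def)
  have finV: "finite V" using V(1) aff_independent_finite by blast
  then obtain \<beta> where b: "\<forall>v\<in>V. 0 \<le> \<beta> v" "sum \<beta> V = 1" "(\<Sum>v\<in>V. \<beta> v *\<^sub>R v) = x"
    using C V convex_hull_finite[OF finV] by auto
  define W where "W = {v \<in> V. \<beta> v > 0}"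
  have W: "W \<subseteq> V" "finite W" using finV by (auto simp: W_def)
  have rest: "(\<Sum>a\<in>W. \<beta> a *\<^sub>R f a) = (\<Sum>a\<in>V. \<beta> a *\<^sub>R f a)" for f :: "real^'n \<Rightarrow> 'c::real_vector"
    unfolding W_def using b(1) finV by (intro sum.mono_neutral_left) (auto simp: less_le)
  have sW: "sum \<beta> W = 1" "(\<Sum>a\<in>W. \<beta> a *\<^sub>R a) = x"
    using rest[of "\<lambda>_. 1::real"] rest[of "\<lambda>a. a"] b by auto
  have indW: "\<not> affine_dependent W" using V(1) W(1) affine_dependent_subset by blast
  have "x \<in> rel_interior (convex hull W)"
    unfolding rel_interior_convex_hull_explicit[OF indW] using sW by (auto simp: W_def)
  moreover have "convex hull W face_of C"
    using face_of_convex_hull_affine_independent[OF V(1)] V(2) W(1) by blast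
  then have "convex hull W \<in> \<C>" using complex C(1) unfolding simplicial_complex_def by blast
  ultimately show "x \<in> \<Union>subdivision"
    using rel_interior_covered subdivision_iff by blast
qed

text \<open>A cell inside \<open>C\<close> may stem from another simplex;
  \<open>cell_of_superset\<close> exhibits it as a cell of \<open>C\<close>.\<close>

lemma subdivision_restrict:
  assumes C: "C \<in> \<C>"
  shows "{F \<in> subdivision. F \<subseteq> C} = regular_subdivision \<omega> (C \<inter> int_lattice)"
proof (intro equalityI subsetI)
  fix F assume F: "F \<in> {F \<in> subdivision. F \<subseteq> C}"
  show "F \<in> regular_subdivision \<omega> (C \<inter> int_lattice)"
  proof (cases "F = {}")
    case False
    then obtain D u where D: "D \<in> \<C>" "F = convex hull (cell D u)" using F subdivision_iff by blast
    have "cell D u \<noteq> {}" using False D(2) by auto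
    moreover have "cell D u \<subseteq> C" using hull_subset[of "cell D u" convex] F D(2) by auto
    ultimately obtain w where "cell C w = cell D u" using cell_of_superset[OF C D(1)] by blast
    then have "F = convex hull (cell C w)" using D(2) by simp
    then show ?thesis unfolding regular_subdivision_cells[OF C] by blast
  qed (use regular_subdivision_cells[OF C] in simp)
next
  fix F assume "F \<in> regular_subdivision \<omega> (C \<inter> int_lattice)"
  then show "F \<in> {F \<in> subdivision. F \<subseteq> C}"
    using regular_subdivision_cells[OF C] hull_cell_subset[OF C] C subdivision_iff by auto
qed

lemma vertices_hull_cell: "C \<in> \<C> \<Longrightarrow> vertices (convex hull (cell C u)) = cell C u"
  unfolding vertices_def using extreme_point_of_convex_hull_affine_independent[OF independent_cell] by blast

lemma regular_refinement_subdivision: "regular_refinement subdivision \<C> (\<Union>\<C>)"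
  unfolding regular_refinement_def lattice_triangulation_def refines_def
proof (intro conjI)
  show "\<forall>F\<in>subdivision. vertices F \<subseteq> int_lattice"
  proof
    fix F assume "F \<in> subdivision"
    then consider "F = {}" | C u where "C \<in> \<C>" "F = convex hull (cell C u)" using subdivision_iff by blast
    then show "vertices F \<subseteq> int_lattice"
    proof cases
      case 1
      then show ?thesis by (auto simp: vertices_def extreme_point_of_def)
    next
      case 2
      then show ?thesis using vertices_hull_cell cell_subset(2) by simp
    qed
  qed
  show "\<forall>F\<in>subdivision. \<exists>C\<in>\<C>. F \<subseteq> C"
  proof
    fix F assume "F \<in> subdivision"
    then consider "F = {}" | C u where "C \<in> \<C>" "F = convex hull (cell C u)" using subdivision_iff by blast
    then show "\<exists>C\<in>\<C>. F \<subseteq> C"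
    proof cases
      case 1
      then show ?thesis using nonempty by blast
    next
      case (2 C u)
      then show ?thesis using hull_cell_subset[OF 2(1), of u] by blast
    qed
  qed
  show "\<exists>\<omega>. \<forall>C\<in>\<C>. {F \<in> subdivision. F \<subseteq> C} = regular_subdivision \<omega> (C \<inter> int_lattice)"
    using subdivision_restrict by blast
qed (simp_all add: simplicial_complex_subdivision Union_subdivision)

end

section \<open>Lattice indices\<close>

definition coset :: "'a::ab_group_add set \<Rightarrow> 'a \<Rightarrow> 'a set" where
  "coset D x = {y. x - y \<in> D}"

lemma quotient_coset: "A // {(x, y). x - y \<in> D} = coset D ` A"
  by (auto simp: quotient_def coset_def)

definition diff_closed :: "'a::ab_group_add set \<Rightarrow> bool" where
  "diff_closed D \<longleftrightarrow> 0 \<in> D \<and> (\<forall>x\<in>D. \<forall>y\<in>D. x - y \<in> D)"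

lemma diff_closed_minus: "diff_closed D \<Longrightarrow> x \<in> D \<Longrightarrow> - x \<in> D"
  unfolding diff_closed_def by (metis diff_0)

lemma diff_closed_add: "diff_closed D \<Longrightarrow> x \<in> D \<Longrightarrow> y \<in> D \<Longrightarrow> x + y \<in> D"
  using diff_closed_minus[of D y] unfolding diff_closed_def by (metis diff_minus_eq_add)

lemma diff_closed_sum: "diff_closed D \<Longrightarrow> (\<And>x. x \<in> X \<Longrightarrow> g x \<in> D) \<Longrightarrow> sum g X \<in> D"
  by (induction X rule: infinite_finite_induct) (auto simp: diff_closed_add diff_closed_def)

lemma coset_eq_iff:
  assumes "diff_closed D"
  shows "coset D x = coset D y \<longleftrightarrow> x - y \<in> D"
proof
  assume "coset D x = coset D y"
  moreover have "y \<in> coset D y" using assms by (simp add: coset_def diff_closed_def)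
  ultimately show "x - y \<in> D" by (auto simp: coset_def)
next
  assume *: "x - y \<in> D"
  have "x - z \<in> D \<longleftrightarrow> y - z \<in> D" for z
  proof
    assume "x - z \<in> D"
    then have "(x - z) - (x - y) \<in> D" using * assms unfolding diff_closed_def by blast
    then show "y - z \<in> D" by simp
  next
    assume "y - z \<in> D"
    then have "(x - y) + (y - z) \<in> D" using * diff_closed_add[OF assms] by blast
    then show "x - z \<in> D" by simp
  qed
  then show "coset D x = coset D y" by (auto simp: coset_def)
qed

lemma card_coset_le:
  assumes D: "diff_closed D" and f: "finite (f ` A)" "\<And>x y. x \<in> A \<Longrightarrow> y \<in> A \<Longrightarrow> f x = f y \<Longrightarrow> x - y \<in> D"
  shows "card (coset D ` A) \<le> card (f ` A)"
proof -
  let ?g = "\<lambda>k. coset D (SOME x. x \<in> A \<and> f x = k)"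
  have "coset D x = ?g (f x)" if "x \<in> A" for x
  proof -
    have "(SOME y. y \<in> A \<and> f y = f x) \<in> A \<and> f (SOME y. y \<in> A \<and> f y = f x) = f x"
      using that by (intro someI[of "\<lambda>y. y \<in> A \<and> f y = f x"]) simp
    then show ?thesis using f(2) that coset_eq_iff[OF D] by metis
  qed
  then have "coset D ` A = ?g ` f ` A" by (auto simp: image_image)
  then show ?thesis using card_image_le[OF f(1)] by metis
qed

text \<open>\<open>A\<close> is an affine lattice rather than a group, but translation by
  \<open>y\<close> permutes its cosets. Adding up representatives before and after the translation
  leaves the number of cosets times \<open>y\<close>, up to \<open>D\<close>.\<close>

lemma lagrange_coset:
  fixes D :: "'a::real_vector set"
  assumes D: "diff_closed D" and fin: "finite (coset D ` A)"
    and y: "\<And>x. x \<in> A \<Longrightarrow> x + y \<in> A"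
  shows "real (card (coset D ` A)) *\<^sub>R y \<in> D"
proof -
  define rep where "rep C = (SOME x. x \<in> A \<and> coset D x = C)" for C
  have rep: "rep (coset D x) \<in> A" "coset D (rep (coset D x)) = coset D x" if "x \<in> A" for x
    using someI[of "\<lambda>z. z \<in> A \<and> coset D z = coset D x" x] that unfolding rep_def by auto
  define R where "R = rep ` coset D ` A"
  have RA: "R \<subseteq> A" unfolding R_def using rep by auto
  have rep_R: "rep (coset D x) = x" if "x \<in> R" for x
    using that rep unfolding R_def by auto
  have finR: "finite R" unfolding R_def using fin by simp
  have injrep: "inj_on rep (coset D ` A)" 
  proof (rule inj_onI)
    fix B C assume "B \<in> coset D ` A" "C \<in> coset D ` A" "rep B = rep C"
    then show "B = C" using rep(2) by (metis imageE)
  qed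
  then have cardR: "card R = card (coset D ` A)" unfolding R_def by (rule card_image)
  define \<phi> where "\<phi> x = rep (coset D (x + y))" for x
  have \<phi>R: "\<phi> x \<in> R" if "x \<in> R" for x using that RA y unfolding R_def \<phi>_def by blast
  have \<phi>D: "\<phi> x - (x + y) \<in> D" if "x \<in> R" for x
    using rep[of "x + y"] y RA that coset_eq_iff[OF D] unfolding \<phi>_def by blast
  have "inj_on \<phi> R"
  proof
    fix x z assume xz: "x \<in> R" "z \<in> R" "\<phi> x = \<phi> z"
    have "(\<phi> z - (z + y)) - (\<phi> x - (x + y)) \<in> D"
      using \<phi>D[OF xz(1)] \<phi>D[OF xz(2)] D unfolding diff_closed_def by blast
    then have "x - z \<in> D" using xz(3) by simp
    then have "coset D x = coset D z" using coset_eq_iff[OF D] by blast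
    then show "x = z" using rep_R xz by metis
  qed
  then have "\<phi> ` R = R" using finR \<phi>R by (intro endo_inj_surj) auto
  then have "sum \<phi> R = sum (\<lambda>x. x) R"
    using sum.reindex[OF \<open>inj_on \<phi> R\<close>, of "\<lambda>x. x"] by simp
  then have "(\<Sum>x\<in>R. \<phi> x - (x + y)) = - (real (card R) *\<^sub>R y)"
    by (simp add: sum_subtractf sum.distrib sum_constant_scaleR)
  moreover have "(\<Sum>x\<in>R. \<phi> x - (x + y)) \<in> D" using diff_closed_sum[OF D \<phi>D] .
  ultimately show ?thesis using diff_closed_minus[OF D] cardR by fastforce
qed

lemma int_lattice_diff_closed: "diff_closed (int_lattice :: (real ^ 'n) set)"
  by (simp add: diff_closed_def int_lattice_def)

lemma int_lattice_diff: "x \<in> int_lattice \<Longrightarrow> y \<in> int_lattice \<Longrightarrow> x - y \<in> int_lattice"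
  by (simp add: int_lattice_def)

lemma int_lattice_add: "x \<in> int_lattice \<Longrightarrow> y \<in> int_lattice \<Longrightarrow> x + y \<in> int_lattice"
  by (simp add: int_lattice_def)

lemma int_lattice_scaleR_of_int: "x \<in> int_lattice \<Longrightarrow> of_int k *\<^sub>R x \<in> int_lattice"
  by (simp add: int_lattice_def)

lemma diff_closed_aff_lattice_dir: "diff_closed (aff_lattice_dir W)"
  unfolding diff_closed_def
proof (intro conjI ballI)
  show "0 \<in> aff_lattice_dir W"
    unfolding aff_lattice_dir_def by (auto intro!: exI[of _ "\<lambda>_. 0"])
  fix x y assume "x \<in> aff_lattice_dir W" "y \<in> aff_lattice_dir W"
  then obtain a b :: "real^'a \<Rightarrow> int" where ab: "x = (\<Sum>v\<in>W. of_int (a v) *\<^sub>R v)" "sum a W = 0"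
    "y = (\<Sum>v\<in>W. of_int (b v) *\<^sub>R v)" "sum b W = 0"
    unfolding aff_lattice_dir_def by blast
  show "x - y \<in> aff_lattice_dir W"
    unfolding aff_lattice_dir_def using ab
    by (auto intro!: exI[of _ "\<lambda>v. a v - b v"] simp: sum_subtractf scaleR_left_diff_distrib)
qed

text \<open>The invariant \<open>f\<close> is later either the class modulo the lattice of the
  surrounding simplex or a residue modulo an entry of the box vector.\<close>

lemma simplex_volume_le:
  fixes W :: "(real ^ 'n) set"
  assumes W: "\<not> affine_dependent W" "card W = CARD('n) + 1"
    and f: "finite (f ` int_lattice)"
      "\<And>x y. x \<in> int_lattice \<Longrightarrow> y \<in> int_lattice \<Longrightarrow> f x = f y \<Longrightarrow> x - y \<in> aff_lattice_dir W"
  shows "simplex_volume (convex hull W) \<le> card (f ` int_lattice)"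
proof -
  have "affine hull (convex hull W) = UNIV"
    using affine_independent_span_eq[OF W(1)] W(2) by simp
  moreover have "vertices (convex hull W) = W"
    unfolding vertices_def using extreme_point_of_convex_hull_affine_independent[OF W(1)] by simp
  ultimately have "simplex_volume (convex hull W) = card (coset (aff_lattice_dir W) ` int_lattice)"
    unfolding simplex_volume_def quotient_coset by simp
  also have "\<dots> \<le> card (f ` int_lattice)"
    by (rule card_coset_le[OF diff_closed_aff_lattice_dir f])
  finally show ?thesis .
qed

text \<open>Vertices are numbered once for the whole complex, and \<open>\<S>\<close> lists the
  index sets of its simplices. \<open>hat_unique\<close> makes barycentric coordinates global, like
  the hat functions of a triangulation: simplices agree on the coordinates of a common
  point.\<close>

locale indexed_complex =
  fixes v :: "nat \<Rightarrow> real ^ 'n" and N :: nat and \<S> :: "nat set set"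
  assumes index_range: "J \<in> \<S> \<Longrightarrow> J \<subseteq> {1..N}"
    and vertex_lattice: "j \<in> {1..N} \<Longrightarrow> v j \<in> int_lattice"
    and hat_unique: "\<lbrakk>J \<in> \<S>; J' \<in> \<S>; \<forall>j. 0 \<le> l j; \<forall>j. 0 \<le> l' j; \<forall>j. j \<notin> J \<longrightarrow> l j = 0; \<forall>j. j \<notin> J' \<longrightarrow> l' j = 0;
        (\<Sum>j=1..N. l j) = (\<Sum>j=1..N. l' j); (\<Sum>j=1..N. l j *\<^sub>R v j) = (\<Sum>j=1..N. l' j *\<^sub>R v j)\<rbrakk>
        \<Longrightarrow> l = l'"
begin

text \<open>Homogeneous coordinates: the total is the dilation factor, so that box points and points
  of \<open>c\<close> times a simplex are treated alike.\<close>

definition tot :: "(nat \<Rightarrow> real) \<Rightarrow> real" where "tot l = (\<Sum>j=1..N. l j)"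
definition comb :: "(nat \<Rightarrow> real) \<Rightarrow> real ^ 'n" where "comb l = (\<Sum>j=1..N. l j *\<^sub>R v j)"

lemma comb_simps:
  "comb (\<lambda>j. l j + l' j) = comb l + comb l'" "comb (\<lambda>j. l j - l' j) = comb l - comb l'"
  "comb (\<lambda>j. s * l j) = s *\<^sub>R comb l" "comb (\<lambda>j. l j / s) = (1 / s) *\<^sub>R comb l"
  "tot (\<lambda>j. l j + l' j) = tot l + tot l'" "tot (\<lambda>j. l j - l' j) = tot l - tot l'"
  "tot (\<lambda>j. s * l j) = s * tot l" "tot (\<lambda>j. l j / s) = tot l / s"
  unfolding comb_def tot_def
  by (simp_all add: sum.distrib sum_subtractf scaleR_left_distrib scaleR_left_diff_distrib
      scaleR_sum_right sum_distrib_left sum_divide_distrib divide_inverse_commute)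

lemma comb_sum: "finite X \<Longrightarrow> comb (\<lambda>j. \<Sum>x\<in>X. r x * l x j) = (\<Sum>x\<in>X. r x *\<^sub>R comb (l x))"
  "finite X \<Longrightarrow> tot (\<lambda>j. \<Sum>x\<in>X. r x * l x j) = (\<Sum>x\<in>X. r x * tot (l x))"
  by (induction X rule: finite_induct) (simp_all add: comb_simps, simp_all add: comb_def tot_def)

lemma comb_single: "k \<in> {1..N} \<Longrightarrow> comb (\<lambda>j. if j = k then s else 0) = s *\<^sub>R v k"
  "k \<in> {1..N} \<Longrightarrow> tot (\<lambda>j. if j = k then s else 0) = s"
  unfolding comb_def tot_def by (simp_all add: if_distrib[of "\<lambda>t. t *\<^sub>R _"] cong: if_cong)

lemma comb_int_lattice:
  assumes "\<And>j. l j \<in> \<int>"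
  shows "comb l \<in> int_lattice"
  unfolding comb_def
proof (rule diff_closed_sum[OF int_lattice_diff_closed])
  fix j assume "j \<in> {1..N}"
  then show "l j *\<^sub>R v j \<in> int_lattice"
    using assms[of j] int_lattice_scaleR_of_int[OF vertex_lattice] by (auto elim!: Ints_cases)
qed

text \<open>The positive and the negative part of \<open>l\<close> are two nonnegative coordinate
  vectors of one point, to which \<open>hat_unique\<close> applies.\<close>

lemma comb_zero:
  assumes J: "J \<in> \<S>" and l: "\<forall>j. j \<notin> J \<longrightarrow> l j = 0" "tot l = 0" "comb l = 0"
  shows "l j = 0"
proof -
  have pm: "l i = max (l i) 0 - max (- l i) 0" for i by simp
  have t: "tot (\<lambda>j. max (l j) 0) - tot (\<lambda>j. max (- l j) 0) = tot l"
    unfolding comb_simps(6)[symmetric] by (rule arg_cong[of _ _ tot]) auto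
  have c: "comb (\<lambda>j. max (l j) 0) - comb (\<lambda>j. max (- l j) 0) = comb l"
    unfolding comb_simps(2)[symmetric] by (rule arg_cong[of _ _ comb]) auto
  have "(\<lambda>j. max (l j) 0) = (\<lambda>j. max (- l j) 0)"
    using l t c by (intro hat_unique[OF J J]) (auto simp: tot_def comb_def)
  then have "max (l j) 0 = max (- l j) 0" by meson
  then show ?thesis by (auto simp: max_def split: if_splits)
qed

lemma comb_unique:
  assumes J: "J \<in> \<S>" and l: "\<forall>j. j \<notin> J \<longrightarrow> l j = 0" "\<forall>j. j \<notin> J \<longrightarrow> l' j = 0"
    "tot l = tot l'" "comb l = comb l'"
  shows "l = l'"
proof
  fix j
  have "l j - l' j = 0"
    by (rule comb_zero[OF J, of "\<lambda>j. l j - l' j"]) (use l in \<open>simp_all add: comb_simps\<close>)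
  then show "l j = l' j" by simp
qed

lemma inj_on_vertices:
  assumes "J \<in> \<S>"
  shows "inj_on v J"
proof
  fix i k assume ik: "i \<in> J" "k \<in> J" "v i = v k"
  have "i \<in> {1..N}" "k \<in> {1..N}" using ik index_range[OF assms] by auto
  then have "(\<lambda>j. if j = i then 1 else 0) = (\<lambda>j. if j = k then 1 else (0::real))"
    using ik by (intro comb_unique[OF assms]) (auto simp: comb_single)
  then show "i = k" by (metis zero_neq_one)
qed

lemma sum_vertices:
  assumes "J \<in> \<S>"
  shows "(\<Sum>w\<in>v ` J. u w *\<^sub>R w) = comb (\<lambda>j. if j \<in> J then u (v j) else 0)"
    "(\<Sum>w\<in>v ` J. u w) = tot (\<lambda>j. if j \<in> J then u (v j) else 0)"
proof -
  have J: "J \<subseteq> {1..N}" by (rule index_range[OF assms])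
  show "(\<Sum>w\<in>v ` J. u w *\<^sub>R w) = comb (\<lambda>j. if j \<in> J then u (v j) else 0)"
    unfolding comb_def sum.reindex[OF inj_on_vertices[OF assms]]
    using J by (intro sum.mono_neutral_cong_left) auto
  show "(\<Sum>w\<in>v ` J. u w) = tot (\<lambda>j. if j \<in> J then u (v j) else 0)"
    unfolding tot_def sum.reindex[OF inj_on_vertices[OF assms]]
    using J by (intro sum.mono_neutral_cong_left) auto
qed

lemma finite_index: "J \<in> \<S> \<Longrightarrow> finite J"
  using index_range finite_subset by blast

lemma independent_vertices:
  assumes "J \<in> \<S>"
  shows "\<not> affine_dependent (v ` J)"
proof
  assume "affine_dependent (v ` J)"
  moreover have fin: "finite (v ` J)" using finite_index[OF assms] by simp
  ultimately obtain u w where u: "sum u (v ` J) = 0" "w \<in> v ` J" "u w \<noteq> 0" "(\<Sum>w\<in>v ` J. u w *\<^sub>R w) = 0"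
    unfolding affine_dependent_explicit_finite[OF fin] by blast
  obtain k where k: "k \<in> J" "w = v k" using u by blast
  have "(if k \<in> J then u (v k) else 0) = 0"
    by (rule comb_zero[OF assms, of "\<lambda>j. if j \<in> J then u (v j) else 0"])
      (use u(1,4) sum_vertices[OF assms, of u] in simp_all)
  then show False using k u by simp
qed

lemma affine_hull_iff:
  assumes "J \<in> \<S>"
  shows "x \<in> affine hull (v ` J) \<longleftrightarrow> (\<exists>l. (\<forall>j. j \<notin> J \<longrightarrow> l j = 0) \<and> tot l = 1 \<and> comb l = x)" (is "_ \<longleftrightarrow> ?R")
proof -
  have fin: "finite (v ` J)" using finite_index[OF assms] by simp
  have "x \<in> affine hull (v ` J) \<longleftrightarrow> (\<exists>u. sum u (v ` J) = 1 \<and> (\<Sum>w\<in>v ` J. u w *\<^sub>R w) = x)"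
    unfolding affine_hull_finite[OF fin] by simp
  also have "\<dots> \<longleftrightarrow> ?R"
  proof
    assume "\<exists>u. sum u (v ` J) = 1 \<and> (\<Sum>w\<in>v ` J. u w *\<^sub>R w) = x"
    then obtain u where "sum u (v ` J) = 1" "(\<Sum>w\<in>v ` J. u w *\<^sub>R w) = x" by blast
    then show ?R unfolding sum_vertices[OF assms] by (intro exI[of _ "\<lambda>j. if j \<in> J then u (v j) else 0"]) simp
  next
    assume ?R
    then obtain l where l: "\<forall>j. j \<notin> J \<longrightarrow> l j = 0" "tot l = 1" "comb l = x" by blast
    define u where "u w = l (the_inv_into J v w)" for w
    have "(\<lambda>j. if j \<in> J then u (v j) else 0) = l"
      using l(1) the_inv_into_f_f[OF inj_on_vertices[OF assms]] by (auto simp: u_def)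
    then show "\<exists>u. sum u (v ` J) = 1 \<and> (\<Sum>w\<in>v ` J. u w *\<^sub>R w) = x"
      unfolding sum_vertices[OF assms] using l by metis
  qed
  finally show ?thesis .
qed

lemma aff_lattice_dir_iff:
  assumes "J \<in> \<S>"
  shows "x \<in> aff_lattice_dir (v ` J) \<longleftrightarrow>
    (\<exists>l. (\<forall>j. j \<notin> J \<longrightarrow> l j = 0) \<and> (\<forall>j. l j \<in> \<int>) \<and> tot l = 0 \<and> comb l = x)" (is "_ \<longleftrightarrow> ?R")
proof
  assume "x \<in> aff_lattice_dir (v ` J)"
  then obtain a :: "real^'n \<Rightarrow> int" where a: "x = (\<Sum>w\<in>v ` J. of_int (a w) *\<^sub>R w)" "sum a (v ` J) = 0"
    unfolding aff_lattice_dir_def by blast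
  have "(\<Sum>w\<in>v ` J. real_of_int (a w)) = 0" using a(2) by (metis of_int_0 of_int_sum)
  then show ?R using a(1) unfolding sum_vertices[OF assms]
    by (intro exI[of _ "\<lambda>j. if j \<in> J then of_int (a (v j)) else 0"]) simp
next
  assume ?R
  then obtain l where l: "\<forall>j. j \<notin> J \<longrightarrow> l j = 0" "\<forall>j. l j \<in> \<int>" "tot l = 0" "comb l = x" by blast
  define a where "a w = \<lfloor>l (the_inv_into J v w)\<rfloor>" for w
  have "(\<lambda>j. if j \<in> J then real_of_int (a (v j)) else 0) = l"
    using l(1,2) the_inv_into_f_f[OF inj_on_vertices[OF assms]] by (auto simp: a_def)
  then have s: "(\<Sum>w\<in>v ` J. real_of_int (a w)) = 0" "(\<Sum>w\<in>v ` J. of_int (a w) *\<^sub>R w) = x"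
    using sum_vertices[OF assms, of "\<lambda>w. real_of_int (a w)"] l by simp_all
  then have "sum a (v ` J) = 0" by (metis of_int_eq_0_iff of_int_sum)
  then show "x \<in> aff_lattice_dir (v ` J)" unfolding aff_lattice_dir_def using s(2) by blast
qed

lemma simplex_volume_coset:
  assumes "J \<in> \<S>"
  shows "simplex_volume (convex hull (v ` J)) =
    card (coset (aff_lattice_dir (v ` J)) ` (int_lattice \<inter> affine hull (v ` J)))"
proof -
  have "vertices (convex hull (v ` J)) = v ` J"
    unfolding vertices_def
    using extreme_point_of_convex_hull_affine_independent[OF independent_vertices[OF assms]] by simp
  then show ?thesis unfolding simplex_volume_def quotient_coset by simp
qed

lemma dir_subset_lattice:
  assumes "J \<in> \<S>"
  shows "aff_lattice_dir (v ` J) \<subseteq> int_lattice"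
proof
  fix x assume "x \<in> aff_lattice_dir (v ` J)"
  then obtain l where "\<forall>j. l j \<in> \<int>" "comb l = x" unfolding aff_lattice_dir_iff[OF assms] by blast
  then show "x \<in> int_lattice" using comb_int_lattice[of l] by blast
qed

text \<open>Removing integer parts of coordinates moves a point within its class into a bounded set,
  which has finitely many lattice points.\<close>

lemma finite_coset:
  assumes J: "J \<in> \<S>"
  shows "finite (coset (aff_lattice_dir (v ` J)) ` (int_lattice \<inter> affine hull (v ` J)))" (is "finite (_ ` ?A)")
proof (cases "J = {}")
  case False
  then obtain j0 where j0: "j0 \<in> J" by blast
  have jN: "j0 \<in> {1..N}" using j0 index_range[OF J] by blast
  define B where "B = real (N + 1) * (\<Sum>j=1..N. norm (v j))"
  have "\<exists>y. y \<in> cball 0 B \<inter> ?A \<and> coset (aff_lattice_dir (v ` J)) x = coset (aff_lattice_dir (v ` J)) y"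
    if x: "x \<in> ?A" for x
  proof -
    obtain l where l: "\<forall>j. j \<notin> J \<longrightarrow> l j = 0" "tot l = 1" "comb l = x"
      using x affine_hull_iff[OF J] by blast
    let ?F = "tot (\<lambda>j. frac (l j))"
    have F: "0 \<le> ?F" "?F \<le> N"
    proof -
      show "0 \<le> ?F" unfolding tot_def by (intro sum_nonneg) simp
      have "?F \<le> (\<Sum>j=1..N. 1)" unfolding tot_def by (intro sum_mono) (simp add: frac_lt_1 less_imp_le)
      then show "?F \<le> N" by simp
    qed
    \<comment> \<open>The integer parts need not have sum 0; the vertex \<open>j0\<close> absorbs
      their sum.\<close>
    define d where "d j = of_int \<lfloor>l j\<rfloor> - (if j = j0 then tot (\<lambda>j. of_int \<lfloor>l j\<rfloor>) else 0)" for j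
    have dj: "d j = l j - (frac (l j) + (if j = j0 then 1 - ?F else 0))" for j
    proof -
      have "tot (\<lambda>j. of_int \<lfloor>l j\<rfloor>) = 1 - ?F"
        unfolding l(2)[symmetric] comb_simps(6)[symmetric] frac_def by simp
      then show ?thesis by (simp add: d_def frac_def)
    qed
    have totd: "tot d = 0"
      unfolding d_def comb_simps(6) using comb_single(2)[OF jN] by simp
    have dJ: "\<forall>j. j \<notin> J \<longrightarrow> d j = 0" using l(1) j0 by (auto simp: dj)
    have dI: "\<forall>j. d j \<in> \<int>" by (auto simp: d_def tot_def)
    have cd: "comb d \<in> aff_lattice_dir (v ` J)" using aff_lattice_dir_iff[OF J] totd dJ dI by blast
    define y where "y = comb (\<lambda>j. l j - d j)"
    have xy: "x - y = comb d" using l(3) by (simp add: y_def comb_simps)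
    have "y = x - comb d" using xy by (simp add: algebra_simps)
    then have "y \<in> int_lattice"
      using x cd dir_subset_lattice[OF J] int_lattice_diff by blast
    moreover have "y \<in> affine hull (v ` J)"
      unfolding affine_hull_iff[OF J] y_def using l dJ totd
      by (intro exI[of _ "\<lambda>j. l j - d j"]) (simp add: comb_simps)
    moreover have "norm y \<le> B"
    proof -
      have le: "\<bar>l j - d j\<bar> \<le> N + 1" for j
      proof -
        have "0 \<le> (if j = j0 then 1 - ?F else 0) + N" "(if j = j0 then 1 - ?F else 0) \<le> 1" using F by auto
        moreover have "l j - d j = frac (l j) + (if j = j0 then 1 - ?F else 0)" using dj by simp
        moreover have "0 \<le> frac (l j)" "frac (l j) < 1" "0 \<le> real N" "real (N + 1) = real N + 1"
          by (simp_all add: frac_lt_1)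
        moreover have "N = 0 \<or> real N \<ge> 1" by auto
        moreover have "N \<noteq> 0" using jN by auto
        ultimately show ?thesis by linarith
      qed
      have "norm y \<le> (\<Sum>j=1..N. norm ((l j - d j) *\<^sub>R v j))" unfolding y_def comb_def by (rule norm_sum)
      also have "\<dots> \<le> (\<Sum>j=1..N. real (N + 1) * norm (v j))"
        using le by (intro sum_mono) (auto intro!: mult_right_mono)
      finally show ?thesis by (simp add: B_def sum_distrib_left)
    qed
    moreover have "coset (aff_lattice_dir (v ` J)) x = coset (aff_lattice_dir (v ` J)) y"
      using cd xy coset_eq_iff[OF diff_closed_aff_lattice_dir] by metis
    ultimately show ?thesis using x by (intro exI[of _ y]) simp
  qed
  then have "coset (aff_lattice_dir (v ` J)) ` ?A \<subseteq> coset (aff_lattice_dir (v ` J)) ` (cball 0 B \<inter> int_lattice)"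
    by blast
  moreover have "finite (cball 0 B \<inter> int_lattice :: (real^'n) set)"
    by (intro finite_bounded_int_lattice) simp
  ultimately show ?thesis by (meson finite_imageI finite_subset)
qed simp

text \<open>\<open>a\<close> encodes the lattice point with barycentric coordinates \<open>a j / V\<close>, which lies in an integer
  multiple of the face spanned by the support of \<open>a\<close>.\<close>

definition box_vector :: "nat \<Rightarrow> (nat \<Rightarrow> nat) \<Rightarrow> bool" where
  "box_vector V a \<longleftrightarrow> (\<forall>j. a j < V) \<and> (\<exists>j. a j \<noteq> 0) \<and> (\<forall>j. j \<notin> {1..N} \<longrightarrow> a j = 0) \<and> V dvd (\<Sum>j=1..N. a j) \<and>
     comb (\<lambda>j. real (a j) / V) \<in> int_lattice"

text \<open>The first \<open>V\<close> multiples of the box point lie in distinct classes, because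
  the prime \<open>V\<close> divides neither \<open>a j1\<close> nor a difference of two multipliers
  below \<open>V\<close>. By the volume bound there are no other classes.\<close>

lemma box_coset:
  assumes J: "J \<in> \<S>" and V: "prime V" "simplex_volume (convex hull (v ` J)) \<le> V"
    and a: "box_vector V a" "\<forall>j. j \<notin> J \<longrightarrow> a j = 0"
    and l: "\<forall>j. j \<notin> J \<longrightarrow> l j = 0" "tot l \<in> \<int>" "comb l \<in> int_lattice"
  shows "\<exists>r::nat. \<forall>j. l j - r * a j / V \<in> \<int>"
proof -
  let ?D = "aff_lattice_dir (v ` J)" and ?A = "int_lattice \<inter> affine hull (v ` J)"
  obtain j1 where j1: "a j1 \<noteq> 0" using a(1) by (auto simp: box_vector_def)
  have j1J: "j1 \<in> J" using j1 a(2) by auto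
  then have j1N: "j1 \<in> {1..N}" using index_range[OF J] by blast
  have V0: "V > 0" using V(1) prime_gt_0_nat by blast
  have "V dvd (\<Sum>j=1..N. a j)" using a(1) by (simp add: box_vector_def)
  then obtain h where h: "(\<Sum>j=1..N. a j) = V * h" by (rule dvdE)
  have tota: "tot (\<lambda>j. real (a j) / V) = h"
    unfolding tot_def sum_divide_distrib[symmetric] using h V0 by (simp flip: of_nat_sum)
  \<comment> \<open>\<open>r\<close> times the box point, brought from total \<open>r * h\<close> to
    total 1 by means of the vertex \<open>j1\<close>.\<close>
  define f where "f r j = real r * (a j / V) + (if j = j1 then 1 - real r * h else 0)" for r :: nat and j
  have fJ: "\<forall>j. j \<notin> J \<longrightarrow> f r j = 0" for r using a(2) j1J by (auto simp: f_def)
  have ftot: "tot (f r) = 1" for r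
    unfolding f_def comb_simps(5,7) tota comb_single(2)[OF j1N] by simp
  have fA: "comb (f r) \<in> ?A" for r
  proof -
    have "comb (f r) = real_of_int (int r) *\<^sub>R comb (\<lambda>j. a j / V) + real_of_int (1 - int r * int h) *\<^sub>R v j1"
      unfolding f_def comb_simps(1,3) comb_single(1)[OF j1N] by simp
    moreover have "comb (\<lambda>j. a j / V) \<in> int_lattice" using a(1) by (simp add: box_vector_def)
    ultimately have "comb (f r) \<in> int_lattice"
      using int_lattice_scaleR_of_int int_lattice_add vertex_lattice[OF j1N] by metis
    then show ?thesis using affine_hull_iff[OF J] fJ ftot by blast
  qed
  have dir_int: "g j \<in> \<int>" if cg: "comb g \<in> ?D" and gJ: "\<forall>j. j \<notin> J \<longrightarrow> g j = 0" and gt: "tot g = 0" for g j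
  proof -
    obtain g' where g': "\<forall>j. j \<notin> J \<longrightarrow> g' j = 0" "\<forall>j. g' j \<in> \<int>" "tot g' = 0" "comb g' = comb g"
      using cg unfolding aff_lattice_dir_iff[OF J] by blast
    have "tot g' = tot g" using g'(3) gt by simp
    then have "g' = g" by (rule comb_unique[OF J g'(1) gJ _ g'(4)])
    then show ?thesis using g'(2) by simp
  qed
  have inj: "inj_on (\<lambda>r. coset ?D (comb (f r))) {..<V}"
  proof (rule inj_onI)
    have lt: False if rs: "r < s" "s < V" "coset ?D (comb (f s)) = coset ?D (comb (f r))" for r s
    proof -
      have "comb (\<lambda>j. f s j - f r j) \<in> ?D"
        using rs(3) coset_eq_iff[OF diff_closed_aff_lattice_dir] by (metis comb_simps(2))
      then have "f s j1 - f r j1 \<in> \<int>"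
        using fJ ftot by (intro dir_int[of "\<lambda>j. f s j - f r j"]) (auto simp: comb_simps)
      moreover have "f s j1 - f r j1 = real (s - r) * a j1 / V - real (s - r) * h"
        using rs(1) by (simp add: f_def of_nat_diff algebra_simps diff_divide_distrib)
      ultimately have "real (s - r) * a j1 / V - real (s - r) * h + real (s - r) * h \<in> \<int>"
        by (metis Ints_add Ints_mult Ints_of_nat)
      then have "real (s - r) * a j1 / V \<in> \<int>" by simp
      then obtain k where "real (s - r) * a j1 / V = of_int k" by (auto elim: Ints_cases)
      then have "real ((s - r) * a j1) = of_int k * V" using V0 by (simp add: field_simps)
      then have "int ((s - r) * a j1) = k * int V" by (metis of_int_eq_iff of_int_mult of_int_of_nat_eq)
      then have "V dvd (s - r) * a j1" by (metis dvd_triv_right int_dvd_int_iff)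
      then have "V dvd s - r \<or> V dvd a j1" using V(1) prime_dvd_mult_nat by blast
      moreover have "a j1 < V" using a(1) by (simp add: box_vector_def)
      ultimately show False using j1 rs by (auto dest: dvd_imp_le)
    qed
    fix r s assume "r \<in> {..<V}" "s \<in> {..<V}" "coset ?D (comb (f r)) = coset ?D (comb (f s))"
    then show "r = s" using lt[of r s] lt[of s r] by (metis lessThan_iff nat_neq_iff)
  qed
  have sub: "(\<lambda>r. coset ?D (comb (f r))) ` {..<V} \<subseteq> coset ?D ` ?A" using fA by blast
  have "card (coset ?D ` ?A) \<le> V" using V(2) simplex_volume_coset[OF J] by simp
  then have all: "(\<lambda>r. coset ?D (comb (f r))) ` {..<V} = coset ?D ` ?A"
  proof (intro card_subset_eq[OF finite_coset[OF J] sub] antisym card_mono[OF finite_coset[OF J] sub])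
    assume "card (coset ?D ` ?A) \<le> V"
    then show "card (coset ?D ` ?A) \<le> card ((\<lambda>r. coset ?D (comb (f r))) ` {..<V})"
      unfolding card_image[OF inj] by simp
  qed
  obtain m :: int where m: "tot l = of_int m" using l(2) by (auto elim: Ints_cases)
  \<comment> \<open>The same normalisation of \<open>l\<close> to total 1; it changes
    \<open>l\<close> by integers only.\<close>
  define l' where "l' j = l j + (if j = j1 then 1 - of_int m else 0)" for j
  have l'J: "\<forall>j. j \<notin> J \<longrightarrow> l' j = 0" using l(1) j1J by (auto simp: l'_def)
  have l't: "tot l' = 1" unfolding l'_def comb_simps comb_single(2)[OF j1N] m by simp
  have "comb l' = comb l + of_int (1 - m) *\<^sub>R v j1"
    unfolding l'_def comb_simps comb_single(1)[OF j1N] by simp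
  then have "comb l' \<in> int_lattice"
    using l(3) int_lattice_scaleR_of_int int_lattice_add vertex_lattice[OF j1N] by metis
  then have "comb l' \<in> ?A" using affine_hull_iff[OF J] l'J l't by blast
  then have "coset ?D (comb l') \<in> (\<lambda>r. coset ?D (comb (f r))) ` {..<V}" using all by blast
  then obtain r where r: "coset ?D (comb l') = coset ?D (comb (f r))" by blast
  then have "comb (\<lambda>j. l' j - f r j) \<in> ?D"
    using coset_eq_iff[OF diff_closed_aff_lattice_dir] by (metis comb_simps(2))
  then have int: "l' j - f r j \<in> \<int>" for j
    using l'J fJ l't ftot by (intro dir_int[of "\<lambda>j. l' j - f r j"]) (auto simp: comb_simps)
  have "l j - r * a j / V \<in> \<int>" for j
  proof -
    have "l j - r * a j / V = (l' j - f r j) + of_int (if j = j1 then m - int r * int h else 0)"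
      by (simp add: l'_def f_def)
    then show ?thesis using int[of j] by (metis Ints_add Ints_of_int)
  qed
  then show ?thesis by blast
qed

text \<open>Two lattice points in different classes differ by a vector \<open>y\<close> outside the
  vertex lattice. By Lagrange \<open>V\<close> times \<open>y\<close> lies inside, so the
  coordinates of \<open>y\<close> have denominator \<open>V\<close>; their fractional parts, not all
  0, form the box vector.\<close>

lemma box_exists:
  assumes J: "J \<in> \<S>" and V: "V \<ge> 2" "simplex_volume (convex hull (v ` J)) = V"
  shows "\<exists>a. box_vector V a \<and> (\<forall>j. j \<notin> J \<longrightarrow> a j = 0)"
proof -
  let ?D = "aff_lattice_dir (v ` J)" and ?A = "int_lattice \<inter> affine hull (v ` J)"
  note D = diff_closed_aff_lattice_dir[of "v ` J"]
  have card: "card (coset ?D ` ?A) = V" using V simplex_volume_coset[OF J] by simp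
  have "coset ?D ` ?A \<noteq> {}" using card V(1) by (metis card.empty not_numeral_le_zero)
  then obtain x0 where x0: "x0 \<in> ?A" by blast
  have "\<not> coset ?D ` ?A \<subseteq> {coset ?D x0}"
  proof
    assume "coset ?D ` ?A \<subseteq> {coset ?D x0}"
    then have "card (coset ?D ` ?A) \<le> card {coset ?D x0}" by (intro card_mono) auto
    then show False using card V(1) by simp
  qed
  then obtain x1 where x1: "x1 \<in> ?A" "coset ?D x1 \<noteq> coset ?D x0" by blast
  define y where "y = x1 - x0"
  have yD: "y \<notin> ?D" using x1 coset_eq_iff[OF D] by (simp add: y_def)
  have y_lat: "y \<in> int_lattice" using x0 x1 by (simp add: y_def int_lattice_diff)
  obtain l0 l1 where l01: "\<forall>j. j \<notin> J \<longrightarrow> l0 j = 0" "tot l0 = 1" "comb l0 = x0"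
    "\<forall>j. j \<notin> J \<longrightarrow> l1 j = 0" "tot l1 = 1" "comb l1 = x1"
    using x0 x1 affine_hull_iff[OF J] by (metis IntD2)
  define l where "l = (\<lambda>j. l1 j - l0 j)"
  have l: "\<forall>j. j \<notin> J \<longrightarrow> l j = 0" "tot l = 0" "comb l = y"
    using l01 by (auto simp: l_def y_def comb_simps)
  have shift: "x + y \<in> ?A" if xA: "x \<in> ?A" for x
  proof -
    obtain g where g: "\<forall>j. j \<notin> J \<longrightarrow> g j = 0" "tot g = 1" "comb g = x"
      using xA affine_hull_iff[OF J] by blast
    have "x + y \<in> affine hull (v ` J)"
      unfolding affine_hull_iff[OF J] using g l by (intro exI[of _ "\<lambda>j. g j + l j"]) (simp add: comb_simps)
    then show ?thesis using xA y_lat int_lattice_add by blast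
  qed
  have "real V *\<^sub>R y \<in> ?D" using lagrange_coset[OF D finite_coset[OF J] shift] card by simp
  then obtain g where g: "\<forall>j. j \<notin> J \<longrightarrow> g j = 0" "\<forall>j. g j \<in> \<int>" "tot g = 0" "comb g = real V *\<^sub>R y"
    using aff_lattice_dir_iff[OF J] by blast
  have "g = (\<lambda>j. V * l j)"
    using g l by (intro comb_unique[OF J]) (auto simp: comb_simps)
  then have gl: "g j = V * l j" for j by simp
  define k where "k j = \<lfloor>g j\<rfloor>" for j
  have k: "real_of_int (k j) = g j" for j using g(2) by (simp add: k_def)
  define a where "a j = nat (k j mod int V)" for j
  have a: "int (a j) = k j mod int V" for j using V(1) by (simp add: a_def)
  have aV: "real (a j) / V = l j - of_int (k j div int V)" for j
  proof -
    have "real (a j) = of_int (k j mod int V)" using a by (metis of_int_of_nat_eq)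
    also have "\<dots> = of_int (k j) - V * of_int (k j div int V)"
    proof -
      have "k j mod int V = k j - int V * (k j div int V)" by (rule minus_mult_div_eq_mod[symmetric])
      then show ?thesis by simp
    qed
    finally show ?thesis using V(1) k[of j] gl[of j] by (simp add: field_simps)
  qed
  have aJ: "\<forall>j. j \<notin> J \<longrightarrow> a j = 0" using g(1) by (auto simp: a_def k_def)
  have "box_vector V a" unfolding box_vector_def
  proof (intro conjI allI impI)
    show "a j < V" for j
    proof -
      have "int (a j) < int V" unfolding a using V(1) by (intro pos_mod_bound) simp
      then show ?thesis by simp
    qed
    show "\<exists>j. a j \<noteq> 0"
    proof (rule ccontr)
      assume "\<not> ?thesis"
      then have "l j = of_int (k j div int V)" for j using aV[of j] by simp
      then have "\<forall>j. l j \<in> \<int>" by (metis Ints_of_int)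
      then show False using yD l aff_lattice_dir_iff[OF J] by blast
    qed
    show "a j = 0" if "j \<notin> {1..N}" for j using that aJ index_range[OF J] by blast
    have "real_of_int (\<Sum>j=1..N. k j) = 0" using g(3) k by (simp add: tot_def)
    then have "(\<Sum>j=1..N. k j) = 0" by (simp only: of_int_eq_0_iff)
    then have "(\<Sum>j=1..N. k j mod int V) mod int V = 0" by (simp add: mod_sum_eq)
    then have "int (\<Sum>j=1..N. a j) mod int V = 0" using a by simp
    then have "int V dvd int (\<Sum>j=1..N. a j)" by (simp only: dvd_eq_mod_eq_0)
    then show "V dvd (\<Sum>j=1..N. a j)" by (simp only: int_dvd_int_iff)
    have "comb (\<lambda>j. real (a j) / V) = y - comb (\<lambda>j. of_int (k j div int V))"
      unfolding aV comb_simps l(3) ..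
    moreover have "comb (\<lambda>j. of_int (k j div int V)) \<in> int_lattice" by (intro comb_int_lattice) simp
    ultimately show "comb (\<lambda>j. real (a j) / V) \<in> int_lattice"
      using y_lat by (simp add: int_lattice_diff)
  qed
  then show ?thesis using aJ by blast
qed

end

section \<open>The weight on a dilated complex\<close>

locale dilated_complex = indexed_complex v N \<S>
  for v :: "nat \<Rightarrow> real ^ 'n" and N :: nat and \<S> :: "nat set set" +
  fixes V c :: nat
  assumes prime_V: "prime V" and c_pos: "c > 0" and c_dvd: "fact CARD('n) dvd c"
    and volume_le: "J \<in> \<S> \<Longrightarrow> simplex_volume (convex hull (v ` J)) \<le> V"
begin

lemma V_pos: "V > 0"
  using prime_V prime_gt_0_nat by blast

lemma box_lt: "box_vector V a \<Longrightarrow> a j < V"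
  and box_nonzero: "box_vector V a \<Longrightarrow> \<exists>j. a j \<noteq> 0"
  and box_dvd: "box_vector V a \<Longrightarrow> V dvd (\<Sum>j=1..N. a j)"
  and box_lattice: "box_vector V a \<Longrightarrow> comb (\<lambda>j. real (a j) / V) \<in> int_lattice"
  by (simp_all add: box_vector_def)

lemma box_range: "box_vector V a \<Longrightarrow> a j \<noteq> 0 \<Longrightarrow> j \<in> {1..N}"
  by (rule ccontr) (simp add: box_vector_def)

text \<open>For box vectors the division is exact and gives the total of the box point.\<close>

definition height :: "(nat \<Rightarrow> nat) \<Rightarrow> nat" where "height a = (\<Sum>j=1..N. a j) div V"

lemma height_pos:
  assumes "box_vector V a"
  shows "height a > 0"
proof -
  obtain j where j: "a j \<noteq> 0" using box_nonzero[OF assms] by blast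
  have "a j \<le> (\<Sum>j=1..N. a j)" using box_range[OF assms j] by (intro member_le_sum) simp_all
  moreover have "(\<Sum>j=1..N. a j) = V * height a" using box_dvd[OF assms] by (simp add: height_def)
  ultimately show ?thesis using j by (cases "height a = 0") simp_all
qed

lemma tot_box: "box_vector V a \<Longrightarrow> tot (\<lambda>j. real (a j) / V) = height a"
proof -
  assume "box_vector V a"
  then have "(\<Sum>j=1..N. a j) = V * height a" using box_dvd by (simp add: height_def)
  then have "(\<Sum>j=1..N. real (a j)) = real V * height a" by (metis of_nat_mult of_nat_sum)
  then show ?thesis unfolding tot_def sum_divide_distrib[symmetric] using V_pos by simp
qed

lemma Ints_div_V:
  assumes "real r * real a / V \<in> \<int>" "0 < a" "a < V"
  shows "V dvd r"
proof -
  obtain k where "real r * real a / V = of_int k" using assms(1) by (auto elim: Ints_cases)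
  then have "real (r * a) = of_int k * V" using V_pos by (simp add: field_simps)
  then have "int (r * a) = k * int V" by (metis of_int_eq_iff of_int_mult of_int_of_nat_eq)
  then have "V dvd r * a" by (metis dvd_triv_right int_dvd_int_iff)
  then have "V dvd r \<or> V dvd a" using prime_V prime_dvd_mult_nat by blast
  then show ?thesis using assms(2,3) by (auto dest: dvd_imp_le)
qed

text \<open>Modulo integers \<open>b / V\<close> is a multiple of \<open>a / V\<close>. So
  \<open>b j / V\<close> is an integer where \<open>a j = 0\<close>, and being less than 1 it is
  0.\<close>

lemma box_support_subset:
  assumes J: "J \<in> \<S>" and a: "box_vector V a" "\<forall>j. j \<notin> J \<longrightarrow> a j = 0" and b: "box_vector V b" "\<forall>j. j \<notin> J \<longrightarrow> b j = 0"
    and j: "a j = 0"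
  shows "b j = 0"
proof -
  have "\<exists>r::nat. \<forall>j. real (b j) / V - r * a j / V \<in> \<int>"
    using b by (intro box_coset[OF J prime_V volume_le[OF J] a]) (auto simp: tot_box box_lattice)
  then obtain r :: nat where "\<forall>j. real (b j) / V - r * a j / V \<in> \<int>" by blast
  then have "real (b j) / V - r * a j / V \<in> \<int>" by blast
  then have "real 1 * real (b j) / V \<in> \<int>" using j by simp
  then have "0 < b j \<Longrightarrow> V dvd 1" using Ints_div_V box_lt[OF b(1)] by blast
  then show ?thesis using prime_V by (metis bot_nat_0.not_eq_extremum nat_dvd_1_iff_1 not_prime_1)
qed

text \<open>One box vector per support: the box point then depends only on the face it spans, which makes
  the weight below consistent across simplices.\<close>

definition canon :: "(nat \<Rightarrow> nat) \<Rightarrow> bool" where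
  "canon a \<longleftrightarrow> box_vector V a \<and> a = (SOME b. box_vector V b \<and> (\<forall>j. b j = 0 \<longleftrightarrow> a j = 0))"

lemma canon_exists:
  assumes "box_vector V b"
  shows "\<exists>a. canon a \<and> (\<forall>j. a j = 0 \<longleftrightarrow> b j = 0)"
proof -
  define a where "a = (SOME a. box_vector V a \<and> (\<forall>j. a j = 0 \<longleftrightarrow> b j = 0))"
  have a: "box_vector V a \<and> (\<forall>j. a j = 0 \<longleftrightarrow> b j = 0)"
    unfolding a_def using assms by (intro someI[of "\<lambda>a. box_vector V a \<and> (\<forall>j. a j = 0 \<longleftrightarrow> b j = 0)" b]) simp
  then have "a = (SOME b. box_vector V b \<and> (\<forall>j. b j = 0 \<longleftrightarrow> a j = 0))" using a_def by simp
  then show ?thesis using a unfolding canon_def by blast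
qed

lemma canon_box: "canon a \<Longrightarrow> box_vector V a"
  by (simp add: canon_def)

text \<open>All box vectors on one simplex have the same support, and \<open>canon\<close> keeps one
  per support.\<close>

lemma canon_unique:
  assumes J: "J \<in> \<S>" and a: "canon a" "\<forall>j. j \<notin> J \<longrightarrow> a j = 0" and b: "canon b" "\<forall>j. j \<notin> J \<longrightarrow> b j = 0"
  shows "a = b"
proof -
  have "a j = 0 \<longleftrightarrow> b j = 0" for j
    using box_support_subset[OF J canon_box[OF a(1)] a(2) canon_box[OF b(1)] b(2)]
      box_support_subset[OF J canon_box[OF b(1)] b(2) canon_box[OF a(1)] a(2)] by blast
  then have "(SOME d. box_vector V d \<and> (\<forall>j. d j = 0 \<longleftrightarrow> a j = 0)) = (SOME d. box_vector V d \<and> (\<forall>j. d j = 0 \<longleftrightarrow> b j = 0))"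
    by simp
  then show ?thesis using a(1) b(1) unfolding canon_def by metis
qed

text \<open>Coordinates of the sum of \<open>z 0\<close> copies of the box point and
  \<open>z j\<close> copies of each \<open>v j\<close>. Index 0 names no vertex, hence the case
  distinction.\<close>

definition bary :: "(nat \<Rightarrow> nat) \<Rightarrow> (nat \<Rightarrow> nat) \<Rightarrow> nat \<Rightarrow> real" where
  "bary a z j = (if j = 0 then 0 else real (z j)) + real (z 0) * (real (a j) / V)"

lemma bary_nonneg: "0 \<le> bary a z j"
  by (simp add: bary_def)

lemma tot_bary: "box_vector V a \<or> z 0 = 0 \<Longrightarrow> tot (bary a z) = real (height a * z 0 + (\<Sum>j=1..N. z j))"
proof -
  assume a: "box_vector V a \<or> z 0 = 0"
  have "tot (bary a z) = tot (\<lambda>j. if j = 0 then 0 else real (z j)) + real (z 0) * tot (\<lambda>j. real (a j) / V)"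
    unfolding bary_def comb_simps(5,7) ..
  also have "real (z 0) * tot (\<lambda>j. real (a j) / V) = real (height a * z 0)"
    using a tot_box by auto
  also have "tot (\<lambda>j. if j = 0 then 0 else real (z j)) = (\<Sum>j=1..N. real (z j))"
    unfolding tot_def by (intro sum.cong) auto
  finally show ?thesis by simp
qed

lemma comb_bary_lattice:
  assumes "box_vector V a \<or> z 0 = 0"
  shows "comb (bary a z) \<in> int_lattice"
proof -
  have eq: "comb (bary a z) = comb (\<lambda>j. if j = 0 then 0 else real (z j)) + of_int (int (z 0)) *\<^sub>R comb (\<lambda>j. real (a j) / V)"
    unfolding bary_def comb_simps(1,3) by simp
  have m1: "comb (\<lambda>j. if j = 0 then 0 else real (z j)) \<in> int_lattice"
    by (intro comb_int_lattice) auto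
  have m2: "of_int (int (z 0)) *\<^sub>R comb (\<lambda>j. real (a j) / V) \<in> int_lattice"
  proof (cases "z 0 = 0")
    case True
    then show ?thesis by (simp add: int_lattice_def)
  next
    case False
    then have "comb (\<lambda>j. real (a j) / V) \<in> int_lattice" using assms box_lattice by simp
    then show ?thesis by (rule int_lattice_scaleR_of_int)
  qed
  show ?thesis unfolding eq by (rule int_lattice_add[OF m1 m2])
qed

text \<open>The last clause makes \<open>z\<close> unique: it puts the point into one of the cones around the box point.\<close>

definition good :: "(nat \<Rightarrow> nat) \<Rightarrow> (nat \<Rightarrow> nat) \<Rightarrow> real ^ 'n \<Rightarrow> bool" where
  "good a z x \<longleftrightarrow> (canon a \<or> a = (\<lambda>_. 0) \<and> z 0 = 0) \<and> (\<exists>J\<in>\<S>. \<forall>j. j \<notin> J \<longrightarrow> bary a z j = 0) \<and>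
     tot (bary a z) = c \<and> comb (bary a z) = x \<and> (\<forall>b. canon b \<longrightarrow> (\<exists>i. b i \<noteq> 0 \<and> z i = 0))"

lemma zero_notin: "J \<in> \<S> \<Longrightarrow> 0 \<notin> J"
  using index_range by fastforce

lemma good_bary_unique:
  assumes "good a z x" and J: "J \<in> \<S>" and l: "\<forall>j. 0 \<le> l j" "\<forall>j. j \<notin> J \<longrightarrow> l j = 0" "tot l = c" "comb l = x"
  shows "bary a z = l"
proof -
  obtain J' where J': "J' \<in> \<S>" "\<forall>j. j \<notin> J' \<longrightarrow> bary a z j = 0" using assms(1) by (auto simp: good_def)
  have t: "tot (bary a z) = c" "comb (bary a z) = x" using assms(1) by (simp_all add: good_def)
  show ?thesis
    by (rule hat_unique[OF J'(1) J _ l(1) J'(2) l(2)])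
      (use t l bary_nonneg in \<open>simp_all add: tot_def comb_def\<close>)
qed

lemma bary_support:
  assumes "bary a z j = 0"
  shows "j \<noteq> 0 \<Longrightarrow> z j = 0" "z 0 \<noteq> 0 \<Longrightarrow> a j = 0"
proof -
  have n: "0 \<le> real (z 0) * (real (a j) / V)" by simp
  have p: "0 \<le> (if j = 0 then 0 else real (z j))" by simp
  have 1: "(if j = 0 then 0 else real (z j)) = 0" and 2: "real (z 0) * (real (a j) / V) = 0"
    using assms unfolding bary_def add_nonneg_eq_0_iff[OF p n] by blast+
  show "j \<noteq> 0 \<Longrightarrow> z j = 0" using 1 by simp
  show "z 0 \<noteq> 0 \<Longrightarrow> a j = 0" using 2 V_pos by simp
qed

text \<open>If \<open>z' 0\<close> were larger, \<open>a'\<close> would be canonical and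
  \<open>z i = 0\<close> for some \<open>i\<close> in its support. Coordinate \<open>i\<close> of
  the point would then consist of \<open>z 0\<close> shares \<open>a' i / V\<close> (of nothing if
  \<open>z 0 = 0\<close>) and yet contain at least \<open>z' 0\<close> such shares.\<close>

lemma good_unique_aux:
  assumes g: "good a z x" and g': "good a' z' x"
  shows "z' 0 \<le> z 0"
proof (rule ccontr)
  assume "\<not> ?thesis"
  then have lt: "z 0 < z' 0" by simp
  obtain J where J: "J \<in> \<S>" "\<forall>j. j \<notin> J \<longrightarrow> bary a' z' j = 0" using g' by (auto simp: good_def)
  have eq: "bary a z = bary a' z'"
    using g' by (intro good_bary_unique[OF g J(1) _ J(2)]) (auto simp: bary_nonneg good_def)
  have ca': "canon a'" using g' lt by (auto simp: good_def)
  then obtain i where i: "a' i \<noteq> 0" "z i = 0" using g by (auto simp: good_def)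
  have i0: "i \<noteq> 0" using box_range[OF canon_box[OF ca'] i(1)] by simp
  have e: "real (z 0) * (real (a i) / V) = real (z' i) + real (z' 0) * (real (a' i) / V)"
    using fun_cong[OF eq, of i] i i0 by (simp add: bary_def)
  have pos: "real (a' i) / V > 0" using i V_pos by simp
  show False
  proof (cases "z 0 = 0")
    case True
    have "real (z' 0) * (real (a' i) / V) > 0" by (intro mult_pos_pos pos) (use lt in simp)
    then show False using e True by simp
  next
    case False
    then have ca: "canon a" using g by (auto simp: good_def)
    have "a j = 0" if "j \<notin> J" for j
      using J(2) that fun_cong[OF eq, of j] bary_support(2)[of a z j] False by simp
    moreover have "a' j = 0" if "j \<notin> J" for j
      using J(2) that bary_support(2)[of a' z' j] lt by simp
    ultimately have "a = a'" using canon_unique[OF J(1) ca _ ca'] by blast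
    then have "real (z 0) * (real (a' i) / V) \<ge> real (z' 0) * (real (a' i) / V)" using e by simp
    moreover have "real (z 0) * (real (a' i) / V) < real (z' 0) * (real (a' i) / V)"
      by (rule mult_strict_right_mono[OF _ pos]) (use lt in simp)
    ultimately show False by linarith
  qed
qed

text \<open>Once the numbers of box points agree, so do their contributions to the coordinates, and
  what remains is \<open>z\<close>. The vector \<open>a\<close> is not claimed to be unique: for
  \<open>z 0 = 0\<close> several may be good.\<close>

lemma good_unique:
  assumes g: "good a z x" and g': "good a' z' x"
  shows "z = z'"
proof -
  have z0: "z 0 = z' 0" using good_unique_aux[OF g g'] good_unique_aux[OF g' g] by simp
  obtain J where J: "J \<in> \<S>" "\<forall>j. j \<notin> J \<longrightarrow> bary a' z' j = 0" using g' by (auto simp: good_def)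
  have eq: "bary a z = bary a' z'"
    using g' by (intro good_bary_unique[OF g J(1) _ J(2)]) (auto simp: bary_nonneg good_def)
  have aa: "z 0 * a j = z' 0 * a' j" for j
  proof (cases "z 0 = 0")
    case False
    then have ca: "canon a" "canon a'" using g g' z0 by (auto simp: good_def)
    have "a j = 0" if "j \<notin> J" for j
      using J(2) that fun_cong[OF eq, of j] bary_support(2)[of a z j] False by simp
    moreover have "a' j = 0" if "j \<notin> J" for j
      using J(2) that bary_support(2)[of a' z' j] False z0 by simp
    ultimately show ?thesis using canon_unique[OF J(1) ca(1) _ ca(2)] z0 by metis
  qed (use z0 in simp)
  show ?thesis
  proof
    fix j
    have "real (z 0) * (real (a j) / V) = real (z' 0) * (real (a' j) / V)"
      using arg_cong[OF aa[of j], of real] by simp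
    moreover have "(if j = 0 then 0 else real (z j)) + real (z 0) * (real (a j) / V) =
        (if j = 0 then 0 else real (z' j)) + real (z' 0) * (real (a' j) / V)"
      using fun_cong[OF eq, of j] unfolding bary_def .
    ultimately have "(if j = 0 then 0 else real (z j)) = (if j = 0 then 0 else real (z' j))" by linarith
    then show "z j = z' j" using z0 by (cases "j = 0") auto
  qed
qed

section \<open>The globally defined weight\<close>

definition slope :: real where
  "slope = (real N + 1) * (real (cost_bound N c) + 1)"

definition rep :: "real ^ 'n \<Rightarrow> nat \<Rightarrow> nat" where
  "rep x = (THE z. \<exists>a. good a z x)"

text \<open>\<open>slope\<close> is chosen for \<open>Sel_region\<close>: leaving a cone gains at
  least \<open>1 / k\<close> in the concave term, \<open>k \<le> N\<close> being the size of the
  support of the box vector, while costs lie between 0 and \<open>cost_bound N c\<close>. The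
  default exceeds the weights of all dilated vertices, which keeps points without a good
  representation out of every cell.\<close>

definition weight :: "real ^ 'n \<Rightarrow> real" where
  "weight x = (if \<exists>a z. good a z x then real (cost N c (rep x)) - slope * rep x 0 else real (cost_bound N c) + 1)"

lemma rep_eq: "good a z x \<Longrightarrow> rep x = z"
  unfolding rep_def using good_unique by (intro the_equality) blast+

lemma weight_good: "good a z x \<Longrightarrow> weight x = real (cost N c z) - slope * z 0"
  unfolding weight_def using rep_eq by auto

definition dcell :: "nat set \<Rightarrow> (real ^ 'n) set" where
  "dcell J = {comb l | l. (\<forall>j. 0 \<le> l j) \<and> (\<forall>j. j \<notin> J \<longrightarrow> l j = 0) \<and> tot l = c}"

text \<open>The default 0 lets \<open>bary\<close> describe simplices with and without a box point
  alike.\<close>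

definition local_box :: "nat set \<Rightarrow> nat \<Rightarrow> nat" where
  "local_box J = (if \<exists>a. canon a \<and> (\<forall>j. j \<notin> J \<longrightarrow> a j = 0)
     then SOME a. canon a \<and> (\<forall>j. j \<notin> J \<longrightarrow> a j = 0) else (\<lambda>_. 0))"

lemma local_box_canon:
  assumes "\<exists>a. canon a \<and> (\<forall>j. j \<notin> J \<longrightarrow> a j = 0)"
  shows "canon (local_box J)" "\<forall>j. j \<notin> J \<longrightarrow> local_box J j = 0"
  using someI_ex[OF assms] assms unfolding local_box_def by simp_all

lemma local_box_none:
  "\<nexists>a. canon a \<and> (\<forall>j. j \<notin> J \<longrightarrow> a j = 0) \<Longrightarrow> local_box J = (\<lambda>_. 0)"
  unfolding local_box_def by (simp only: if_False)

lemma local_box_outside: "j \<notin> J \<Longrightarrow> local_box J j = 0"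
  by (cases "\<exists>a. canon a \<and> (\<forall>j. j \<notin> J \<longrightarrow> a j = 0)") (simp_all add: local_box_canon local_box_none)

lemma local_box_cases: "canon (local_box J) \<or> local_box J = (\<lambda>_. 0) \<and> \<not> (\<exists>a. canon a \<and> (\<forall>j. j \<notin> J \<longrightarrow> a j = 0))"
proof (cases "\<exists>a. canon a \<and> (\<forall>j. j \<notin> J \<longrightarrow> a j = 0)")
  case True
  show ?thesis by (rule disjI1[OF local_box_canon(1)[OF True]])
next
  case False
  show ?thesis by (rule disjI2[OF conjI[OF local_box_none[OF False] False]])
qed

lemma local_box_eq:
  assumes "J \<in> \<S>" "canon a" "\<forall>j. j \<notin> J \<longrightarrow> a j = 0"
  shows "local_box J = a"
proof -
  have "\<exists>a. canon a \<and> (\<forall>j. j \<notin> J \<longrightarrow> a j = 0)" using assms(2,3) by (intro exI[of _ a]) simp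
  then show ?thesis by (intro canon_unique[OF assms(1) _ _ assms(2,3)] local_box_canon)
qed

text \<open>If \<open>z 0\<close> is positive, the support of \<open>a\<close> lies in
  \<open>J\<close> and uniqueness makes \<open>a\<close> the box vector of \<open>J\<close>; if
  \<open>z 0 = 0\<close>, the coordinates do not depend on \<open>a\<close>.\<close>

lemma good_local:
  assumes J: "J \<in> \<S>" and x: "x \<in> dcell J" and g: "good a z x"
  shows "good (local_box J) z x" "\<forall>j. j \<notin> J \<longrightarrow> bary (local_box J) z j = 0"
proof -
  obtain l where l: "\<forall>j. 0 \<le> l j" "\<forall>j. j \<notin> J \<longrightarrow> l j = 0" "tot l = c" "comb l = x"
    using x by (auto simp: dcell_def)
  have eq: "bary a z = l" by (rule good_bary_unique[OF g J l])
  have "bary (local_box J) z = bary a z"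
  proof (cases "z 0 = 0")
    case True
    then show ?thesis by (auto simp: bary_def)
  next
    case False
    then have "canon a" using g by (auto simp: good_def)
    moreover have "a j = 0" if "j \<notin> J" for j
      using l(2) that eq bary_support(2)[of a z j] False by simp
    ultimately show ?thesis using local_box_eq[OF J] by blast
  qed
  then have b: "bary (local_box J) z = bary a z" .
  show "\<forall>j. j \<notin> J \<longrightarrow> bary (local_box J) z j = 0" using b eq l by simp
  have "canon (local_box J) \<or> local_box J = (\<lambda>_. 0) \<and> z 0 = 0"
  proof (cases "z 0 = 0")
    case True
    then show ?thesis using local_box_cases by blast
  next
    case False
    then have "canon a" using g by (auto simp: good_def)
    moreover have "a j = 0" if "j \<notin> J" for j
      using l(2) that eq bary_support(2)[of a z j] False by simp
    ultimately show ?thesis using local_box_eq[OF J] by blast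
  qed
  then show "good (local_box J) z x" using g unfolding good_def b by blast
qed

lemma good_le: "good a z x \<Longrightarrow> i \<le> N \<Longrightarrow> z i \<le> c"
proof -
  assume g: "good a z x" and i: "i \<le> N"
  have a: "box_vector V a \<or> z 0 = 0" using g canon_box by (auto simp: good_def)
  have s: "height a * z 0 + (\<Sum>j=1..N. z j) = c"
    using tot_bary[of a z] a g by (simp only: good_def of_nat_eq_iff)
  show ?thesis
  proof (cases "i = 0")
    case False
    then have "z i \<le> (\<Sum>j=1..N. z j)" using i by (intro member_le_sum) auto
    then show ?thesis using s by simp
  next
    case True
    show ?thesis
    proof (cases "z 0 = 0")
      case False
      then have bx: "box_vector V a" using a by simp
      have "height a > 0" by (rule height_pos[OF bx])
      then have "z 0 \<le> height a * z 0" by simp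
      also have "\<dots> \<le> c" using s by simp
      finally show ?thesis using True by simp
    qed (use True in simp)
  qed
qed

lemma good_cost_le: "good a z x \<Longrightarrow> cost N c z \<le> cost_bound N c"
  using good_le by (intro cost_le) blast

lemma card_le_dim: "J \<in> \<S> \<Longrightarrow> card J \<le> CARD('n) + 1"
proof -
  assume J: "J \<in> \<S>"
  have "int (card (v ` J)) = aff_dim (v ` J) + 1"
    using aff_dim_affine_independent[OF independent_vertices[OF J]] by simp
  also have "\<dots> \<le> CARD('n) + 1" using aff_dim_le_DIM[of "v ` J"] by simp
  finally show ?thesis using card_image[OF inj_on_vertices[OF J]] by simp
qed

text \<open>The entries are less than \<open>V\<close> on at most \<open>CARD('n) + 1\<close>
  vertices, so their sum \<open>V * height a\<close> is less than \<open>V * card J\<close>. Hence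
  the height is at most \<open>CARD('n)\<close> and divides its factorial.\<close>

lemma height_dvd:
  assumes J: "J \<in> \<S>" and a: "box_vector V a" "\<forall>j. j \<notin> J \<longrightarrow> a j = 0"
  shows "height a dvd c"
proof -
  have sum: "(\<Sum>j=1..N. a j) = V * height a" using box_dvd[OF a(1)] by (simp add: height_def)
  have "(\<Sum>j=1..N. a j) = (\<Sum>j\<in>J. a j)"
    using a(2) index_range[OF J] by (intro sum.mono_neutral_right) auto
  also have "\<dots> < (\<Sum>j\<in>J. V)"
  proof (rule sum_strict_mono[OF finite_index[OF J]])
    show "J \<noteq> {}" using box_nonzero[OF a(1)] a(2) by auto
  qed (rule box_lt[OF a(1)])
  finally have "V * height a < V * card J" unfolding sum by (simp add: mult.commute)
  then have "height a < card J" by simp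
  then have "height a \<le> CARD('n)" using card_le_dim[OF J] by simp
  then have "height a dvd fact CARD('n)" using height_pos[OF a(1)] by (intro dvd_fact) simp_all
  then show "height a dvd c" using c_dvd dvd_trans by blast
qed

lemma good_vertex:
  assumes J: "J \<in> \<S>" and j: "j \<in> J"
  shows "good (\<lambda>_. 0) (\<lambda>i. if i = j then c else 0) (real c *\<^sub>R v j)"
proof -
  let ?z = "\<lambda>i. if i = j then c else 0"
  have jN: "j \<in> {1..N}" using j index_range[OF J] by blast
  have b: "bary (\<lambda>_. 0) ?z = (\<lambda>i. if i = j then real c else 0)" using jN by (auto simp: bary_def)
  \<comment> \<open>A box vector supported on \<open>j\<close> alone would have \<open>V\<close>
    dividing \<open>b j\<close>, which lies strictly between 0 and \<open>V\<close>.\<close>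
  have free: "\<exists>i. b i \<noteq> 0 \<and> ?z i = 0" if "canon b" for b
  proof (rule ccontr)
    assume "\<not> ?thesis"
    then have z: "b i = 0" if "i \<noteq> j" for i using that c_pos by auto
    have bx: "box_vector V b" using that canon_box by blast
    have "(\<Sum>i=1..N. b i) = (\<Sum>i\<in>{j}. b i)" using z jN by (intro sum.mono_neutral_right) auto
    then have "V dvd b j" using box_dvd[OF bx] by simp
    then have "b j = 0" using box_lt[OF bx, of j] by (auto dest: dvd_imp_le)
    then show False using z box_nonzero[OF bx] by metis
  qed
  have supp: "\<forall>i. i \<notin> J \<longrightarrow> bary (\<lambda>_. 0) ?z i = 0" unfolding b using j by auto
  show ?thesis unfolding good_def
  proof (intro conjI allI impI)
    show "canon (\<lambda>_. 0) \<or> (\<lambda>_. 0 :: nat) = (\<lambda>_. 0) \<and> ?z 0 = 0" using jN by simp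
    show "\<exists>J\<in>\<S>. \<forall>i. i \<notin> J \<longrightarrow> bary (\<lambda>_. 0) ?z i = 0" by (rule bexI[of _ J]) (rule supp, rule J)
    show "tot (bary (\<lambda>_. 0) ?z) = c" "comb (bary (\<lambda>_. 0) ?z) = real c *\<^sub>R v j"
      unfolding b by (simp_all only: comb_single[OF jN])
  qed (rule free)
qed

text \<open>The common apex of the cones. Divisibility of \<open>c\<close> by the height puts it
  exactly at total \<open>c\<close>.\<close>

lemma good_apex:
  assumes J: "J \<in> \<S>" and a: "canon a" "\<forall>j. j \<notin> J \<longrightarrow> a j = 0"
  shows "good a (\<lambda>i. if i = 0 then c div height a else 0) (real (c div height a) *\<^sub>R comb (\<lambda>j. real (a j) / V))"
proof -
  let ?z = "\<lambda>i. if i = 0 then c div height a else (0::nat)"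
  note bx = canon_box[OF a(1)]
  have b: "bary a ?z = (\<lambda>j. real (c div height a) * (real (a j) / V))" by (auto simp: bary_def)
  have "tot (bary a ?z) = real (c div height a) * real (height a)"
    unfolding b comb_simps(7) tot_box[OF bx] ..
  also have "\<dots> = c" using height_dvd[OF J bx a(2)] by (metis dvd_div_mult_self of_nat_mult)
  finally have t: "tot (bary a ?z) = c" .
  have cb: "comb (bary a ?z) = real (c div height a) *\<^sub>R comb (\<lambda>j. real (a j) / V)"
    unfolding b comb_simps(3) ..
  have s: "\<forall>j. j \<notin> J \<longrightarrow> bary a ?z j = 0" unfolding b using a(2) by simp
  have free: "\<exists>i. d i \<noteq> 0 \<and> ?z i = 0" if "canon d" for d
  proof -
    from box_nonzero[OF canon_box[OF that]] obtain i where i: "d i \<noteq> 0" by (elim exE)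
    have "i \<noteq> 0" using box_range[OF canon_box[OF that] i] by simp
    then show ?thesis using i by (intro exI[of _ i]) simp
  qed
  show ?thesis unfolding good_def
  proof (intro conjI allI impI)
    show "canon a \<or> a = (\<lambda>_. 0) \<and> ?z 0 = 0" using a(1) by simp
    show "\<exists>J\<in>\<S>. \<forall>i. i \<notin> J \<longrightarrow> bary a ?z i = 0" by (rule bexI[of _ J]) (rule s, rule J)
  qed (rule t cb free, assumption?)+
qed

lemma dcell_bary:
  assumes "\<forall>j. j \<notin> J \<longrightarrow> bary a z j = 0" "tot (bary a z) = c"
  shows "comb (bary a z) \<in> dcell J"
  unfolding dcell_def using assms bary_nonneg by blast

lemma vertex_in_dcell:
  assumes J: "J \<in> \<S>" and j: "j \<in> J"
  shows "real c *\<^sub>R v j \<in> dcell J \<inter> int_lattice"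
proof -
  have jN: "j \<in> {1..N}" using j index_range[OF J] by blast
  have "real c *\<^sub>R v j \<in> dcell J" unfolding dcell_def
    using comb_single[OF jN, of "real c"] j by (intro CollectI exI[of _ "\<lambda>i. if i = j then real c else 0"]) auto
  moreover have "real c *\<^sub>R v j \<in> int_lattice"
    using int_lattice_scaleR_of_int[OF vertex_lattice[OF jN], of "int c"] by simp
  ultimately show ?thesis by blast
qed

section \<open>The cells of one dilated simplex\<close>

abbreviation Sel :: "nat set \<Rightarrow> real ^ 'n \<Rightarrow> (real ^ 'n) set" where
  "Sel J u \<equiv> min_set (tilt weight u) (dcell J \<inter> int_lattice)"

lemma Sel_subset: "x \<in> Sel J u \<Longrightarrow> x \<in> dcell J" "x \<in> Sel J u \<Longrightarrow> x \<in> int_lattice"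
  by (simp_all add: min_set_def)

lemma dcell_barycentric:
  assumes J: "J \<in> \<S>" and l: "\<forall>j. j \<notin> J \<longrightarrow> l j = 0"
  shows "comb l = (\<Sum>j\<in>J. (l j / c) *\<^sub>R (real c *\<^sub>R v j))" "tot l = (\<Sum>j\<in>J. l j)"
proof -
  have "comb l = (\<Sum>j\<in>J. l j *\<^sub>R v j)"
    unfolding comb_def using l index_range[OF J] by (intro sum.mono_neutral_right) auto
  then show "comb l = (\<Sum>j\<in>J. (l j / c) *\<^sub>R (real c *\<^sub>R v j))" using c_pos by simp
  show "tot l = (\<Sum>j\<in>J. l j)"
    unfolding tot_def using l index_range[OF J] by (intro sum.mono_neutral_right) auto
qed

lemma slope_pos: "slope > 0"
  unfolding slope_def by (intro mult_pos_pos) auto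

lemma weight_vertex: "J \<in> \<S> \<Longrightarrow> j \<in> J \<Longrightarrow> weight (real c *\<^sub>R v j) \<le> cost_bound N c"
proof -
  assume J: "J \<in> \<S>" "j \<in> J"
  have j0: "j \<noteq> 0" using J zero_notin by metis
  show ?thesis using weight_good[OF good_vertex[OF J]] good_cost_le[OF good_vertex[OF J]] j0 by simp
qed

text \<open>A point of weight \<open>cost_bound N c + 1\<close> is heavier than the combination of
  dilated vertices that represents it, so it is no minimiser.\<close>

lemma Sel_good:
  assumes J: "J \<in> \<S>" and x: "x \<in> Sel J u"
  shows "\<exists>a z. good a z x"
proof (rule ccontr)
  assume bad: "\<nexists>a z. good a z x"
  have "x \<in> dcell J" by (rule Sel_subset(1)[OF x])
  then obtain l where l: "\<forall>j. 0 \<le> l j" "\<forall>j. j \<notin> J \<longrightarrow> l j = 0" "tot l = c" "comb l = x"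
    by (auto simp: dcell_def)
  have s1: "(\<Sum>j\<in>J. l j / c) = 1"
    using dcell_barycentric(2)[OF J l(2)] l(3) c_pos by (simp add: sum_divide_distrib[symmetric])
  have "(\<Sum>i\<in>{x}. 1 * weight i) \<le> (\<Sum>j\<in>J. (l j / c) * weight (real c *\<^sub>R v j))"
  proof (rule min_set_tilt_exchange(1)[where \<beta> = "\<lambda>_. 1" and p = "\<lambda>x. x"])
    show "(\<Sum>i\<in>{x}. 1 *\<^sub>R i) = (\<Sum>j\<in>J. (l j / c) *\<^sub>R (real c *\<^sub>R v j))"
      using dcell_barycentric(1)[OF J l(2)] l(4) by simp
  qed (use x l s1 finite_index[OF J] vertex_in_dcell[OF J] in auto)
  also have "\<dots> \<le> (\<Sum>j\<in>J. (l j / c) * cost_bound N c)"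
    using l weight_vertex[OF J] by (intro sum_mono mult_left_mono) auto
  also have "\<dots> = cost_bound N c" unfolding sum_distrib_right[symmetric] s1 by simp
  finally show False using bad by (simp add: weight_def)
qed

lemma Sel_rep:
  assumes J: "J \<in> \<S>" and x: "x \<in> Sel J u"
  shows "good (local_box J) (rep x) x" "\<forall>j. j \<notin> J \<longrightarrow> bary (local_box J) (rep x) j = 0"
    "comb (bary (local_box J) (rep x)) = x" "tot (bary (local_box J) (rep x)) = c"
proof -
  obtain a z where g: "good a z x" using Sel_good[OF J x] by blast
  have z: "rep x = z" by (rule rep_eq[OF g])
  have xd: "x \<in> dcell J" by (rule Sel_subset(1)[OF x])
  show g': "good (local_box J) (rep x) x" unfolding z by (rule good_local(1)[OF J xd g])
  show "\<forall>j. j \<notin> J \<longrightarrow> bary (local_box J) (rep x) j = 0" unfolding z by (rule good_local(2)[OF J xd g])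
  show "comb (bary (local_box J) (rep x)) = x" "tot (bary (local_box J) (rep x)) = c"
    using g' by (simp_all add: good_def)
qed

lemma Sel_outside:
  assumes J: "J \<in> \<S>" and x: "x \<in> Sel J u" and j: "j \<notin> J" "j \<noteq> 0"
  shows "rep x j = 0"
  using Sel_rep(2)[OF J x] j bary_support(1) by blast

lemma bary_sum:
  "(\<Sum>x\<in>X. r x * bary a (f x) j) = (if j = 0 then 0 else \<Sum>x\<in>X. r x * real (f x j)) + (\<Sum>x\<in>X. r x * real (f x 0)) * (real (a j) / V)"
  unfolding bary_def by (simp add: distrib_left sum.distrib sum_distrib_right sum_divide_distrib mult.assoc)

text \<open>The linear term with coefficient \<open>- slope\<close> is the negative of the concave function
  \<open>x \<mapsto> min {\<lambda> i * V / a i}\<close> whose domains of linearity are the cones from the box point over the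
  facets of its face. So a set of minimizers never leaves one such cone.\<close>

lemma Sel_region:
  assumes J: "J \<in> \<S>" and can: "canon (local_box J)"
  shows "\<exists>i. local_box J i \<noteq> 0 \<and> (\<forall>x\<in>Sel J u. rep x i = 0)"
proof (rule ccontr)
  assume "\<not> ?thesis"
  then have "\<forall>i. \<exists>x. local_box J i \<noteq> 0 \<longrightarrow> x \<in> Sel J u \<and> rep x i \<noteq> 0" by blast
  \<comment> \<open>For each vertex \<open>i\<close> of the box face, \<open>p i\<close> lies off
    the cone opposite to \<open>i\<close>. The average of these points is compared with a
    combination through the apex.\<close>
  then obtain p where p: "\<And>i. local_box J i \<noteq> 0 \<Longrightarrow> p i \<in> Sel J u \<and> rep (p i) i \<noteq> 0" by metis
  define a where "a = local_box J"
  have ca: "canon a" "\<forall>j. j \<notin> J \<longrightarrow> a j = 0" using can local_box_outside by (auto simp: a_def)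
  note bx = canon_box[OF ca(1)]
  define D where "D = {i. a i \<noteq> 0}"
  have DN: "D \<subseteq> {1..N}" using box_range[OF bx] by (auto simp: D_def)
  have finD: "finite D" using DN finite_subset by blast
  have D0: "D \<noteq> {}" using box_nonzero[OF bx] by (auto simp: D_def)
  define k where "k = real (card D)"
  have k: "k \<ge> 1" "k \<le> N"
    using D0 finD card_mono[OF _ DN] by (auto simp: k_def card_gt_0_iff Suc_le_eq)
  have pS: "p i \<in> Sel J u" and p0: "rep (p i) i \<noteq> 0" if "i \<in> D" for i
    using p[of i] that by (auto simp: D_def a_def)
  note rp = Sel_rep[OF J pS, folded a_def]
  define \<mu> where "\<mu> j = (\<Sum>i\<in>D. (1 / k) * real (rep (p i) j))" for j
  define l where "l j = (\<Sum>i\<in>D. (1 / k) * bary a (rep (p i)) j)" for j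
  have lj: "l j = (if j = 0 then 0 else \<mu> j) + \<mu> 0 * (a j / V)" for j
    unfolding l_def \<mu>_def bary_sum ..
  have lpos: "0 \<le> l j" for j unfolding l_def using k bary_nonneg by (intro sum_nonneg) auto
  have lJ: "l j = 0" if "j \<notin> J" for j unfolding l_def using rp(2) that by (intro sum.neutral) auto
  have k1: "(\<Sum>i\<in>D. 1 / k) = 1" using k by (simp add: k_def)
  have ltot: "tot l = c"
    unfolding l_def comb_sum(2)[OF finD] using rp(4) k1 by (simp add: sum_distrib_right[symmetric])
  have lcomb: "comb l = (\<Sum>i\<in>D. (1 / k) *\<^sub>R p i)"
    unfolding l_def comb_sum(1)[OF finD] using rp(3) by (intro sum.cong) auto
  have \<mu>pos: "\<mu> i \<ge> 1 / k" if "i \<in> D" for i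
  proof -
    have "(1 / k) * 1 \<le> (1 / k) * real (rep (p i) i)" using p0[OF that] k by (intro mult_left_mono) auto
    also have "\<dots> \<le> \<mu> i" unfolding \<mu>_def using k finD that
      by (intro member_le_sum) auto
    finally show ?thesis by simp
  qed
  \<comment> \<open>The concave function at the average. As each \<open>\<mu> i\<close> is at least
    \<open>1 / k\<close>, it exceeds the average number \<open>\<mu> 0\<close> of box points by at
    least \<open>1 / k\<close>.\<close>
  define s where "s = Min ((\<lambda>i. l i * V / a i) ` D)"
  have s_in: "s \<in> (\<lambda>i. l i * V / a i) ` D" unfolding s_def using finD D0 by (intro Min_in) auto
  have s_le: "s \<le> l i * V / a i" if "i \<in> D" for i unfolding s_def using finD that by (intro Min_le) auto
  have s_ge: "s \<ge> \<mu> 0 + 1 / k"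
  proof -
    obtain i where i: "i \<in> D" "s = l i * V / a i" using s_in by blast
    have ai: "0 < real (a i)" "real (a i) \<le> V" using i box_lt[OF bx, of i] by (auto simp: D_def)
    have i0: "i \<noteq> 0" using i DN by auto
    have "s = \<mu> i * (V / a i) + \<mu> 0" unfolding i(2) lj using i0 ai V_pos by (simp add: field_simps)
    moreover have "\<mu> i * 1 \<le> \<mu> i * (V / a i)"
      using ai \<mu>pos[OF i(1)] k by (intro mult_left_mono) (auto intro: order_trans[of 0 "1 / k"])
    ultimately show ?thesis using \<mu>pos[OF i(1)] by simp
  qed
  have \<mu>0: "0 \<le> \<mu> 0" unfolding \<mu>_def using k by (intro sum_nonneg) auto
  have s0: "0 \<le> s" using s_ge \<mu>0 k by (smt (verit) divide_nonneg_nonneg)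
  define h where "h = height a"
  define e where "e = c div h"
  have h: "h > 0" "c = e * h" using height_pos[OF bx] height_dvd[OF J bx ca(2)] by (auto simp: h_def e_def)
  have e0: "e > 0" using h c_pos by (cases e) auto
  \<comment> \<open>The average written with the apex and the dilated vertices, using as much of the
    apex as nonnegative coefficients permit.\<close>
  define q where "q j = (if j = 0 then real e *\<^sub>R comb (\<lambda>j. real (a j) / V) else real c *\<^sub>R v j)" for j
  define \<gamma> where "\<gamma> j = (if j = 0 then s / e else (l j - s * (a j / V)) / c)" for j
  have n0: "0 \<notin> J" by (rule zero_notin[OF J])
  have finJ: "finite J" by (rule finite_index[OF J])
  have \<gamma>pos: "\<gamma> j \<ge> 0" if "j \<in> insert 0 J" for j
  proof (cases "j = 0")
    case False
    have "s * (a j / V) \<le> l j"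
    proof (cases "j \<in> D")
      case True
      then have "real (a j) > 0" by (simp add: D_def)
      then show ?thesis using s_le[OF True] V_pos by (simp add: field_simps)
    qed (use lpos in \<open>simp add: D_def\<close>)
    then show ?thesis using False c_pos by (simp add: \<gamma>_def)
  qed (use s0 e0 in \<open>simp add: \<gamma>_def\<close>)
  define l' where "l' j = l j - s * (a j / V)" for j
  have l'J: "\<forall>j. j \<notin> J \<longrightarrow> l' j = 0" using lJ ca(2) by (simp add: l'_def)
  have l't: "tot l' = c - s * h" unfolding l'_def comb_simps(6,7) ltot tot_box[OF bx] h_def ..
  have l'c: "comb l' = comb l - s *\<^sub>R comb (\<lambda>j. real (a j) / V)" unfolding l'_def comb_simps(2,3) ..
  have sumJ: "(\<Sum>j\<in>J. F (\<gamma> j) (q j)) = (\<Sum>j\<in>J. F (l' j / c) (real c *\<^sub>R v j))" for F :: "real \<Rightarrow> real^'n \<Rightarrow> 'c::comm_monoid_add"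
    using n0 by (intro sum.cong) (auto simp: \<gamma>_def q_def l'_def)
  have \<gamma>1: "sum \<gamma> (insert 0 J) = 1"
  proof -
    have "sum \<gamma> (insert 0 J) = s / e + (\<Sum>j\<in>J. l' j) / c"
      using n0 finJ sumJ[of "\<lambda>g _. g"] by (simp add: \<gamma>_def[of 0] sum_divide_distrib)
    also have "(\<Sum>j\<in>J. l' j) = c - s * h" using dcell_barycentric(2)[OF J l'J] l't by simp
    also have "s / e + (real c - s * h) / c = 1" using h e0 c_pos by (simp add: field_simps)
    finally show ?thesis .
  qed
  have \<gamma>q: "(\<Sum>j\<in>insert 0 J. \<gamma> j *\<^sub>R q j) = comb l"
  proof -
    have "(\<Sum>j\<in>insert 0 J. \<gamma> j *\<^sub>R q j) = \<gamma> 0 *\<^sub>R q 0 + comb l'"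
      using n0 finJ sumJ[of "\<lambda>g x. g *\<^sub>R x"] dcell_barycentric(1)[OF J l'J] by simp
    then show ?thesis using l'c e0 by (simp add: \<gamma>_def q_def)
  qed
  note apex = good_apex[OF J ca, folded h_def, folded e_def]
  let ?za = "\<lambda>i. if i = 0 then e else (0::nat)"
  have "q 0 \<in> dcell J \<inter> int_lattice"
  proof -
    have "bary a ?za j = 0" if "j \<notin> J" for j using ca(2) that by (simp add: bary_def)
    then have "comb (bary a ?za) \<in> dcell J" using apex by (intro dcell_bary) (auto simp: good_def)
    moreover have "comb (bary a ?za) \<in> int_lattice" using bx by (intro comb_bary_lattice) simp
    moreover have "comb (bary a ?za) = q 0" using apex by (simp add: good_def q_def)
    ultimately show ?thesis by simp
  qed
  then have qA: "\<forall>j\<in>insert 0 J. q j \<in> dcell J \<inter> int_lattice"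
    using vertex_in_dcell[OF J] n0 by (auto simp: q_def)
  have "(\<Sum>i\<in>D. (1 / k) * weight (p i)) \<le> (\<Sum>j\<in>insert 0 J. \<gamma> j * weight (q j))"
    by (rule min_set_tilt_exchange(1)[OF finD _ k1 _ qA _ \<gamma>1]) (use pS \<gamma>pos finJ \<gamma>q lcomb in auto)
  also have "\<dots> \<le> (\<Sum>j\<in>insert 0 J. \<gamma> j * (cost_bound N c - (if j = 0 then slope * e else 0)))"
  proof (intro sum_mono mult_left_mono \<gamma>pos)
    fix j assume j: "j \<in> insert 0 J"
    show "weight (q j) \<le> cost_bound N c - (if j = 0 then slope * e else 0)"
    proof (cases "j = 0")
      case True
      then show ?thesis using weight_good[OF apex] good_cost_le[OF apex] by (simp add: q_def)
    next
      case False
      then show ?thesis using weight_vertex[OF J, of j] j by (simp add: q_def)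
    qed
  qed auto
  also have "\<dots> = (\<Sum>j\<in>insert 0 J. \<gamma> j * cost_bound N c) - (\<Sum>j\<in>insert 0 J. \<gamma> j * (if j = 0 then slope * e else 0))"
    by (simp add: right_diff_distrib sum_subtractf)
  also have "(\<Sum>j\<in>insert 0 J. \<gamma> j * cost_bound N c) = cost_bound N c"
    using \<gamma>1 by (simp add: sum_distrib_right[symmetric])
  also have "(\<Sum>j\<in>insert 0 J. \<gamma> j * (if j = 0 then slope * e else 0)) = slope * s"
  proof -
    have "(\<Sum>j\<in>J. \<gamma> j * (if j = 0 then slope * e else 0)) = 0" using n0 by (intro sum.neutral) auto
    then show ?thesis using n0 finJ e0 by (simp add: \<gamma>_def)
  qed
  finally have 1: "(\<Sum>i\<in>D. (1 / k) * weight (p i)) \<le> cost_bound N c - slope * s" .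
  \<comment> \<open>Costs are nonnegative, so the concave terms alone bound the average weight from
    below.\<close>
  have "- slope * \<mu> 0 = (\<Sum>i\<in>D. (1 / k) * (- slope * rep (p i) 0))"
    unfolding \<mu>_def by (simp add: sum_distrib_left sum_negf[symmetric] algebra_simps)
  also have "\<dots> \<le> (\<Sum>i\<in>D. (1 / k) * weight (p i))"
    using weight_good[OF rp(1)] k by (intro sum_mono mult_left_mono) auto
  finally have "slope * (s - \<mu> 0) \<le> cost_bound N c" using 1 by (simp add: algebra_simps)
  moreover have "slope * (1 / k) \<le> slope * (s - \<mu> 0)"
    using s_ge slope_pos by (intro mult_left_mono) auto
  moreover have "real (cost_bound N c) < slope * (1 / k)"
  proof -
    have "k * cost_bound N c < (real N + 1) * (real (cost_bound N c) + 1)"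
      using k by (intro mult_less_le_imp_less mult_strict_mono) auto
    then show ?thesis using k by (simp add: slope_def field_simps)
  qed
  ultimately show False by simp
qed

text \<open>The coordinates that stay free on the cone over the facet opposite to \<open>i\<close>.\<close>

definition region :: "nat set \<Rightarrow> nat \<Rightarrow> nat set" where
  "region J i = (if canon (local_box J) then insert 0 (J - {i}) else J)"

text \<open>Without a box point \<open>region\<close> excludes coordinate 0, and the value 1 keeps
  the height positive for the exchange argument.\<close>

definition region_height :: "nat set \<Rightarrow> nat" where
  "region_height J = (if canon (local_box J) then height (local_box J) else 1)"

definition in_region :: "nat set \<Rightarrow> real ^ 'n \<Rightarrow> nat \<Rightarrow> bool" where
  "in_region J u i \<longleftrightarrow> (canon (local_box J) \<longrightarrow> local_box J i \<noteq> 0 \<and> (\<forall>x\<in>Sel J u. rep x i = 0))"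

lemma in_region_exists: "J \<in> \<S> \<Longrightarrow> \<exists>i. in_region J u i"
  unfolding in_region_def using Sel_region by (cases "canon (local_box J)") simp_all

lemma region_tot:
  assumes "canon (local_box J) \<or> z 0 = 0"
  shows "tot (bary (local_box J) z) = real (region_height J * z 0 + (\<Sum>j=1..N. z j))"
proof -
  have "box_vector V (local_box J) \<or> z 0 = 0" using assms by (elim disjE) (simp_all add: canon_box)
  from tot_bary[of "local_box J" z, OF this] show ?thesis using assms by (auto simp: region_height_def)
qed

lemma Sel_reps:
  assumes J: "J \<in> \<S>" and i: "in_region J u i" and x: "x \<in> Sel J u"
  shows "rep x \<in> reps N c (region J i) (region_height J)"
proof -
  note rx = Sel_rep[OF J x]
  have c0: "canon (local_box J) \<or> rep x 0 = 0" using rx(1) by (auto simp: good_def)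
  have "rep x j = 0" if j: "j \<notin> region J i" for j
  proof (cases "canon (local_box J)")
    case True
    then show ?thesis
      using j i x Sel_outside[OF J x, of j] by (auto simp: region_def in_region_def)
  next
    case False
    then show ?thesis using j c0 Sel_outside[OF J x, of j] by (cases "j = 0") (auto simp: region_def)
  qed
  moreover have "region_height J * rep x 0 + (\<Sum>j=1..N. rep x j) = c"
    using region_tot[of J "rep x"] c0 rx(4) by (simp only: of_nat_eq_iff)
  ultimately show ?thesis unfolding reps_def by blast
qed

text \<open>Vectors obtained by exchanging coordinates again have the weight given by the cost. A
  canonical box vector violating the last clause of \<open>good\<close> would be supported in
  \<open>J\<close>, hence be the local one; but its support contains \<open>i\<close>, where
  \<open>z\<close> vanishes.\<close>

lemma reps_good:
  assumes J: "J \<in> \<S>" and i: "in_region J u i" and z: "z \<in> reps N c (region J i) (region_height J)"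
  shows "good (local_box J) z (comb (bary (local_box J) z))" "comb (bary (local_box J) z) \<in> dcell J \<inter> int_lattice"
proof -
  have out: "z j = 0" if "j \<notin> region J i" for j using z that by (simp add: reps_def)
  have c0: "canon (local_box J) \<or> z 0 = 0"
    using out[of 0] zero_notin[OF J] by (cases "canon (local_box J)") (simp_all add: region_def)
  have "region_height J * z 0 + (\<Sum>j=1..N. z j) = c" using z unfolding reps_def by simp
  then have t: "tot (bary (local_box J) z) = c" using region_tot[of J z, OF c0] by (simp only:)
  have zJ: "z j = 0" if "j \<notin> J" "j \<noteq> 0" for j using out[of j] that by (auto simp: region_def split: if_splits)
  have s: "\<forall>j. j \<notin> J \<longrightarrow> bary (local_box J) z j = 0"
    using zJ local_box_outside by (simp add: bary_def)
  have free: "\<exists>k. b k \<noteq> 0 \<and> z k = 0" if b: "canon b" for b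
  proof (rule ccontr)
    assume n: "\<not> ?thesis"
    have bJ: "\<forall>j. j \<notin> J \<longrightarrow> b j = 0"
    proof (intro allI impI)
      fix j assume j: "j \<notin> J"
      show "b j = 0"
      proof (rule ccontr)
        assume bj: "b j \<noteq> 0"
        then have "j \<noteq> 0" using box_range[OF canon_box[OF b] bj] by simp
        then show False using zJ[OF j] n bj by blast
      qed
    qed
    then have lb: "local_box J = b" by (rule local_box_eq[OF J b])
    then have "b i \<noteq> 0" using i b by (simp add: in_region_def)
    moreover from this have "i \<noteq> 0" using box_range[OF canon_box[OF b]] by fastforce
    then have "z i = 0" using out[of i] b lb by (simp add: region_def)
    ultimately show False using n by blast
  qed
  show "good (local_box J) z (comb (bary (local_box J) z))" unfolding good_def
  proof (intro conjI allI impI)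
    show "canon (local_box J) \<or> local_box J = (\<lambda>_. 0) \<and> z 0 = 0" using c0 local_box_cases[of J] by (elim disjE conjE) simp_all
    show "\<exists>J'\<in>\<S>. \<forall>j. j \<notin> J' \<longrightarrow> bary (local_box J) z j = 0" by (rule bexI[of _ J]) (rule s, rule J)
  qed (rule t refl free, assumption?)+
  have "box_vector V (local_box J) \<or> z 0 = 0" using c0 by (elim disjE) (simp_all add: canon_box)
  then show "comb (bary (local_box J) z) \<in> dcell J \<inter> int_lattice"
    using dcell_bary[OF s t] comb_bary_lattice by blast
qed

text \<open>Equal coordinate sums give equal sums of points and equal numbers of box points, so the
  tilts and the \<open>slope\<close> terms cancel and the costs remain.\<close>

lemma Sel_exchange:
  assumes J: "J \<in> \<S>" and i: "in_region J u i" and x: "x \<in> Sel J u" and y: "y \<in> Sel J u"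
    and z: "z \<in> reps N c (region J i) (region_height J)" and z': "z' \<in> reps N c (region J i) (region_height J)"
    and add: "\<And>j. rep x j + rep y j = z j + z' j"
  shows "cost N c (rep x) + cost N c (rep y) \<le> cost N c z + cost N c z'"
proof -
  let ?a = "local_box J"
  let ?p = "\<lambda>z. comb (bary ?a z)"
  note gz = reps_good[OF J i z] and gz' = reps_good[OF J i z']
  have addr: "real (rep x j) + real (rep y j) = real (z j) + real (z' j)" for j
    using add[of j] by (metis of_nat_add)
  have e0: "real (rep x 0) * t + real (rep y 0) * t = real (z 0) * t + real (z' 0) * t" for t
    using addr[of 0] by (metis distrib_right)
  have "(\<lambda>j. bary ?a (rep x) j + bary ?a (rep y) j) = (\<lambda>j. bary ?a z j + bary ?a z' j)"
  proof
    fix j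
    show "bary ?a (rep x) j + bary ?a (rep y) j = bary ?a z j + bary ?a z' j"
    proof -
      have "(if j = 0 then 0 else real (rep x j)) + (if j = 0 then 0 else real (rep y j)) =
          (if j = 0 then 0 else real (z j)) + (if j = 0 then 0 else real (z' j))"
        using addr[of j] by simp
      then show ?thesis using e0[of "real (?a j) / V"] unfolding bary_def by linarith
    qed
  qed
  then have "?p (rep x) + ?p (rep y) = ?p z + ?p z'"
    unfolding comb_simps(1)[symmetric] by simp
  then have pts: "x + y = ?p z + ?p z'" using Sel_rep(3)[OF J x] Sel_rep(3)[OF J y] by simp
  have "tilt weight u x \<le> tilt weight u (?p z)" "tilt weight u y \<le> tilt weight u (?p z')"
    using x y gz(2) gz'(2) unfolding min_set_def by blast+
  moreover have "u \<bullet> x + u \<bullet> y = u \<bullet> ?p z + u \<bullet> ?p z'"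
    using arg_cong[OF pts, of "\<lambda>v. u \<bullet> v"] by (simp add: inner_add_right)
  ultimately have "weight x + weight y \<le> weight (?p z) + weight (?p z')" unfolding tilt_def by linarith
  then have "real (cost N c (rep x)) + cost N c (rep y) - (slope * rep x 0 + slope * rep y 0)
      \<le> real (cost N c z) + cost N c z' - (slope * z 0 + slope * z' 0)"
    unfolding weight_good[OF Sel_rep(1)[OF J x]] weight_good[OF Sel_rep(1)[OF J y]]
      weight_good[OF gz(1)] weight_good[OF gz'(1)] by linarith
  moreover have "slope * rep x 0 + slope * rep y 0 = slope * z 0 + slope * z' 0"
    using e0[of slope] by (simp add: mult.commute)
  ultimately have "real (cost N c (rep x) + cost N c (rep y)) \<le> real (cost N c z + cost N c z')" by simp
  then show ?thesis by (simp only: of_nat_le_iff)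
qed

section \<open>Independence and volume of the cells\<close>

lemma Sel_Ints:
  fixes r :: "real ^ 'n \<Rightarrow> real"
  assumes J: "J \<in> \<S>" and fin: "finite (Sel J u)" and sum_r: "sum r (Sel J u) \<in> \<int>"
    and rep_r: "\<And>j. j \<le> N \<Longrightarrow> (\<Sum>x\<in>Sel J u. r x * rep x j) \<in> \<int>" and p: "p \<in> Sel J u"
  shows "r p \<in> \<int>"
proof -
  obtain i where i: "in_region J u i" using in_region_exists[OF J] by blast
  show ?thesis
  proof (rule exchange_Ints[where f = rep and X = "Sel J u" and N = N and c = c and J = "region J i" and h = "region_height J"])
    show "region_height J > 0"
      using height_pos canon_box unfolding region_height_def by simp
    show "region J i \<subseteq> {..N}" using index_range[OF J] by (auto simp: region_def)
    show "inj_on rep (Sel J u)"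
      by (rule inj_onI) (metis Sel_rep(3)[OF J])
    show "\<And>x. x \<in> Sel J u \<Longrightarrow> rep x \<in> reps N c (region J i) (region_height J)"
      by (rule Sel_reps[OF J i])
    show "\<And>x y z z'. \<lbrakk>x \<in> Sel J u; y \<in> Sel J u; z \<in> reps N c (region J i) (region_height J);
        z' \<in> reps N c (region J i) (region_height J); \<And>j. rep x j + rep y j = z j + z' j\<rbrakk>
        \<Longrightarrow> cost N c (rep x) + cost N c (rep y) \<le> cost N c z + cost N c z'"
      by (rule Sel_exchange[OF J i])
  qed (use fin sum_r rep_r p in auto)
qed

lemma Sel_combination:
  assumes J: "J \<in> \<S>" and fin: "finite (Sel J u)"
  shows "(\<Sum>x\<in>Sel J u. r x *\<^sub>R x) = comb (\<lambda>j. \<Sum>x\<in>Sel J u. r x * bary (local_box J) (rep x) j)"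
    "tot (\<lambda>j. \<Sum>x\<in>Sel J u. r x * bary (local_box J) (rep x) j) = sum r (Sel J u) * c"
    "j \<notin> J \<Longrightarrow> (\<Sum>x\<in>Sel J u. r x * bary (local_box J) (rep x) j) = 0"
  unfolding comb_sum[OF fin] using Sel_rep[OF J]
  by (auto simp: sum_distrib_right intro!: sum.cong sum.neutral)

text \<open>The coordinate moments of an affine relation all vanish, also after scaling. If one
  coefficient is scaled to 1/2, \<open>Sel_Ints\<close> makes it an integer.\<close>

lemma Sel_independent:
  assumes J: "J \<in> \<S>" and fin: "finite (Sel J u)"
  shows "\<not> affine_dependent (Sel J u)"
proof
  assume "affine_dependent (Sel J u)"
  then obtain r w where r: "sum r (Sel J u) = 0" "w \<in> Sel J u" "r w \<noteq> 0" "(\<Sum>x\<in>Sel J u. r x *\<^sub>R x) = 0"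
    unfolding affine_dependent_explicit_finite[OF fin] by blast
  obtain i where i: "in_region J u i" using in_region_exists[OF J] by blast
  let ?l = "\<lambda>j. \<Sum>x\<in>Sel J u. r x * bary (local_box J) (rep x) j"
  have l0: "?l j = 0" for j
    by (rule comb_zero[OF J]) (use r Sel_combination[OF J fin, where r = r] in simp_all)
  \<comment> \<open>The net number of box points in the relation. If there is a box point, it is 0
    because barycentric coordinate \<open>i\<close> of the cell comes from the box point
    alone.\<close>
  define \<rho> where "\<rho> = (\<Sum>x\<in>Sel J u. r x * real (rep x 0))"
  have e: "(if j = 0 then 0 else \<Sum>x\<in>Sel J u. r x * real (rep x j)) + \<rho> * (real (local_box J j) / V) = 0" for j
    using l0[of j] unfolding bary_sum \<rho>_def .
  have \<rho>0: "\<rho> = 0"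
  proof (cases "canon (local_box J)")
    case True
    then have ai: "local_box J i \<noteq> 0" "\<forall>x\<in>Sel J u. rep x i = 0" using i by (simp_all add: in_region_def)
    have "(\<Sum>x\<in>Sel J u. r x * real (rep x i)) = 0" using ai(2) by (intro sum.neutral) simp
    then have "\<rho> * (real (local_box J i) / V) = 0" using e[of i] by (auto split: if_splits)
    then show ?thesis using ai(1) V_pos by simp
  next
    case False
    have "rep x 0 = 0" if "x \<in> Sel J u" for x using Sel_rep(1)[OF J that] False by (simp add: good_def)
    then show ?thesis unfolding \<rho>_def by (intro sum.neutral) simp
  qed
  have zero: "(\<Sum>x\<in>Sel J u. r x * real (rep x j)) = 0" for j
    using e[of j] \<rho>0 \<rho>_def by (cases "j = 0") simp_all
  define s where "s = 1 / (2 * r w)"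
  have "s * r w \<in> \<int>"
  proof (rule Sel_Ints[OF J fin, where r = "\<lambda>x. s * r x"])
    show "(\<Sum>x\<in>Sel J u. s * r x) \<in> \<int>" using r(1) by (simp flip: sum_distrib_left)
    show "(\<Sum>x\<in>Sel J u. s * r x * real (rep x j)) \<in> \<int>" for j
      using zero[of j] by (simp add: mult.assoc flip: sum_distrib_left)
  qed (rule r(2))
  then have "(1 / 2 :: real) \<in> \<int>" using r(3) by (simp add: s_def)
  then obtain k :: int where "(1 / 2 :: real) = of_int k" by (auto elim: Ints_cases)
  then have "1 = 2 * k" by linarith
  then show False by presburger
qed

text \<open>If there is a box point, the hypotheses say that \<open>b\<close> consists of \<tau> box
  points and integer multiples of vertices other than \<open>i\<close>: the lattice in which the
  cell is unimodular. For real coefficients expressing \<open>comb b\<close> on the cell, the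
  moments are forced to be \<tau> and the integers \<open>b j - \<tau> * a j / V\<close>, where
  \<open>a\<close> is the local box vector, so the coefficients are integers.\<close>

lemma Sel_dir:
  assumes J: "J \<in> \<S>" and fin: "finite (Sel J u)" and full: "affine hull (Sel J u) = UNIV"
    and i: "in_region J u i"
    and b: "\<forall>j. j \<notin> J \<longrightarrow> b j = 0" "tot b = 0"
    and \<tau>: "\<tau> \<in> \<int>" "canon (local_box J) \<Longrightarrow> b i = \<tau> * (real (local_box J i) / V)"
      "\<And>j. b j - \<tau> * (real (local_box J j) / V) \<in> \<int>"
  shows "comb b \<in> aff_lattice_dir (Sel J u)"
proof -
  have "Sel J u \<noteq> {}" using full by force
  then obtain x0 where x0: "x0 \<in> Sel J u" by blast
  have "comb b + x0 \<in> affine hull (Sel J u)" using full by simp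
  then obtain s where s: "sum s (Sel J u) = 1" "(\<Sum>x\<in>Sel J u. s x *\<^sub>R x) = comb b + x0"
    unfolding affine_hull_finite[OF fin] by blast
  define r where "r x = s x - (if x = x0 then 1 else 0)" for x
  have r: "sum r (Sel J u) = 0" "(\<Sum>x\<in>Sel J u. r x *\<^sub>R x) = comb b"
    unfolding r_def sum_subtractf scaleR_left_diff_distrib using fin x0 s
    by (simp_all add: if_distrib[of "\<lambda>t. t *\<^sub>R _"] cong: if_cong)
  have l: "(\<lambda>j. \<Sum>x\<in>Sel J u. r x * bary (local_box J) (rep x) j) = b"
    by (rule comb_unique[OF J _ b(1)]) (use r b Sel_combination[OF J fin, where r = r] in simp_all)
  define \<rho> where "\<rho> = (\<Sum>x\<in>Sel J u. r x * real (rep x 0))"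
  have e: "(if j = 0 then 0 else \<Sum>x\<in>Sel J u. r x * real (rep x j)) + \<rho> * (real (local_box J j) / V) = b j" for j
    using fun_cong[OF l, of j] unfolding bary_sum \<rho>_def .
  have \<rho>\<tau>: "\<rho> \<in> \<int>" "\<rho> * (real (local_box J j) / V) = \<tau> * (real (local_box J j) / V)" for j
  proof -
    have "\<rho> = \<tau> \<or> \<rho> = 0 \<and> local_box J = (\<lambda>_. 0)"
    proof (cases "canon (local_box J)")
      case True
      then have ai: "local_box J i \<noteq> 0" "\<forall>x\<in>Sel J u. rep x i = 0" using i by (simp_all add: in_region_def)
      have "(\<Sum>x\<in>Sel J u. r x * real (rep x i)) = 0" using ai(2) by (intro sum.neutral) simp
      then have "\<rho> * (real (local_box J i) / V) = b i" using e[of i] by (auto split: if_splits)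
      then have "\<rho> * (real (local_box J i) / V) = \<tau> * (real (local_box J i) / V)" using \<tau>(2)[OF True] by simp
      then show ?thesis using ai(1) V_pos by simp
    next
      case False
      have "rep x 0 = 0" if "x \<in> Sel J u" for x using Sel_rep(1)[OF J that] False by (simp add: good_def)
      then have "\<rho> = 0" unfolding \<rho>_def by (intro sum.neutral) simp
      moreover have "local_box J = (\<lambda>_. 0)" using local_box_cases[of J] False by blast
      ultimately show ?thesis by (intro disjI2 conjI)
    qed
    then show "\<rho> \<in> \<int>" "\<rho> * (real (local_box J j) / V) = \<tau> * (real (local_box J j) / V)" using \<tau>(1) by auto
  qed
  have int: "(\<Sum>x\<in>Sel J u. r x * real (rep x j)) \<in> \<int>" for j
  proof (cases "j = 0")
    case True
    then show ?thesis using \<rho>\<tau>(1) by (simp add: \<rho>_def)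
  next
    case False
    then have "(\<Sum>x\<in>Sel J u. r x * real (rep x j)) + \<rho> * (real (local_box J j) / V) = b j"
      using e[of j] by (simp only: if_False)
    then have "(\<Sum>x\<in>Sel J u. r x * real (rep x j)) = b j - \<tau> * (real (local_box J j) / V)"
      using \<rho>\<tau>(2)[of j] by linarith
    then show ?thesis using \<tau>(3) by simp
  qed
  have rI: "r x \<in> \<int>" if "x \<in> Sel J u" for x
    by (rule Sel_Ints[OF J fin _ int that]) (simp add: r(1))
  have fl: "real_of_int \<lfloor>r x\<rfloor> = r x" if "x \<in> Sel J u" for x using rI[OF that] by simp
  have "comb b = (\<Sum>x\<in>Sel J u. of_int \<lfloor>r x\<rfloor> *\<^sub>R x)"
    unfolding r(2)[symmetric] by (intro sum.cong refl) (simp only: fl)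
  moreover have "real_of_int (\<Sum>x\<in>Sel J u. \<lfloor>r x\<rfloor>) = 0"
    unfolding of_int_sum r(1)[symmetric] by (intro sum.cong refl) (simp only: fl)
  then have "(\<Sum>x\<in>Sel J u. \<lfloor>r x\<rfloor>) = 0" by (simp only: of_int_eq_0_iff)
  ultimately show ?thesis unfolding aff_lattice_dir_def
    by (intro CollectI exI[of _ "\<lambda>x. \<lfloor>r x\<rfloor>"] conjI)
qed

text \<open>Coordinates over a full-dimensional cell, divided by \<open>c\<close>, show that the
  simplex of \<open>J\<close> spans the whole space.\<close>

lemma full_coordinates:
  assumes J: "J \<in> \<S>" and fin: "finite (Sel J u)" and full: "affine hull (Sel J u) = UNIV"
  shows "\<exists>l. (\<forall>j. j \<notin> J \<longrightarrow> l j = 0) \<and> tot l = 1 \<and> comb l = y"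
proof -
  have "real c *\<^sub>R y \<in> affine hull (Sel J u)" using full by simp
  then obtain s where s: "sum s (Sel J u) = 1" "(\<Sum>x\<in>Sel J u. s x *\<^sub>R x) = real c *\<^sub>R y"
    unfolding affine_hull_finite[OF fin] by blast
  let ?l = "\<lambda>j. \<Sum>x\<in>Sel J u. s x * bary (local_box J) (rep x) j"
  have "tot ?l = c" "comb ?l = real c *\<^sub>R y" "\<forall>j. j \<notin> J \<longrightarrow> ?l j = 0"
    using Sel_combination[OF J fin, where r = s] s by simp_all
  then show ?thesis using c_pos by (intro exI[of _ "\<lambda>j. ?l j / c"]) (simp add: comb_simps(4,8))
qed

text \<open>Without a box point the simplex cannot have volume \<open>V\<close>, by
  \<open>box_exists\<close>, and its vertex lattice is contained in that of the cell. With one, the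
  residue of \<open>V\<close> times coordinate \<open>i\<close> modulo \<open>?a i\<close> separates
  the classes, so there are at most \<open>?a i\<close> of them.\<close>

lemma Sel_volume:
  assumes J: "J \<in> \<S>" and fin: "finite (Sel J u)" and card: "card (Sel J u) = CARD('n) + 1"
  shows "simplex_volume (convex hull (Sel J u)) < V"
proof -
  note ind = Sel_independent[OF J fin]
  have full: "affine hull (Sel J u) = UNIV"
    using affine_independent_span_eq[OF ind] card by simp
  obtain i where i: "in_region J u i" using in_region_exists[OF J] by blast
  let ?a = "local_box J"
  show ?thesis
  proof (cases "canon ?a")
    case False
    then have a0: "?a = (\<lambda>_. 0)" using local_box_cases by blast
    let ?f = "coset (aff_lattice_dir (v ` J))"
    have UN: "affine hull (v ` J) = UNIV"
      using full_coordinates[OF J fin full] affine_hull_iff[OF J] by auto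
    have vol: "simplex_volume (convex hull (v ` J)) = card (?f ` int_lattice)"
      unfolding simplex_volume_coset[OF J] UN by simp
    have "simplex_volume (convex hull (Sel J u)) \<le> card (?f ` int_lattice)"
    proof (rule simplex_volume_le[OF ind card])
      show "finite (?f ` int_lattice)" using finite_coset[OF J] unfolding UN by simp
      fix x y assume "?f x = ?f y"
      then have "x - y \<in> aff_lattice_dir (v ` J)" using coset_eq_iff[OF diff_closed_aff_lattice_dir] by blast
      then obtain b where b: "\<forall>j. j \<notin> J \<longrightarrow> b j = 0" "\<forall>j. b j \<in> \<int>" "tot b = 0" "comb b = x - y"
        unfolding aff_lattice_dir_iff[OF J] by blast
      have "comb b \<in> aff_lattice_dir (Sel J u)"
        by (rule Sel_dir[OF J fin full i b(1,3), of 0]) (use b False in simp_all)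
      then show "x - y \<in> aff_lattice_dir (Sel J u)" using b(4) by simp
    qed
    moreover have "simplex_volume (convex hull (v ` J)) \<noteq> V"
    proof
      assume vV: "simplex_volume (convex hull (v ` J)) = V"
      obtain b where b: "box_vector V b" "\<forall>j. j \<notin> J \<longrightarrow> b j = 0"
        using box_exists[OF J prime_ge_2_nat[OF prime_V] vV] by blast
      obtain a where a: "canon a" "\<forall>j. a j = 0 \<longleftrightarrow> b j = 0" using canon_exists[OF b(1)] by blast
      then have "local_box J = a" using b(2) by (intro local_box_eq[OF J]) simp_all
      then show False using a(1) False by simp
    qed
    ultimately show ?thesis using volume_le[OF J] vol by linarith
  next
    case True
    note bx = canon_box[OF True]
    have aJ: "\<forall>j. j \<notin> J \<longrightarrow> ?a j = 0" using local_box_outside by blast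
    have ai: "?a i > 0" "?a i < V" using i True box_lt[OF bx] by (auto simp: in_region_def)
    obtain L where L: "\<And>y. (\<forall>j. j \<notin> J \<longrightarrow> L y j = 0) \<and> tot (L y) = 1 \<and> comb (L y) = y"
      using full_coordinates[OF J fin full] by metis
    define f where "f y = \<lfloor>V * L y i\<rfloor> mod int (?a i)" for y
    \<comment> \<open>Modulo integers a lattice point is a multiple of the box point, whose
      coordinates have denominator \<open>V\<close>; so the floor in \<open>f\<close> loses
      nothing.\<close>
    have VL: "real V * L y i \<in> \<int>" if y: "y \<in> int_lattice" for y
    proof -
      obtain r :: nat where "\<forall>j. L y j - r * ?a j / V \<in> \<int>"
        using box_coset[OF J prime_V volume_le[OF J] bx aJ, of "L y"] L[of y] y by auto
      then have "L y i - r * ?a i / V \<in> \<int>" by blast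
      then have 1: "real V * (L y i - r * ?a i / V) + real (r * ?a i) \<in> \<int>" by (intro Ints_add Ints_mult) auto
      have 2: "real V * (L y i - r * ?a i / V) + real (r * ?a i) = real V * L y i"
        using V_pos by (simp add: field_simps)
      show ?thesis using 1 unfolding 2 .
    qed
    have rng: "f ` int_lattice \<subseteq> {0..<int (?a i)}" using ai by (auto simp: f_def)
    have "simplex_volume (convex hull (Sel J u)) \<le> card (f ` int_lattice)"
    proof (rule simplex_volume_le[OF ind card])
      show "finite (f ` int_lattice)" using rng finite_subset by blast
      fix x y :: "real^'n" assume xy: "x \<in> int_lattice" "y \<in> int_lattice" "f x = f y"
      define b where "b = (\<lambda>j. L x j - L y j)"
      have b: "\<forall>j. j \<notin> J \<longrightarrow> b j = 0" "tot b = 0" "comb b = x - y"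
        unfolding b_def comb_simps(2,6) using L[of x] L[of y] by simp_all
      have "int (?a i) dvd \<lfloor>V * L x i\<rfloor> - \<lfloor>V * L y i\<rfloor>" using xy(3) by (simp add: f_def mod_eq_dvd_iff)
      then obtain t where t: "\<lfloor>V * L x i\<rfloor> - \<lfloor>V * L y i\<rfloor> = int (?a i) * t" by (rule dvdE)
      have "real V * b i = real_of_int (\<lfloor>V * L x i\<rfloor> - \<lfloor>V * L y i\<rfloor>)"
        using VL[OF xy(1)] VL[OF xy(2)] by (simp add: b_def right_diff_distrib)
      then have Vb: "real V * b i = ?a i * of_int t" unfolding t by simp
      then have bi: "b i = of_int t * (?a i / V)" using V_pos by (simp add: field_simps)
      have "comb b \<in> int_lattice" using b(3) xy int_lattice_diff by simp
      then obtain r :: nat where "\<forall>j. b j - r * ?a j / V \<in> \<int>"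
        using box_coset[OF J prime_V volume_le[OF J] bx aJ b(1)] b(2) by auto
      then have r: "b j - r * ?a j / V \<in> \<int>" for j by blast
      \<comment> \<open>Coordinate \<open>i\<close> demands \<open>t\<close> box points, the class
        of \<open>b\<close> demands \<open>r\<close> of them modulo \<open>V\<close>. As
        \<open>V\<close> does not divide \<open>?a i\<close>, the two agree modulo \<open>V\<close>.
        The absolute value is taken because \<open>Ints_div_V\<close> speaks of naturals.\<close>
      define m where "m = nat \<bar>t - int r\<bar>"
      have "real_of_int (t - int r) * real (?a i) / V \<in> \<int>"
      proof -
        have "b i - r * ?a i / V = real_of_int (t - int r) * real (?a i) / V"
          unfolding bi by (simp add: diff_divide_distrib left_diff_distrib)
        then show ?thesis using r[of i] by simp
      qed
      moreover have "real m = real_of_int (t - int r) \<or> real m = - real_of_int (t - int r)"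
        by (auto simp: m_def abs_if)
      then have "real m * real (?a i) / V = real_of_int (t - int r) * real (?a i) / V \<or>
          real m * real (?a i) / V = - (real_of_int (t - int r) * real (?a i) / V)"
        by (elim disjE; simp only: mult_minus_left minus_divide_left[symmetric] simp_thms)
      ultimately have "real m * real (?a i) / V \<in> \<int>" by (metis Ints_minus)
      then have "V dvd m" using Ints_div_V ai by blast
      then have "int V dvd t - int r" by (simp add: m_def)
      then obtain w where w: "t - int r = int V * w" by (rule dvdE)
      have "b j - of_int t * (?a j / V) \<in> \<int>" for j
      proof -
        have "of_int t = real r + real V * of_int w" using arg_cong[OF w, of real_of_int] by simp
        then have "b j - of_int t * (?a j / V) = (b j - r * ?a j / V) - of_int (w * int (?a j))"
          using V_pos by (simp add: field_simps)
        then show ?thesis using r[of j] by (metis Ints_diff Ints_of_int)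
      qed
      then have "comb b \<in> aff_lattice_dir (Sel J u)"
        by (intro Sel_dir[OF J fin full i b(1,2), of "of_int t"] bi) simp_all
      then show "x - y \<in> aff_lattice_dir (Sel J u)" using b(3) by simp
    qed
    also have "\<dots> \<le> card {0..<int (?a i)}" using rng by (intro card_mono) auto
    finally show ?thesis using ai(2) by simp
  qed
qed

end

section \<open>Triangulations\<close>

lemma (in dilated_complex) dilate_hull:
  assumes J: "J \<in> \<S>"
  shows "dilate c (convex hull (v ` J)) = dcell J"
proof -
  have fin: "finite (v ` J)" using finite_index[OF J] by simp
  have hull: "convex hull (v ` J) = {comb l | l. (\<forall>j. 0 \<le> l j) \<and> (\<forall>j. j \<notin> J \<longrightarrow> l j = 0) \<and> tot l = 1}"
  proof (intro equalityI subsetI)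
    fix x assume "x \<in> convex hull (v ` J)"
    then obtain w where w: "\<forall>y\<in>v ` J. 0 \<le> w y" "sum w (v ` J) = 1" "(\<Sum>y\<in>v ` J. w y *\<^sub>R y) = x"
      unfolding convex_hull_finite[OF fin] by blast
    then show "x \<in> {comb l | l. (\<forall>j. 0 \<le> l j) \<and> (\<forall>j. j \<notin> J \<longrightarrow> l j = 0) \<and> tot l = 1}"
      unfolding sum_vertices[OF J]
      by (intro CollectI exI[of _ "\<lambda>j. if j \<in> J then w (v j) else 0"]) simp
  next
    fix x assume "x \<in> {comb l | l. (\<forall>j. 0 \<le> l j) \<and> (\<forall>j. j \<notin> J \<longrightarrow> l j = 0) \<and> tot l = 1}"
    then obtain l where l: "\<forall>j. 0 \<le> l j" "\<forall>j. j \<notin> J \<longrightarrow> l j = 0" "tot l = 1" "x = comb l" by blast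
    have s: "tot l = sum l J" "comb l = (\<Sum>j\<in>J. l j *\<^sub>R v j)"
      unfolding tot_def comb_def using l(2) index_range[OF J] by (auto intro!: sum.mono_neutral_right)
    show "x \<in> convex hull (v ` J)"
      unfolding l(4) s(2) using l s(1) finite_index[OF J] by (intro convex_sum) (auto intro: hull_inc)
  qed
  show ?thesis
  proof (intro equalityI subsetI)
    fix x assume "x \<in> dilate c (convex hull (v ` J))"
    then obtain l where l: "\<forall>j. 0 \<le> l j" "\<forall>j. j \<notin> J \<longrightarrow> l j = 0" "tot l = 1" "x = real c *\<^sub>R comb l"
      unfolding dilate_def hull by blast
    then show "x \<in> dcell J"
      unfolding dcell_def by (intro CollectI exI[of _ "\<lambda>j. c * l j"]) (simp add: comb_simps(3,7))
  next
    fix x assume "x \<in> dcell J"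
    then obtain l where l: "\<forall>j. 0 \<le> l j" "\<forall>j. j \<notin> J \<longrightarrow> l j = 0" "tot l = c" "x = comb l"
      unfolding dcell_def by blast
    have "comb (\<lambda>j. l j / c) \<in> convex hull (v ` J)"
      unfolding hull using l c_pos by (intro CollectI exI[of _ "\<lambda>j. l j / c"]) (simp add: comb_simps(8))
    moreover have "x = real c *\<^sub>R comb (\<lambda>j. l j / c)" unfolding l(4) comb_simps(4) using c_pos by simp
    ultimately show "x \<in> dilate c (convex hull (v ` J))" unfolding dilate_def by blast
  qed
qed

lemma simplex_vertices:
  assumes "n simplex S"
  shows "finite (vertices S)" "\<not> affine_dependent (vertices S)" "convex hull (vertices S) = S"
proof -
  obtain C where C: "\<not> affine_dependent C" "S = convex hull C" using assms by (auto simp: simplex_def)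
  have "vertices S = C"
    unfolding vertices_def C(2) using extreme_point_of_convex_hull_affine_independent[OF C(1)] by simp
  then show "finite (vertices S)" "\<not> affine_dependent (vertices S)" "convex hull (vertices S) = S"
    using C aff_independent_finite by simp_all
qed

lemma linear_dilate: "linear (\<lambda>x. real c *\<^sub>R x)"
  by (simp add: linear_iff scaleR_right_distrib)

lemma inj_dilate: "c > 0 \<Longrightarrow> inj (\<lambda>x. real c *\<^sub>R (x :: 'a::real_vector))"
  by (simp add: inj_on_def)

lemma simplicial_complex_dilate:
  assumes c: "c > 0" and T: "simplicial_complex \<T>"
  shows "simplicial_complex (dilate c ` \<T>)"
proof -
  let ?f = "\<lambda>x :: real^'a. real c *\<^sub>R x"
  have d: "dilate c = image ?f" by (rule ext) (simp add: dilate_def)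
  note lin = linear_dilate[of c] and inj = inj_dilate[OF c]
  show ?thesis unfolding simplicial_complex_def d
  proof (intro conjI ballI allI impI)
    show "finite ((`) ?f ` \<T>)" using T by (simp add: simplicial_complex_def)
  next
    fix S assume "S \<in> (`) ?f ` \<T>"
    then obtain S' where S': "S' \<in> \<T>" "S = ?f ` S'" by blast
    then obtain n where n: "n simplex S'" using T by (auto simp: simplicial_complex_def)
    then obtain C where C: "\<not> affine_dependent C" "int (card C) = n + 1" "S' = convex hull C"
      by (auto simp: simplex_def)
    have "S = convex hull (?f ` C)" unfolding S' C(3) by (rule convex_hull_linear_image[OF lin])
    moreover have card: "card (?f ` C) = card C" using inj by (intro card_image) (auto intro: inj_on_subset)
    moreover have "\<not> affine_dependent (?f ` C)"
      using C(1) card aff_dim_injective_linear_image[OF lin inj, of C] by (simp add: affine_independent_iff_card)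
    ultimately have "n simplex S" unfolding simplex_def using C(2) by metis
    then show "\<exists>n. n simplex S" by blast
  next
    fix F S assume FS: "S \<in> (`) ?f ` \<T> \<and> F face_of S"
    then obtain S' where S': "S' \<in> \<T>" "S = ?f ` S'" by blast
    then have "F \<in> {T. T face_of ?f ` S'}" using FS by simp
    then have "F \<in> (`) ?f ` {T. T face_of S'}" unfolding faces_of_linear_image[OF lin inj] .
    then obtain F' where "F' face_of S'" "F = ?f ` F'" by blast
    then show "F \<in> (`) ?f ` \<T>" using T S' unfolding simplicial_complex_def by blast
  next
    fix S R assume SR: "S \<in> (`) ?f ` \<T> \<and> R \<in> (`) ?f ` \<T>"
    then obtain S' R' where S': "S' \<in> \<T>" "S = ?f ` S'" and R': "R' \<in> \<T>" "R = ?f ` R'" by blast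
    have "S' \<inter> R' face_of S'" using T S' R' unfolding simplicial_complex_def by blast
    then have "?f ` (S' \<inter> R') face_of ?f ` S'" unfolding face_of_linear_image[OF lin inj] .
    then show "S \<inter> R face_of S" unfolding S' R' image_Int[OF inj] .
  qed
qed

lemma vertices_dilate_subset:
  assumes "vertices S \<subseteq> int_lattice" "convex hull (vertices S) = S"
  shows "vertices (dilate c S) \<subseteq> int_lattice"
proof
  fix x assume x: "x \<in> vertices (dilate c S)"
  have "dilate c S = convex hull ((\<lambda>x. real c *\<^sub>R x) ` vertices S)"
    unfolding dilate_def convex_hull_linear_image[OF linear_dilate, symmetric] assms(2) ..
  then have "x \<in> (\<lambda>x. real c *\<^sub>R x) ` vertices S"
    using x extreme_point_of_convex_hull unfolding vertices_def by auto
  then show "x \<in> int_lattice" using assms(1) int_lattice_scaleR_of_int[of _ "int c"] by auto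
qed

section \<open>Numbering the vertices of a triangulation\<close>

locale indexed_triangulation =
  fixes \<T> :: "(real ^ 'n) set set" and vv :: "nat \<Rightarrow> real ^ 'n" and N :: nat
  assumes complex: "simplicial_complex \<T>"
    and lattice: "S \<in> \<T> \<Longrightarrow> vertices S \<subseteq> int_lattice"
    and bij: "bij_betw vv {1..N} (\<Union>(vertices ` \<T>))"
begin

definition index_set :: "(real ^ 'n) set \<Rightarrow> nat set" where
  "index_set S = {j \<in> {1..N}. vv j \<in> S}"

lemma is_simplex: "S \<in> \<T> \<Longrightarrow> \<exists>n. n simplex S"
  using complex by (simp add: simplicial_complex_def)

text \<open>The singleton of a vertex of any simplex is itself in the complex, so it meets
  \<open>S\<close> in a face of \<open>S\<close>. This is why \<open>index_set\<close> can test mere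
  membership in \<open>S\<close>.\<close>

lemma vertex_of_containing:
  assumes "S \<in> \<T>" "j \<in> index_set S"
  shows "vv j \<in> vertices S"
proof -
  have "vv j \<in> \<Union>(vertices ` \<T>)" using assms(2) bij by (auto simp: index_set_def bij_betw_def)
  then obtain R where R: "R \<in> \<T>" "vv j extreme_point_of R" by (auto simp: vertices_def)
  then have "{vv j} \<in> \<T>" using complex unfolding simplicial_complex_def by (metis face_of_singleton)
  then have "S \<inter> {vv j} face_of S" using complex assms(1) unfolding simplicial_complex_def by blast
  moreover have "S \<inter> {vv j} = {vv j}" using assms(2) by (auto simp: index_set_def)
  ultimately show ?thesis by (simp add: vertices_def face_of_singleton)
qed

lemma image_index_set:
  assumes S: "S \<in> \<T>"
  shows "vv ` index_set S = vertices S"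
proof (intro equalityI subsetI)
  fix x assume x: "x \<in> vertices S"
  then have "x \<in> vv ` {1..N}" using bij S by (auto simp: bij_betw_def)
  moreover have "x \<in> S" using x by (auto simp: vertices_def extreme_point_of_def)
  ultimately show "x \<in> vv ` index_set S" by (auto simp: index_set_def)
qed (use vertex_of_containing[OF S] in auto)

text \<open>The point lies in the face \<open>S \<inter> S'\<close> of \<open>S\<close>, so every
  vertex of \<open>S\<close> with a positive coefficient lies in that face.\<close>

lemma hat_subset:
  assumes S: "S \<in> \<T>" "S' \<in> \<T>"
    and l: "\<forall>j. 0 \<le> l j" "\<forall>j. j \<notin> index_set S \<longrightarrow> l j = 0" "(\<Sum>j=1..N. l j) = t" "(\<Sum>j=1..N. l j *\<^sub>R vv j) = t *\<^sub>R x"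
    and x: "x \<in> S'" and t: "t > 0" and j: "j \<notin> index_set S'"
  shows "l j = 0"
proof (rule ccontr)
  assume lj: "l j \<noteq> 0"
  let ?J = "index_set S"
  have fin: "finite ?J" "?J \<subseteq> {1..N}" by (auto simp: index_set_def)
  have s1: "(\<Sum>j\<in>?J. l j) = t" using l(2,3) fin by (subst l(3)[symmetric], intro sum.mono_neutral_left) auto
  have s2: "(\<Sum>j\<in>?J. l j *\<^sub>R vv j) = t *\<^sub>R x"
    using l(2,4) fin by (subst l(4)[symmetric], intro sum.mono_neutral_left) auto
  have b1: "(\<Sum>j\<in>?J. l j / t) = 1" using s1 t by (simp add: sum_divide_distrib[symmetric])
  have "(\<Sum>j\<in>?J. (l j / t) *\<^sub>R vv j) = (1 / t) *\<^sub>R (\<Sum>j\<in>?J. l j *\<^sub>R vv j)"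
    by (simp add: scaleR_sum_right)
  then have b2: "(\<Sum>j\<in>?J. (l j / t) *\<^sub>R vv j) = x" using s2 t by simp
  have conv: "convex S" using is_simplex[OF S(1)] convex_simplex by blast
  have mem: "vv i \<in> S" if "i \<in> ?J" for i using that by (simp add: index_set_def)
  have "x \<in> S" unfolding b2[symmetric] using fin conv b1 l(1) t mem by (intro convex_sum) auto
  then have xS: "(\<Sum>j\<in>?J. (l j / t) *\<^sub>R vv j) \<in> S \<inter> S'" using x b2 by simp
  have face: "S \<inter> S' face_of S" using complex S unfolding simplicial_complex_def by blast
  have jJ: "j \<in> ?J" using l(2) lj by blast
  have "l j / t > 0" using l(1) lj t by (simp add: less_le)
  then have "vv j \<in> S \<inter> S'"
    using convex_combination_in_face[OF face conv fin(1) mem _ b1 xS jJ] l(1) t by simp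
  then show False using j jJ by (simp add: index_set_def)
qed

lemma hat_unique_same:
  assumes S: "S \<in> \<T>" and l: "\<forall>j. j \<notin> index_set S \<longrightarrow> l j = 0" "(\<Sum>j=1..N. l j) = 0" "(\<Sum>j=1..N. l j *\<^sub>R vv j) = 0"
  shows "l j = 0"
proof (rule ccontr)
  assume lj: "l j \<noteq> 0"
  let ?J = "index_set S"
  have fin: "finite ?J" "?J \<subseteq> {1..N}" by (auto simp: index_set_def)
  have inj: "inj_on vv ?J" using bij fin(2) by (auto simp: bij_betw_def intro: inj_on_subset)
  obtain n where "n simplex S" using is_simplex[OF S] by blast
  note sv = simplex_vertices[OF this]
  define u where "u w = l (the_inv_into ?J vv w)" for w
  have u: "u (vv i) = l i" if "i \<in> ?J" for i using the_inv_into_f_f[OF inj that] by (simp add: u_def)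
  have s1: "(\<Sum>j\<in>?J. l j) = 0" using l(1) fin by (subst l(2)[symmetric], intro sum.mono_neutral_left) auto
  have s2: "(\<Sum>j\<in>?J. l j *\<^sub>R vv j) = 0"
    using l(1) fin by (subst l(3)[symmetric], intro sum.mono_neutral_left) auto
  have "sum u (vv ` ?J) = 0" "(\<Sum>w\<in>vv ` ?J. u w *\<^sub>R w) = 0"
    unfolding sum.reindex[OF inj] o_def using s1 s2 u by (simp_all cong: sum.cong)
  moreover have "j \<in> ?J" using l(1) lj by blast
  then have "vv j \<in> vv ` ?J" "u (vv j) \<noteq> 0" using u lj by auto
  ultimately have "affine_dependent (vertices S)"
    unfolding image_index_set[OF S] affine_dependent_explicit_finite[OF sv(1)] by blast
  then show False using sv(2) by blast
qed

text \<open>By \<open>hat_subset\<close> the coordinates from \<open>S\<close> are supported on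
  \<open>S'\<close> as well, and on a single simplex affine independence decides.\<close>

lemma indexed_complex: "indexed_complex vv N (index_set ` \<T>)"
proof
  fix J assume "J \<in> index_set ` \<T>"
  then show "J \<subseteq> {1..N}" by (auto simp: index_set_def)
next
  fix j assume "j \<in> {1..N}"
  then have "vv j \<in> \<Union>(vertices ` \<T>)" using bij by (auto simp: bij_betw_def)
  then show "vv j \<in> int_lattice" using lattice by blast
next
  fix J J' and l l' :: "nat \<Rightarrow> real"
  assume JJ': "J \<in> index_set ` \<T>" "J' \<in> index_set ` \<T>" and l0: "\<forall>j. 0 \<le> l j" "\<forall>j. 0 \<le> l' j"
    and lJ: "\<forall>j. j \<notin> J \<longrightarrow> l j = 0" "\<forall>j. j \<notin> J' \<longrightarrow> l' j = 0"
    and t: "(\<Sum>j=1..N. l j) = (\<Sum>j=1..N. l' j)" and eq: "(\<Sum>j=1..N. l j *\<^sub>R vv j) = (\<Sum>j=1..N. l' j *\<^sub>R vv j)"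
  obtain S S' where S: "S \<in> \<T>" "J = index_set S" "S' \<in> \<T>" "J' = index_set S'" using JJ' by blast
  define s where "s = (\<Sum>j=1..N. l' j)"
  have "l j = l' j" for j
  \<comment> \<open>Nonnegative coordinates with total 0 vanish; any other total can be normalised
    to a genuine point of \<open>S'\<close>.\<close>
  proof (cases "s = 0")
    case True
    have "l j = 0 \<and> l' j = 0"
    proof (cases "j \<in> {1..N}")
      case True
      then show ?thesis
        using sum_nonneg_0[of "{1..N}" l j] sum_nonneg_0[of "{1..N}" l' j] l0 t \<open>s = 0\<close> by (simp add: s_def)
    next
      case False
      then have "j \<notin> J" "j \<notin> J'" unfolding S by (auto simp: index_set_def)
      then show ?thesis using lJ by simp
    qed
    then show ?thesis by simp
  next
    case False
    have "s \<ge> 0" unfolding s_def using l0 by (intro sum_nonneg) auto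
    then have s: "s > 0" using False by simp
    define x where "x = (\<Sum>j\<in>J'. (l' j / s) *\<^sub>R vv j)"
    have fin: "finite J'" "J' \<subseteq> {1..N}" unfolding S by (auto simp: index_set_def)
    have sJ: "(\<Sum>j\<in>J'. l' j) = s" unfolding s_def using lJ(2) fin by (intro sum.mono_neutral_left) auto
    have cJ: "(\<Sum>j\<in>J'. l' j *\<^sub>R vv j) = (\<Sum>j=1..N. l' j *\<^sub>R vv j)" using lJ(2) fin by (intro sum.mono_neutral_left) auto
    have "convex S'" using is_simplex[OF S(3)] convex_simplex by blast
    moreover have "(\<Sum>j\<in>J'. l' j / s) = 1" using sJ s by (simp add: sum_divide_distrib[symmetric])
    ultimately have x: "x \<in> S'" unfolding x_def using fin l0 s S(4)
      by (intro convex_sum) (auto simp: index_set_def)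
    have sx: "s *\<^sub>R x = (\<Sum>j=1..N. l' j *\<^sub>R vv j)"
      unfolding x_def cJ[symmetric] using s by (simp add: scaleR_sum_right)
    have "l i = 0" if "i \<notin> J'" for i
      using that unfolding S(4)
      by (intro hat_subset[OF S(1,3) l0(1) _ _ _ x s]) (use lJ S t eq sx s_def in auto)
    then have "l j - l' j = 0"
      using lJ(2) t eq unfolding S(4)
      by (intro hat_unique_same[OF S(3), of "\<lambda>j. l j - l' j"])
        (auto simp: sum_subtractf scaleR_left_diff_distrib)
    then show ?thesis by simp
  qed
  then show "l = l'" by blast
qed

end

theorem theorem4p21:
  fixes P :: "(real ^ 'n) set" and \<T> :: "(real ^ 'n) set set" and V c :: nat
  assumes "lattice_polytope P"
    and "aff_dim P = int CARD('n)"
    and "lattice_triangulation \<T> P"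
    and "prime V"
    and "\<forall>F\<in>\<T>. simplex_volume F \<le> V"
    and "c > 0"
    and "fact CARD('n) dvd c"
  shows "\<exists>\<T>'. regular_refinement \<T>' (dilate c ` \<T>) (dilate c P) \<and>
           (\<forall>F\<in>\<T>'. aff_dim F = int CARD('n) \<longrightarrow> simplex_volume F < V)"
proof -
  have complex: "simplicial_complex \<T>" and UnT: "\<Union>\<T> = P"
    and latT: "\<And>S. S \<in> \<T> \<Longrightarrow> vertices S \<subseteq> int_lattice"
    using assms(3) by (auto simp: lattice_triangulation_def)
  have simplexT: "\<exists>n. n simplex S" if "S \<in> \<T>" for S using complex that by (simp add: simplicial_complex_def)
  have "finite \<T>" using complex by (simp add: simplicial_complex_def)
  then have "finite (\<Union>(vertices ` \<T>))" using simplexT simplex_vertices(1) by blast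
  then obtain vv where bij: "bij_betw vv {1..card (\<Union>(vertices ` \<T>))} (\<Union>(vertices ` \<T>))"
    using ex_bij_betw_nat_finite_1 by blast
  define N where "N = card (\<Union>(vertices ` \<T>))"
  interpret I: indexed_triangulation \<T> vv N
    by unfold_locales (use complex latT bij N_def in auto)
  have hull: "convex hull (vv ` I.index_set S) = S" if "S \<in> \<T>" for S
    using I.image_index_set[OF that] simplex_vertices(3) simplexT[OF that] by metis
  interpret IC: indexed_complex vv N "I.index_set ` \<T>" by (rule I.indexed_complex)
  interpret D: dilated_complex vv N "I.index_set ` \<T>" V c
    by unfold_locales (use assms(4-7) hull in auto)
  have cell: "dilate c S = D.dcell (I.index_set S)" if "S \<in> \<T>" for S
    using D.dilate_hull[of "I.index_set S"] hull[OF that] that by simp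
  have cell_compact: "finite (dilate c S \<inter> int_lattice)" if S: "S \<in> \<T>" for S
  proof -
    have "bounded S" using simplexT[OF S] compact_simplex compact_imp_bounded by blast
    then have "bounded (dilate c S)" unfolding dilate_def by (rule bounded_scaling)
    then show ?thesis by (rule finite_bounded_int_lattice)
  qed
  have ind: "finite (min_set (tilt D.weight u) (dilate c S \<inter> int_lattice))"
    "\<not> affine_dependent (min_set (tilt D.weight u) (dilate c S \<inter> int_lattice))" if S: "S \<in> \<T>" for S u
  proof -
    show fin: "finite (min_set (tilt D.weight u) (dilate c S \<inter> int_lattice))"
      using cell_compact[OF S] min_set_subset by (rule finite_subset[rotated])
    then show "\<not> affine_dependent (min_set (tilt D.weight u) (dilate c S \<inter> int_lattice))"
      unfolding cell[OF S] using S by (intro D.Sel_independent) simp_all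
  qed
  have "P \<noteq> {}" using assms(2) by auto
  then have nonempty: "\<T> \<noteq> {}" using UnT by auto
  interpret L: lifted_complex "dilate c ` \<T>" D.weight
  proof
    show "simplicial_complex (dilate c ` \<T>)" by (rule simplicial_complex_dilate[OF assms(6) complex])
    show "dilate c ` \<T> \<noteq> {}" using nonempty by simp
    show "vertices C \<subseteq> int_lattice" if C: "C \<in> dilate c ` \<T>" for C
    proof -
      obtain S where S: "S \<in> \<T>" "C = dilate c S" using C by blast
      obtain n where "n simplex S" using simplexT[OF S(1)] by blast
      then show ?thesis unfolding S(2) using latT[OF S(1)] simplex_vertices(3) by (intro vertices_dilate_subset) auto
    qed
    show "\<not> affine_dependent (min_set (tilt D.weight u) (C \<inter> int_lattice))" if "C \<in> dilate c ` \<T>" for C u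
      using that ind(2) by blast
  qed
  have "\<Union>(dilate c ` \<T>) = dilate c P" unfolding UnT[symmetric] dilate_def by blast
  then have "regular_refinement L.subdivision (dilate c ` \<T>) (dilate c P)"
    using L.regular_refinement_subdivision by simp
  moreover have "simplex_volume F < V" if F: "F \<in> L.subdivision" "aff_dim F = int CARD('n)" for F
  proof -
    have "F \<noteq> {}" using F(2) by auto
    then obtain C u where C: "C \<in> dilate c ` \<T>" "F = convex hull (L.cell C u)"
      using F(1) L.subdivision_iff by blast
    then obtain S where S: "S \<in> \<T>" "C = dilate c S" by blast
    have F_eq: "F = convex hull (D.Sel (I.index_set S) u)"
      unfolding C(2) L.cell_def S(2) cell[OF S(1)] ..
    have fin: "finite (D.Sel (I.index_set S) u)" using ind(1)[OF S(1)] unfolding cell[OF S(1)] .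
    have SS: "I.index_set S \<in> I.index_set ` \<T>" using S(1) by simp
    \<comment> \<open>The minimisers are affinely independent, so the dimension of their hull
      determines their number.\<close>
    have "int (card (D.Sel (I.index_set S) u)) = CARD('n) + 1"
      using aff_dim_affine_independent[OF D.Sel_independent[OF SS fin]] F(2)[unfolded F_eq aff_dim_convex_hull] by simp
    then show ?thesis unfolding F_eq by (intro D.Sel_volume[OF SS fin]) simp
  qed
  ultimately show ?thesis by blast
qed

end
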